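(* Let $n\ge 2$. For each $i=1,\ldots,n$, let $\mathcal{H}_{k_i}$ be the Dirichlet space, the Bergman space or the Hardy space over $\mathbb{D}$, and let $\mathcal{Q}_i$ be a proper closed shift co-invariant (that is, $M_z^*$-invariant) subspace of $\mathcal{H}_{k_i}$. If, for all $i=1,\ldots,n$, $\mathcal{Q}_i^\perp$ is a zero-based $M_z$-invariant subspace of $\mathcal{H}_{k_i}$ and $$\dim(\mathcal{Q}_i^\perp\ominus z\mathcal{Q}_i^\perp)<\infty,$$ then $$\operatorname{mult}_{M_{\boldsymbol{z}}|_{(\mathcal{Q}_1\otimes\cdots\otimes\mathcal{Q}_n)^\perp}}\big((\mathcal{Q}_1\otimes\cdots\otimes\mathcal{Q}_n)^\perp\big)=\sum_{i=1}^n\operatorname{mult}_{M_z|_{\mathcal{Q}_i^\perp}}(\mathcal{Q}_i^\perp)=\sum_{i=1}^n\dim(\mathcal{Q}_i^\perp\ominus z\mathcal{Q}_i^\perp),$$ where $(\mathcal{Q}_1\otimes\cdots\otimes\mathcal{Q}_n)^\perp$ is the orthogonal complement in $\mathcal{H}_{k_1}\otimes\cdots\otimes\mathcal{H}_{k_n}$.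
   Context: $\mathbb{D}$ is the open unit disc in $\mathbb{C}$. The Hardy, Dirichlet and Bergman spaces over $\mathbb{D}$ are the Hilbert spaces of analytic functions $f(z)=\sum_{m\ge0}a_mz^m$ on $\mathbb{D}$ with, respectively, $\|f\|^2=\sum_m|a_m|^2<\infty$, $\|f\|^2=\sum_m(m+1)|a_m|^2<\infty$, and $\|f\|^2=\sum_m|a_m|^2/(m+1)<\infty$. $M_z$ denotes multiplication by the coordinate function $z$. $\mathcal{S}\ominus z\mathcal{S}$ is the orthogonal complement of $z\mathcal{S}$ in $\mathcal{S}$. Zero-based invariant subspace: a closed subspace $\mathcal{S}$ with $z\mathcal{S}\subseteq\mathcal{S}$ for which there exists $\lambda\in\mathbb{D}$ with $f(\lambda)=0$ for all $f\in\mathcal{S}$. Multiplicity: for a commuting tuple $A=(A_1,\ldots,A_m)$ ($m\ge 1$) of bounded linear operators on a Hilbert space $\mathcal{H}$ and $G\subseteq\mathcal{H}$, put $[G]_A=\overline{\operatorname{span}}\{A_1^{k_1}\cdots A_m^{k_m}g : g\in G,\ k_1,\ldots,k_m\in\mathbb{Z}_+\}$, where $\mathbb{Z}_+=\{0,1,2,\ldots\}$, and $\operatorname{mult}_A(\mathcal{H})=\min\{\#G : G\subseteq\mathcal{H},\ [G]_A=\mathcal{H}\}$. $M_{\boldsymbol{z}}=(M_{z_1},\ldots,M_{z_n})$ is the commuting tuple on the Hilbert space tensor product $\mathcal{H}_{k_1}\otimes\cdots\otimes\mathcal{H}_{k_n}$ (identified with a space of analytic functions on the polydisc $\mathbb{D}^n$),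 where $M_{z_i}=I\otimes\cdots\otimes M_z\otimes\cdots\otimes I$ with $M_z$ acting in the $i$-th factor. $(\mathcal{Q}_1\otimes\cdots\otimes\mathcal{Q}_n)^\perp$ is invariant under each $M_{z_i}$. *)

theory Defs
  imports
    "HOL-Complex_Analysis.Complex_Analysis"
    "HOL-Library.Function_Algebras"
    "HOL-Library.Extended_Nat"
begin

no_notation fps_nth (infixl \<open>$\<close> 75)

section \<open>Hilbert spaces of complex-valued functions\<close>

global_interpretation fvs: vector_space "\<lambda>(c::complex) (f::'x \<Rightarrow> complex) x. c * f x"
  by unfold_locales (auto simp: fun_eq_iff algebra_simps)

text \<open>A Hilbert space of functions is given by its underlying set together with its inner
  product, linear in the first argument.\<close>

record 'x hspace =
  car :: "('x \<Rightarrow> complex) set"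
  ip :: "('x \<Rightarrow> complex) \<Rightarrow> ('x \<Rightarrow> complex) \<Rightarrow> complex"

definition hnorm :: "'x hspace \<Rightarrow> ('x \<Rightarrow> complex) \<Rightarrow> real" where
  "hnorm H f = sqrt (Re (ip H f f))"

definition hclosure :: "'x hspace \<Rightarrow> ('x \<Rightarrow> complex) set \<Rightarrow> ('x \<Rightarrow> complex) set" where
  "hclosure H S = {f \<in> car H. \<forall>e>0. \<exists>g\<in>S. hnorm H (f - g) < e}"

definition closed_subspace :: "'x hspace \<Rightarrow> ('x \<Rightarrow> complex) set \<Rightarrow> bool" where
  "closed_subspace H S \<longleftrightarrow> S \<subseteq> car H \<and> fvs.subspace S \<and> hclosure H S = S"

definition orth :: "'x hspace \<Rightarrow> ('x \<Rightarrow> complex) set \<Rightarrow> ('x \<Rightarrow> complex) set" where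
  "orth H S = {f \<in> car H. \<forall>g\<in>S. ip H f g = 0}"

definition ominus :: "'x hspace \<Rightarrow> ('x \<Rightarrow> complex) set \<Rightarrow> ('x \<Rightarrow> complex) set \<Rightarrow> ('x \<Rightarrow> complex) set"
  where "ominus H S T = S \<inter> orth H T"

definition restr :: "'x hspace \<Rightarrow> ('x \<Rightarrow> complex) set \<Rightarrow> 'x hspace" where
  "restr H S = H\<lparr>car := S\<rparr>"

definition hadjoint ::
    "'x hspace \<Rightarrow> (('x \<Rightarrow> complex) \<Rightarrow> 'x \<Rightarrow> complex) \<Rightarrow> ('x \<Rightarrow> complex) \<Rightarrow> 'x \<Rightarrow> complex" where
  "hadjoint H T g = (THE h. h \<in> car H \<and> (\<forall>f\<in>car H. ip H (T f) g = ip H f h))"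

definition ecard :: "'a set \<Rightarrow> enat" where
  "ecard A = (if finite A then enat (card A) else \<infinity>)"

definition hdim :: "('x \<Rightarrow> complex) set \<Rightarrow> enat" where
  "hdim V = (if \<exists>B. finite B \<and> V \<subseteq> fvs.span B then enat (fvs.dim V) else \<infinity>)"


section \<open>Multiplicity of a commuting tuple\<close>

text \<open>The fold multiplies the powers \<open>A i ^^ k i\<close> in an unspecified order; for a commuting
  tuple the result does not depend on it. An operator on a subspace of \<open>H\<close> is represented by any
  operator extending it, so the restriction of \<open>A\<close> to an invariant subspace \<open>S\<close> is the
  tuple \<open>A\<close> considered on \<open>restr H S\<close>.\<close>

definition op_monomial :: "('i::finite \<Rightarrow> 'v \<Rightarrow> 'v) \<Rightarrow> ('i \<Rightarrow> nat) \<Rightarrow> 'v \<Rightarrow> 'v" where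
  "op_monomial A k = Finite_Set.fold (\<lambda>i T. (A i ^^ k i) \<circ> T) id UNIV"

definition generated ::
    "'x hspace \<Rightarrow> ('i::finite \<Rightarrow> ('x \<Rightarrow> complex) \<Rightarrow> 'x \<Rightarrow> complex) \<Rightarrow> ('x \<Rightarrow> complex) set \<Rightarrow>
      ('x \<Rightarrow> complex) set" where
  "generated H A G = hclosure H (fvs.span {op_monomial A k g | k g. g \<in> G})"

text \<open>The value \<open>\<infinity>\<close> means that no finite set generates.\<close>

definition hmult ::
    "'x hspace \<Rightarrow> ('i::finite \<Rightarrow> ('x \<Rightarrow> complex) \<Rightarrow> 'x \<Rightarrow> complex) \<Rightarrow> enat" where
  "hmult H A = Inf {ecard G | G. G \<subseteq> car H \<and> generated H A G = car H}"


section \<open>Hardy, Dirichlet and Bergman spaces on the disc\<close>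

text \<open>Functions on the disc (and later on the polydisc) are represented by their extensions
  by zero, so that equality of functions on the disc is equality in HOL.\<close>

datatype space_kind = Hardy | Dirichlet | Bergman

fun weight :: "space_kind \<Rightarrow> nat \<Rightarrow> real" where
  "weight Hardy m = 1"
| "weight Dirichlet m = real m + 1"
| "weight Bergman m = 1 / (real m + 1)"

definition taylor_coeff :: "(complex \<Rightarrow> complex) \<Rightarrow> nat \<Rightarrow> complex" where
  "taylor_coeff f m = (deriv ^^ m) f 0 / fact m"

definition disc_space :: "space_kind \<Rightarrow> complex hspace" where
  "disc_space \<kappa> = \<lparr>
     car = {f. f holomorphic_on ball 0 1 \<and> (\<forall>z. z \<notin> ball 0 1 \<longrightarrow> f z = 0) \<and>
               (\<lambda>m. weight \<kappa> m * (cmod (taylor_coeff f m))\<^sup>2) summable_on UNIV},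
     ip = (\<lambda>f g. \<Sum>\<^sub>\<infinity>m. of_real (weight \<kappa> m) * taylor_coeff f m * cnj (taylor_coeff g m))\<rparr>"

definition M\<^sub>z :: "(complex \<Rightarrow> complex) \<Rightarrow> complex \<Rightarrow> complex" where
  "M\<^sub>z f = (\<lambda>z. z * f z)"

definition zero_based :: "complex hspace \<Rightarrow> (complex \<Rightarrow> complex) set \<Rightarrow> bool" where
  "zero_based H S \<longleftrightarrow> closed_subspace H S \<and> M\<^sub>z ` S \<subseteq> S \<and> (\<exists>w\<in>ball 0 1. \<forall>f\<in>S. f w = 0)"


section \<open>Tensor products, as spaces of functions on the polydisc\<close>

definition polydisc :: "(complex ^ 'n::finite) set" where
  "polydisc = {z. \<forall>i. z $ i \<in> ball 0 1}"

definition monom_at :: "('n::finite \<Rightarrow> nat) \<Rightarrow> complex ^ 'n \<Rightarrow> complex" where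
  "monom_at \<alpha> z = (\<Prod>i\<in>UNIV. (z $ i) ^ \<alpha> i)"

definition has_expansion :: "(complex ^ 'n::finite \<Rightarrow> complex) \<Rightarrow> (('n \<Rightarrow> nat) \<Rightarrow> complex) \<Rightarrow> bool" where
  "has_expansion F a \<longleftrightarrow> (\<forall>z\<in>polydisc. ((\<lambda>\<alpha>. a \<alpha> * monom_at \<alpha> z) has_sum F z) UNIV)"

definition coeff_of :: "(complex ^ 'n::finite \<Rightarrow> complex) \<Rightarrow> ('n \<Rightarrow> nat) \<Rightarrow> complex" where
  "coeff_of F = (THE a. has_expansion F a)"

definition tensor_weight :: "('n::finite \<Rightarrow> space_kind) \<Rightarrow> ('n \<Rightarrow> nat) \<Rightarrow> real" where
  "tensor_weight \<kappa> \<alpha> = (\<Prod>i\<in>UNIV. weight (\<kappa> i) (\<alpha> i))"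

text \<open>The Hilbert space tensor product of the spaces \<open>disc_space (\<kappa> i)\<close>, with
  \<open>f\<^sub>1 \<otimes> \<dots> \<otimes> f\<^sub>n\<close> identified with the function \<open>z \<mapsto> f\<^sub>1 z\<^sub>1 \<cdots> f\<^sub>n z\<^sub>n\<close>.
  In \<open>disc_space (\<kappa> i)\<close> the monomials \<open>z\<^sup>m\<close> form an orthogonal basis with squared norms
  \<open>weight (\<kappa> i) m\<close>; hence in the tensor product the monomials in several variables form one, with
  squared norms \<open>tensor_weight \<kappa> \<alpha>\<close>. See \<open>elem_tensor_in_tensor_space\<close>,
  \<open>ip_elem_tensor\<close> and \<open>hclosure_elem_tensors\<close> below.\<close>

definition tensor_space :: "('n::finite \<Rightarrow> space_kind) \<Rightarrow> (complex ^ 'n) hspace" where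
  "tensor_space \<kappa> = \<lparr>
     car = {F. (\<forall>z. z \<notin> polydisc \<longrightarrow> F z = 0) \<and>
               (\<exists>a. has_expansion F a \<and>
                    (\<lambda>\<alpha>. tensor_weight \<kappa> \<alpha> * (cmod (a \<alpha>))\<^sup>2) summable_on UNIV)},
     ip = (\<lambda>F G. \<Sum>\<^sub>\<infinity>\<alpha>. of_real (tensor_weight \<kappa> \<alpha>) * coeff_of F \<alpha> * cnj (coeff_of G \<alpha>))\<rparr>"

definition elem_tensor :: "('n::finite \<Rightarrow> complex \<Rightarrow> complex) \<Rightarrow> complex ^ 'n \<Rightarrow> complex" where
  "elem_tensor f = (\<lambda>z. \<Prod>i\<in>UNIV. f i (z $ i))"

definition tensor_subspace ::
    "('n::finite \<Rightarrow> space_kind) \<Rightarrow> ('n \<Rightarrow> (complex \<Rightarrow> complex) set) \<Rightarrow> (complex ^ 'n \<Rightarrow> complex) set" where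
  "tensor_subspace \<kappa> Q = hclosure (tensor_space \<kappa>) (fvs.span {elem_tensor f | f. \<forall>i. f i \<in> Q i})"

text \<open>Under the identification, the operator acting as \<open>M\<^sub>z\<close> in the \<open>i\<close>-th factor and as the
  identity in the others is multiplication by the \<open>i\<close>-th coordinate.\<close>

definition Mcoord :: "'n::finite \<Rightarrow> (complex ^ 'n \<Rightarrow> complex) \<Rightarrow> complex ^ 'n \<Rightarrow> complex" where
  "Mcoord i F = (\<lambda>z. z $ i * F z)"


subsection \<open>Agreement with the tensor product\<close>

lemma weight_pos: "weight \<kappa> m > 0"
  by (cases \<kappa>) auto

lemma tensor_weight_pos: "tensor_weight \<kappa> \<alpha> > 0"
  by (simp add: tensor_weight_def prod_pos weight_pos)

lemma powser_zero_imp_coeff_zero: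
  fixes e :: "nat \<Rightarrow> complex"
  assumes "\<And>t. norm t < 1 \<Longrightarrow> (\<lambda>m. e m * t ^ m) sums 0"
  shows "e m = 0"
proof (rule ccontr)
  assume ne: "e m \<noteq> 0"
  have "e 0 = 0"
    using assms[of 0] by simp
  with ne have "m > 0"
    by (cases m) auto
  show False
  proof (rule powser_0_nonzero[of 1 0 e "\<lambda>_. 0" m])
    show "(\<lambda>m. e m * (t - 0) ^ m) sums 0" if "norm (t - 0) < 1" for t
      using assms[of t] that by simp
    fix s :: real
    assume "0 < s" and *: "\<And>z. (z::complex) \<in> cball 0 s - {0} \<Longrightarrow> (0::complex) \<noteq> 0"
    then show False
      using *[of "of_real s"] by simp
  qed (use ne \<open>m > 0\<close> in auto)
qed

lemma has_expansion_zero: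
  fixes c :: "('n::finite \<Rightarrow> nat) \<Rightarrow> complex"
  assumes c: "has_expansion (\<lambda>_. 0) c"
  shows "c \<beta> = 0"
proof -
  have "\<forall>z\<in>polydisc. ((\<lambda>\<alpha>. c \<alpha> * (\<Prod>i\<in>-I. (z $ i) ^ \<alpha> i)) has_sum 0) {\<alpha>. \<forall>i\<in>I. \<alpha> i = \<beta> i}"
    if "finite I" for I :: "'n set"
    using that
  proof (induction I rule: finite_induct)
    case empty
    then show ?case
      using c by (simp add: has_expansion_def monom_at_def)
  next
    case (insert j I)
    show ?case
    proof
      fix z :: "complex ^ 'n" assume z: "z \<in> polydisc"
      define d where "d \<alpha> = c \<alpha> * (\<Prod>i\<in>-insert j I. (z $ i) ^ \<alpha> i)" for \<alpha>
      define A where "A = {\<alpha>::'n \<Rightarrow> nat. \<forall>i\<in>I. \<alpha> i = \<beta> i}"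
      define B where "B m = {\<alpha>\<in>A. \<alpha> j = m}" for m
      have *: "((\<lambda>\<alpha>. d \<alpha> * t ^ \<alpha> j) has_sum 0) A" if t: "norm t < 1" for t
      proof -
        define z' where "z' = (\<chi> i. if i = j then t else z $ i)"
        have "z' \<in> polydisc"
          using z t by (auto simp: z'_def polydisc_def)
        moreover have "c \<alpha> * (\<Prod>i\<in>-I. (z' $ i) ^ \<alpha> i) = d \<alpha> * t ^ \<alpha> j" for \<alpha>
        proof -
          have "-I = insert j (-insert j I)"
            using insert.hyps by auto
          then have "(\<Prod>i\<in>-I. (z' $ i) ^ \<alpha> i) = (\<Prod>i\<in>insert j (-insert j I). (z' $ i) ^ \<alpha> i)"
            by (rule arg_cong)
          also have "\<dots> = (z' $ j) ^ \<alpha> j * (\<Prod>i\<in>-insert j I. (z' $ i) ^ \<alpha> i)"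
            by (rule prod.insert) auto
          also have "(\<Prod>i\<in>-insert j I. (z' $ i) ^ \<alpha> i) = (\<Prod>i\<in>-insert j I. (z $ i) ^ \<alpha> i)"
            by (intro prod.cong) (auto simp: z'_def)
          finally show ?thesis
            by (simp add: d_def z'_def)
        qed
        ultimately show ?thesis
          using bspec[OF insert.IH, of z'] by (simp add: A_def)
      qed
      have sm: "d summable_on B m" for m
      proof -
        have "(\<lambda>\<alpha>. d \<alpha> * (1/2) ^ \<alpha> j) summable_on B m"
          by (rule summable_on_subset_banach[of _ A])
             (use *[of "1/2"] in \<open>auto simp: summable_on_def B_def norm_divide\<close>)
        then have "(\<lambda>\<alpha>. 2 ^ m * (d \<alpha> * (1/2) ^ \<alpha> j)) summable_on B m"
          by (rule summable_on_cmult_right)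
        then show ?thesis
          by (rule summable_on_cong[THEN iffD1, rotated]) (auto simp: B_def power_divide)
      qed
      define e where "e m = infsum d (B m)" for m
      have "(\<lambda>m. e m * t ^ m) sums 0" if t: "norm t < 1" for t
      proof -
        have bij: "bij_betw snd (Sigma UNIV B) A"
          by (rule bij_betwI[where g = "\<lambda>\<alpha>. (\<alpha> j, \<alpha>)"]) (auto simp: B_def)
        have "((\<lambda>p. d (snd p) * t ^ (snd p) j) has_sum 0) (Sigma UNIV B)"
          using has_sum_reindex_bij_betw[OF bij, of "\<lambda>\<alpha>. d \<alpha> * t ^ \<alpha> j"] *[OF t] by simp
        moreover have "((\<lambda>\<alpha>. d (snd (m, \<alpha>)) * t ^ (snd (m, \<alpha>)) j) has_sum (e m * t ^ m)) (B m)" for m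
        proof -
          have "((\<lambda>\<alpha>. d \<alpha> * t ^ m) has_sum (e m * t ^ m)) (B m)"
            unfolding e_def by (intro has_sum_cmult_left has_sum_infsum sm)
          then show ?thesis
            by (rule has_sum_cong[THEN iffD1, rotated]) (auto simp: B_def)
        qed
        ultimately have "((\<lambda>m. e m * t ^ m) has_sum 0) UNIV"
          by (rule has_sum_SigmaD)
        then show ?thesis
          by (rule has_sum_imp_sums)
      qed
      then have "e (\<beta> j) = 0"
        by (rule powser_zero_imp_coeff_zero)
      then have "(d has_sum 0) (B (\<beta> j))"
        using has_sum_infsum[OF sm] by (metis e_def)
      moreover have "B (\<beta> j) = {\<alpha>. \<forall>i\<in>insert j I. \<alpha> i = \<beta> i}"
        by (auto simp: B_def A_def)
      ultimately show "((\<lambda>\<alpha>. c \<alpha> * (\<Prod>i\<in>-insert j I. (z $ i) ^ \<alpha> i)) has_sum 0)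
          {\<alpha>. \<forall>i\<in>insert j I. \<alpha> i = \<beta> i}"
        by (simp add: d_def[abs_def])
    qed
  qed
  from this[of UNIV] have "\<forall>z::complex^'n\<in>polydisc. (c has_sum 0) {\<beta>}"
    by (simp add: fun_eq_iff[symmetric])
  moreover have "0 \<in> (polydisc :: (complex^'n) set)"
    by (simp add: polydisc_def)
  ultimately have "(c has_sum 0) {\<beta>}"
    by blast
  then show ?thesis
    using has_sum_unique[OF has_sum_finite[of "{\<beta>}" c]] by simp
qed

lemma has_expansion_diff:
  assumes "has_expansion F a" "has_expansion G b"
  shows "has_expansion (F - G) (\<lambda>\<alpha>. a \<alpha> - b \<alpha>)"
proof -
  have "((\<lambda>\<alpha>. a \<alpha> * monom_at \<alpha> z + - (b \<alpha> * monom_at \<alpha> z)) has_sum (F z + - G z)) UNIV"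
    if "z \<in> polydisc" for z
    using assms that by (intro has_sum_add) (auto simp: has_expansion_def has_sum_uminus)
  then show ?thesis
    by (simp add: has_expansion_def left_diff_distrib)
qed

lemma coeff_of_eq:
  assumes "has_expansion F a"
  shows "coeff_of F = a"
  unfolding coeff_of_def
proof (rule the_equality)
  fix b assume "has_expansion F b"
  with assms have "has_expansion (F - F) (\<lambda>\<alpha>. b \<alpha> - a \<alpha>)"
    by (intro has_expansion_diff)
  moreover have "F - F = (\<lambda>_. 0)"
    by (simp add: fun_eq_iff)
  ultimately show "b = a"
    using has_expansion_zero[of "\<lambda>\<alpha>. b \<alpha> - a \<alpha>"] by (metis eq_iff_diff_eq_0 ext)
qed (fact assms)

lemma taylor_abs_summable:
  assumes "f holomorphic_on ball 0 1" "z \<in> ball 0 1"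
  shows "(\<lambda>m. norm (taylor_coeff f m * z ^ m)) summable_on UNIV"
    and "((\<lambda>m. taylor_coeff f m * z ^ m) has_sum f z) UNIV"
proof -
  have s: "(\<lambda>m. taylor_coeff f m * w ^ m) sums f w" if "w \<in> ball 0 1" for w
    using holomorphic_power_series[OF assms(1) that] by (simp add: taylor_coeff_def)
  obtain r where r: "norm z < r" "r < 1"
    using assms(2) dense by (auto simp: dist_norm)
  then have "norm (of_real r :: complex) = r"
    using norm_ge_zero[of z] by (simp del: norm_ge_zero)
  then have "summable (\<lambda>m. norm (taylor_coeff f m * z ^ m))"
    using powser_insidea[OF sums_summable[OF s[of "of_real r"]], of z] r by simp
  then show "(\<lambda>m. norm (taylor_coeff f m * z ^ m)) summable_on UNIV"
    and "((\<lambda>m. taylor_coeff f m * z ^ m) has_sum f z) UNIV"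
    using norm_summable_imp_has_sum[OF _ s[OF assms(2)]]
    by (auto intro!: norm_summable_imp_summable_on)
qed

lemma prod_has_sum:
  fixes f :: "'n::finite \<Rightarrow> nat \<Rightarrow> 'c::{banach, real_normed_field, second_countable_topology}"
  assumes abs: "\<And>i. (\<lambda>m. norm (f i m)) summable_on UNIV" and s: "\<And>i. (f i has_sum s i) UNIV"
  shows "((\<lambda>\<alpha>. \<Prod>i\<in>UNIV. f i (\<alpha> i)) has_sum (\<Prod>i\<in>UNIV. s i)) UNIV"
proof -
  have U: "PiE UNIV (\<lambda>_. UNIV) = (UNIV :: ('n \<Rightarrow> nat) set)"
    by (simp add: PiE_UNIV_domain)
  have "(\<lambda>\<alpha>. norm (\<Prod>i\<in>UNIV. f i (\<alpha> i))) summable_on PiE UNIV (\<lambda>_. UNIV)"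
    unfolding abs_summable_equivalent
    by (rule abs_summable_on_prod_PiE) (use abs in \<open>auto simp: abs_summable_equivalent\<close>)
  then have "(\<lambda>\<alpha>. \<Prod>i\<in>UNIV. f i (\<alpha> i)) summable_on UNIV"
    unfolding U by (rule abs_summable_summable)
  moreover have "infsum (\<lambda>\<alpha>. \<Prod>i\<in>UNIV. f i (\<alpha> i)) UNIV = (\<Prod>i\<in>UNIV. infsum (f i) UNIV)"
    unfolding U[symmetric] by (rule infsum_prod_PiE_abs) (use abs in auto)
  moreover have "infsum (f i) UNIV = s i" for i
    using s by (rule infsumI)
  ultimately show ?thesis
    by (simp add: has_sum_iff)
qed

lemma disc_space_ip_summable:
  assumes "f \<in> car (disc_space \<kappa>)" "g \<in> car (disc_space \<kappa>)"
  shows "(\<lambda>m. norm (of_real (weight \<kappa> m) * taylor_coeff f m * cnj (taylor_coeff g m))) summable_on UNIV"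
proof (rule summable_on_comparison_test)
  show "(\<lambda>m. weight \<kappa> m * (cmod (taylor_coeff f m))\<^sup>2 + weight \<kappa> m * (cmod (taylor_coeff g m))\<^sup>2)
      summable_on UNIV"
    using assms by (intro summable_on_add) (auto simp: disc_space_def)
  fix m
  define a b where "a = cmod (taylor_coeff f m)" and "b = cmod (taylor_coeff g m)"
  have "0 \<le> (a - b)\<^sup>2" "a \<ge> 0" "b \<ge> 0"
    by (auto simp: a_def b_def)
  then have "a * b \<le> a\<^sup>2 + b\<^sup>2"
    using mult_nonneg_nonneg[of a b] unfolding power2_diff by linarith
  then have "weight \<kappa> m * (a * b) \<le> weight \<kappa> m * (a\<^sup>2 + b\<^sup>2)"
    using weight_pos[of \<kappa> m] by (intro mult_left_mono) auto
  then show "norm (of_real (weight \<kappa> m) * taylor_coeff f m * cnj (taylor_coeff g m))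
      \<le> weight \<kappa> m * (cmod (taylor_coeff f m))\<^sup>2 + weight \<kappa> m * (cmod (taylor_coeff g m))\<^sup>2"
    using weight_pos[of \<kappa> m] by (simp add: norm_mult a_def b_def algebra_simps)
qed auto

lemma elem_tensor_expansion:
  assumes "\<And>i. f i \<in> car (disc_space (\<kappa> i))"
  shows "has_expansion (elem_tensor f) (\<lambda>\<alpha>. \<Prod>i\<in>UNIV. taylor_coeff (f i) (\<alpha> i))"
  unfolding has_expansion_def
proof
  fix z :: "complex ^ 'a" assume z: "z \<in> polydisc"
  have "f i holomorphic_on ball 0 1" "z $ i \<in> ball 0 1" for i
    using assms z by (auto simp: disc_space_def polydisc_def)
  then have "((\<lambda>\<alpha>. \<Prod>i\<in>UNIV. taylor_coeff (f i) (\<alpha> i) * (z $ i) ^ \<alpha> i) has_sum (\<Prod>i\<in>UNIV. f i (z $ i))) UNIV"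
    by (intro prod_has_sum taylor_abs_summable)
  then show "((\<lambda>\<alpha>. (\<Prod>i\<in>UNIV. taylor_coeff (f i) (\<alpha> i)) * monom_at \<alpha> z) has_sum elem_tensor f z) UNIV"
    by (simp add: monom_at_def elem_tensor_def prod.distrib)
qed

lemma elem_tensor_in_tensor_space:
  assumes "\<And>i. f i \<in> car (disc_space (\<kappa> i))"
  shows "elem_tensor f \<in> car (tensor_space \<kappa>)"
proof -
  have "elem_tensor f z = 0" if "z \<notin> polydisc" for z
  proof -
    from that obtain i where "z $ i \<notin> ball 0 1"
      by (auto simp: polydisc_def)
    then have "f i (z $ i) = 0"
      using assms[of i] by (auto simp: disc_space_def)
    then show ?thesis
      by (auto simp: elem_tensor_def)
  qed
  moreover have "(\<lambda>\<alpha>. tensor_weight \<kappa> \<alpha> * (cmod (\<Prod>i\<in>UNIV. taylor_coeff (f i) (\<alpha> i)))\<^sup>2) summable_on UNIV"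
  proof -
    have *: "(\<lambda>m. weight (\<kappa> i) m * (cmod (taylor_coeff (f i) m))\<^sup>2) summable_on UNIV" for i
      using assms[of i] by (simp add: disc_space_def)
    have "((\<lambda>\<alpha>. \<Prod>i\<in>UNIV. weight (\<kappa> i) (\<alpha> i) * (cmod (taylor_coeff (f i) (\<alpha> i)))\<^sup>2) has_sum
        (\<Prod>i\<in>UNIV. \<Sum>\<^sub>\<infinity>m. weight (\<kappa> i) m * (cmod (taylor_coeff (f i) m))\<^sup>2)) UNIV"
      using * weight_pos by (intro prod_has_sum has_sum_infsum) (auto simp: less_imp_le abs_mult)
    then show ?thesis
      by (auto simp: tensor_weight_def prod.distrib prod_power_distrib prod_norm[symmetric]
            dest: has_sum_imp_summable)
  qed
  ultimately show ?thesis
    using elem_tensor_expansion[of f \<kappa>, OF assms] by (auto simp: tensor_space_def)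
qed

lemma ip_elem_tensor:
  assumes "\<And>i. f i \<in> car (disc_space (\<kappa> i))" "\<And>i. g i \<in> car (disc_space (\<kappa> i))"
  shows "ip (tensor_space \<kappa>) (elem_tensor f) (elem_tensor g) = (\<Prod>i\<in>UNIV. ip (disc_space (\<kappa> i)) (f i) (g i))"
proof -
  have "((\<lambda>\<alpha>. \<Prod>i\<in>UNIV. of_real (weight (\<kappa> i) (\<alpha> i)) * taylor_coeff (f i) (\<alpha> i) *
            cnj (taylor_coeff (g i) (\<alpha> i))) has_sum (\<Prod>i\<in>UNIV. ip (disc_space (\<kappa> i)) (f i) (g i))) UNIV"
    using disc_space_ip_summable[OF assms(1) assms(2)]
    by (intro prod_has_sum) (simp_all add: disc_space_def has_sum_infsum abs_summable_summable)
  moreover have "coeff_of (elem_tensor f) = (\<lambda>\<alpha>. \<Prod>i\<in>UNIV. taylor_coeff (f i) (\<alpha> i))"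
    "coeff_of (elem_tensor g) = (\<lambda>\<alpha>. \<Prod>i\<in>UNIV. taylor_coeff (g i) (\<alpha> i))"
    using assms by (blast intro: coeff_of_eq elem_tensor_expansion)+
  ultimately show ?thesis
    by (simp add: tensor_space_def tensor_weight_def prod.distrib infsumI)
qed

definition disc_monom :: "nat \<Rightarrow> complex \<Rightarrow> complex" where
  "disc_monom m z = (if z \<in> ball 0 1 then z ^ m else 0)"

lemma disc_monom_holomorphic: "disc_monom m holomorphic_on ball 0 1"
  by (rule holomorphic_transform[of "\<lambda>z. z ^ m"]) (auto simp: disc_monom_def intro!: holomorphic_intros)

lemma taylor_coeff_disc_monom: "taylor_coeff (disc_monom m) j = (if j = m then 1 else 0)"
proof -
  define e where "e j = taylor_coeff (disc_monom m) j - (if j = m then 1 else 0)" for j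
  have "(\<lambda>j. e j * t ^ j) sums 0" if "norm t < 1" for t
  proof -
    have "(\<lambda>j. taylor_coeff (disc_monom m) j * t ^ j) sums t ^ m"
      using has_sum_imp_sums[OF taylor_abs_summable(2)[OF disc_monom_holomorphic, of t m]] that
      by (simp add: disc_monom_def)
    moreover have "(\<lambda>j. (if j = m then t ^ j else 0)) sums t ^ m"
      using sums_single[of m "\<lambda>j. t ^ j"] by simp
    ultimately have "(\<lambda>j. taylor_coeff (disc_monom m) j * t ^ j - (if j = m then t ^ j else 0)) sums (t ^ m - t ^ m)"
      by (rule sums_diff)
    moreover have "taylor_coeff (disc_monom m) j * t ^ j - (if j = m then t ^ j else 0) = e j * t ^ j" for j
      by (simp add: e_def left_diff_distrib)
    ultimately show ?thesis
      by simp
  qed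
  then have "e j = 0"
    by (rule powser_zero_imp_coeff_zero)
  then show ?thesis
    by (simp add: e_def split: if_splits)
qed

lemma disc_monom_in_disc_space: "disc_monom m \<in> car (disc_space \<kappa>)"
proof -
  have "(\<lambda>j. weight \<kappa> j * (cmod (taylor_coeff (disc_monom m) j))\<^sup>2) summable_on UNIV"
    by (rule finite_nonzero_values_imp_summable_on) (simp add: taylor_coeff_disc_monom)
  then show ?thesis
    using disc_monom_holomorphic by (simp add: disc_space_def disc_monom_def)
qed

lemma hclosure_elem_tensors:
  "hclosure (tensor_space \<kappa>) (fvs.span {elem_tensor f | f. \<forall>i. f i \<in> car (disc_space (\<kappa> i))})
     = car (tensor_space \<kappa>)"
proof (intro equalityI subsetI)
  fix F assume "F \<in> car (tensor_space \<kappa>)"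
  then obtain a where a: "has_expansion F a"
      and sm: "(\<lambda>\<alpha>. tensor_weight \<kappa> \<alpha> * (cmod (a \<alpha>))\<^sup>2) summable_on UNIV"
      and F: "F \<in> car (tensor_space \<kappa>)"
    by (auto simp: tensor_space_def)
  define w where "w \<alpha> = tensor_weight \<kappa> \<alpha> * (cmod (a \<alpha>))\<^sup>2" for \<alpha>
  have w: "(w has_sum infsum w UNIV) UNIV"
    using sm by (auto simp: w_def[abs_def] intro!: has_sum_infsum)
  have "\<exists>G\<in>fvs.span {elem_tensor f | f. \<forall>i. f i \<in> car (disc_space (\<kappa> i))}. hnorm (tensor_space \<kappa>) (F - G) < e"
    if "e > 0" for e
  proof -
    obtain E where E: "finite E" "dist (sum w E) (infsum w UNIV) \<le> e\<^sup>2 / 2"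
      using has_sum_finite_approximation[OF w, of "e\<^sup>2 / 2"] \<open>e > 0\<close> by auto
    define G where "G = (\<Sum>\<alpha>\<in>E. (\<lambda>z. a \<alpha> * elem_tensor (\<lambda>i. disc_monom (\<alpha> i)) z))"
    have "G \<in> fvs.span {elem_tensor f | f. \<forall>i. f i \<in> car (disc_space (\<kappa> i))}"
      unfolding G_def
      by (intro fvs.span_sum fvs.span_scale fvs.span_base) (auto intro!: disc_monom_in_disc_space)
    moreover have "hnorm (tensor_space \<kappa>) (F - G) < e"
    proof -
      have G_apply: "G z = (\<Sum>\<alpha>\<in>E. a \<alpha> * elem_tensor (\<lambda>i. disc_monom (\<alpha> i)) z)" for z
        unfolding G_def using E(1) by (induction E rule: finite_induct) auto
      have "has_expansion G (\<lambda>\<alpha>. if \<alpha> \<in> E then a \<alpha> else 0)"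
        unfolding has_expansion_def
      proof
        fix z :: "complex ^ 'a" assume "z \<in> polydisc"
        then have "G z = (\<Sum>\<alpha>\<in>E. a \<alpha> * monom_at \<alpha> z)"
          by (simp add: G_apply elem_tensor_def monom_at_def disc_monom_def polydisc_def)
        moreover have "((\<lambda>\<alpha>. a \<alpha> * monom_at \<alpha> z) has_sum (\<Sum>\<alpha>\<in>E. a \<alpha> * monom_at \<alpha> z)) E"
          using E(1) by (rule has_sum_finite)
        then have "((\<lambda>\<alpha>. (if \<alpha> \<in> E then a \<alpha> else 0) * monom_at \<alpha> z) has_sum (\<Sum>\<alpha>\<in>E. a \<alpha> * monom_at \<alpha> z)) UNIV"
          by (rule has_sum_cong_neutral[THEN iffD1, rotated -1]) auto
        ultimately show "((\<lambda>\<alpha>. (if \<alpha> \<in> E then a \<alpha> else 0) * monom_at \<alpha> z) has_sum G z) UNIV"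
          by simp
      qed
      from has_expansion_diff[OF a this]
      have c: "coeff_of (F - G) = (\<lambda>\<alpha>. if \<alpha> \<in> E then 0 else a \<alpha>)"
        by (auto dest!: coeff_of_eq)
      have "(w has_sum (infsum w UNIV - sum w E)) (UNIV - E)"
        using w E(1) by (intro has_sum_Diff has_sum_finite) auto
      then have "((\<lambda>\<alpha>. of_real (w \<alpha>)) has_sum complex_of_real (infsum w UNIV - sum w E)) (UNIV - E)"
        by (rule has_sum_of_real)
      then have "((\<lambda>\<alpha>. of_real (tensor_weight \<kappa> \<alpha>) * coeff_of (F - G) \<alpha> * cnj (coeff_of (F - G) \<alpha>)) has_sum
          complex_of_real (infsum w UNIV - sum w E)) UNIV"
        by (rule has_sum_cong_neutral[THEN iffD1, rotated -1])
           (auto simp: c w_def mult.assoc simp flip: complex_norm_square)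
      then have "ip (tensor_space \<kappa>) (F - G) (F - G) = complex_of_real (infsum w UNIV - sum w E)"
        by (simp add: tensor_space_def infsumI)
      moreover have "infsum w UNIV - sum w E < e\<^sup>2"
      proof -
        have "e\<^sup>2 / 2 < e\<^sup>2"
          using \<open>e > 0\<close> by simp
        with E(2) show ?thesis
          unfolding dist_real_def by linarith
      qed
      ultimately show ?thesis
        using \<open>e > 0\<close> by (simp add: hnorm_def real_less_lsqrt)
    qed
    ultimately show ?thesis
      by blast
  qed
  with F show "F \<in> hclosure (tensor_space \<kappa>) (fvs.span {elem_tensor f | f. \<forall>i. f i \<in> car (disc_space (\<kappa> i))})"
    by (simp add: hclosure_def)
qed (simp add: hclosure_def)

end

theory Submission
  imports Defs
begin

text \<open>For one factor, let \<open>S = Q\<^sup>\<bottom>\<close> and \<open>W = S \<ominus> z S\<close>. The wandering subspace property \<open>[W] = S\<close>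
  (Richter for the concave shifts, Shimorin for the Bergman shift) gives \<open>mult S \<le> dim W\<close>, and
  \<open>z S \<bottom> W\<close> gives the converse. In the tensor product, the functions \<open>1 \<otimes> \<cdots> \<otimes> b \<otimes> \<cdots> \<otimes> 1\<close>, with \<open>b\<close> in
  a basis of \<open>W\<^sub>i\<close> in slot \<open>i\<close>, generate \<open>(Q\<^sub>1 \<otimes> \<cdots> \<otimes> Q\<^sub>n)\<^sup>\<bottom>\<close>. For the lower bound, let \<open>w\<^sub>i\<close> be a
  common zero of \<open>S\<^sub>i\<close>. The bounds on the powers of the left inverse that underlie the wandering
  subspace property turn each \<open>b\<close> into an eigenvector \<open>e\<^sub>b\<close> of the compressed \<open>M\<^sub>z\<^sup>*\<close> on \<open>S\<^sub>i\<close> for the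
  conjugate of \<open>w\<^sub>i\<close>. Since the kernel functions at \<open>w\<^sub>j\<close> lie in \<open>Q\<^sub>j\<close>, putting \<open>e\<^sub>b\<close> in slot \<open>i\<close> and
  kernel functions in the other slots yields, over all \<open>i\<close> and \<open>b\<close>, independent joint eigenvectors
  for a single joint eigenvalue, and a generating set cannot have fewer elements than these.\<close>

section \<open>Hilbert space geometry\<close>

text \<open>For one factor the eigenvalue 0 suffices in the lower bound, since W is the kernel of
  the compressed adjoint. With several factors a joint eigenvalue 0 would put the constant 1, the
  kernel function at 0, into the other slots, and it lies in Q_j only if S_j vanishes at 0. The
  eigenvalues therefore have to move from 0 to the conjugates of the common zeros, without loss of
  eigenvectors. This is what a power series in B does, where L is the left inverse of T = M_z on S
  with kernel W, and B is its adjoint. The adjoint of T annihilates W and inverts B from the left,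
  so the sum of conj(l)^n B^n w is an eigenvector for conj(l); since B maps into the range of T, its
  pairing with W is that of w, and independence survives. The series needs |l| < 1 and at most
  linear growth of the norms of B^n w. On Hardy and Dirichlet, T is expansive and B a contraction;
  on Bergman, the squared norms of B^n w form a concave sequence. Disc and polydisc spaces are both
  treated as weighted l2 spaces of coefficients, so that completeness and adjoints of shifts are
  proved once.\<close>

locale hilbert =
  fixes H :: "'x hspace"
  assumes subspace_car: "fvs.subspace (car H)"
    and ip_add_left [simp]: "\<lbrakk>f \<in> car H; g \<in> car H; h \<in> car H\<rbrakk> \<Longrightarrow> ip H (f + g) h = ip H f h + ip H g h"
    and ip_scale_left [simp]: "\<lbrakk>f \<in> car H; h \<in> car H\<rbrakk> \<Longrightarrow> ip H (\<lambda>x. c * f x) h = c * ip H f h"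
    and ip_commute: "\<lbrakk>f \<in> car H; g \<in> car H\<rbrakk> \<Longrightarrow> ip H g f = cnj (ip H f g)"
    and ip_nonneg: "f \<in> car H \<Longrightarrow> 0 \<le> Re (ip H f f)"
    and ip_definite: "\<lbrakk>f \<in> car H; ip H f f = 0\<rbrakk> \<Longrightarrow> f = 0"
    and complete: "\<lbrakk>\<And>n. X n \<in> car H;
        \<And>e. e > 0 \<Longrightarrow> \<exists>N. \<forall>m\<ge>N. \<forall>n\<ge>N. hnorm H (X m - X n) < e\<rbrakk>
      \<Longrightarrow> \<exists>l\<in>car H. (\<lambda>n. hnorm H (X n - l)) \<longlonglongrightarrow> 0"
begin

lemma car_0 [simp]: "0 \<in> car H"
  by (rule fvs.subspace_0[OF subspace_car])

lemma car_0' [simp]: "(\<lambda>x. 0) \<in> car H"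
  using car_0 by (simp add: zero_fun_def)

lemma car_add [simp]: "f \<in> car H \<Longrightarrow> g \<in> car H \<Longrightarrow> f + g \<in> car H"
  by (rule fvs.subspace_add[OF subspace_car])

lemma car_diff [simp]: "f \<in> car H \<Longrightarrow> g \<in> car H \<Longrightarrow> f - g \<in> car H"
  by (rule fvs.subspace_diff[OF subspace_car])

lemma car_scale [simp]: "f \<in> car H \<Longrightarrow> (\<lambda>x. c * f x) \<in> car H"
  by (rule fvs.subspace_scale[OF subspace_car])

lemma car_sum: "(\<And>i. i \<in> I \<Longrightarrow> F i \<in> car H) \<Longrightarrow> sum F I \<in> car H"
  by (rule fvs.subspace_sum[OF subspace_car])

lemma span_car: "X \<subseteq> car H \<Longrightarrow> fvs.span X \<subseteq> car H"
  using fvs.span_minimal subspace_car by blast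

lemma ip_add_right [simp]:
  "\<lbrakk>f \<in> car H; g \<in> car H; h \<in> car H\<rbrakk> \<Longrightarrow> ip H h (f + g) = ip H h f + ip H h g"
  by (metis car_add complex_cnj_add ip_add_left ip_commute)

lemma ip_scale_right [simp]:
  "\<lbrakk>f \<in> car H; h \<in> car H\<rbrakk> \<Longrightarrow> ip H h (\<lambda>x. c * f x) = cnj c * ip H h f"
  by (metis car_scale complex_cnj_mult ip_scale_left ip_commute)

lemma diff_eq_scale: "f - g = f + (\<lambda>x. (-1) * g x)" for f g :: "'x \<Rightarrow> complex"
  by (simp add: fun_eq_iff)

lemma ip_diff_left [simp]:
  "\<lbrakk>f \<in> car H; g \<in> car H; h \<in> car H\<rbrakk> \<Longrightarrow> ip H (f - g) h = ip H f h - ip H g h"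
  unfolding diff_eq_scale by (subst ip_add_left) (use car_scale[of g "-1"] ip_scale_left[of g h "-1"] in simp_all)

lemma ip_diff_right [simp]:
  "\<lbrakk>f \<in> car H; g \<in> car H; h \<in> car H\<rbrakk> \<Longrightarrow> ip H h (f - g) = ip H h f - ip H h g"
  by (metis car_diff complex_cnj_diff ip_diff_left ip_commute)

lemma ip_0_left [simp]: "f \<in> car H \<Longrightarrow> ip H 0 f = 0"
  using ip_diff_left[of f f f] by simp

lemma ip_0_right [simp]: "f \<in> car H \<Longrightarrow> ip H f 0 = 0"
  using ip_diff_right[of f f f] by simp

lemma ip_sum_right:
  "\<lbrakk>\<And>i. i \<in> I \<Longrightarrow> F i \<in> car H; h \<in> car H\<rbrakk> \<Longrightarrow> ip H h (sum F I) = (\<Sum>i\<in>I. ip H h (F i))"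
  by (induction I rule: infinite_finite_induct) (auto simp: car_sum)

lemma ip_eq_0_commute: "\<lbrakk>f \<in> car H; g \<in> car H\<rbrakk> \<Longrightarrow> ip H f g = 0 \<longleftrightarrow> ip H g f = 0"
  by (metis complex_cnj_zero ip_commute)

lemma orth_iff: "X \<subseteq> car H \<Longrightarrow> f \<in> orth H X \<longleftrightarrow> f \<in> car H \<and> (\<forall>x\<in>X. ip H x f = 0)"
  unfolding orth_def using ip_eq_0_commute by blast

section \<open>Norm identities and inequalities\<close>

lemma ip_self: "f \<in> car H \<Longrightarrow> ip H f f = of_real ((hnorm H f)\<^sup>2)"
  using ip_commute[of f f] ip_nonneg[of f] by (simp add: hnorm_def complex_eq_iff)

lemma hnorm_nonneg [simp]: "f \<in> car H \<Longrightarrow> 0 \<le> hnorm H f"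
  by (simp add: hnorm_def ip_nonneg)

lemma hnorm_eq_0: "f \<in> car H \<Longrightarrow> hnorm H f = 0 \<longleftrightarrow> f = 0"
  using ip_definite[of f] ip_self[of f] by auto

lemma hnorm_le_0: "\<lbrakk>f \<in> car H; hnorm H f \<le> 0\<rbrakk> \<Longrightarrow> f = 0"
  using hnorm_nonneg[of f] hnorm_eq_0[of f] by linarith

lemma hnorm_0 [simp]: "hnorm H 0 = 0"
  by (simp add: hnorm_eq_0)

lemma hnorm_sq: "f \<in> car H \<Longrightarrow> (hnorm H f)\<^sup>2 = Re (ip H f f)"
  by (simp add: ip_self)

lemma hnorm_scale [simp]: "f \<in> car H \<Longrightarrow> hnorm H (\<lambda>x. c * f x) = cmod c * hnorm H f"
proof -
  assume f: "f \<in> car H"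
  have "(hnorm H (\<lambda>x. c * f x))\<^sup>2 = Re ((c * cnj c) * ip H f f)"
    using f by (simp add: hnorm_sq mult.assoc del: complex_mult_cnj)
  also have "\<dots> = Re ((c * cnj c) * of_real ((hnorm H f)\<^sup>2))"
    using f by (simp only: ip_self)
  also have "\<dots> = (cmod c * hnorm H f)\<^sup>2"
    by (simp add: complex_norm_square[symmetric] power_mult_distrib)
  finally show ?thesis
    using f by (simp add: power2_eq_iff_nonneg)
qed

lemma hnorm_minus: "\<lbrakk>f \<in> car H; g \<in> car H\<rbrakk> \<Longrightarrow> hnorm H (f - g) = hnorm H (g - f)"
  by (simp add: hnorm_def)

lemma hnorm_add_sq:
  "\<lbrakk>f \<in> car H; g \<in> car H\<rbrakk> \<Longrightarrow> (hnorm H (f + g))\<^sup>2 = (hnorm H f)\<^sup>2 + (hnorm H g)\<^sup>2 + 2 * Re (ip H f g)"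
  using ip_commute[of f g] by (simp add: hnorm_sq)

lemma hnorm_diff_sq:
  "\<lbrakk>f \<in> car H; g \<in> car H\<rbrakk> \<Longrightarrow> (hnorm H (f - g))\<^sup>2 = (hnorm H f)\<^sup>2 + (hnorm H g)\<^sup>2 - 2 * Re (ip H f g)"
  using ip_commute[of f g] by (simp add: hnorm_sq)

lemma pythagoras:
  "\<lbrakk>f \<in> car H; g \<in> car H; ip H f g = 0\<rbrakk> \<Longrightarrow> (hnorm H (f + g))\<^sup>2 = (hnorm H f)\<^sup>2 + (hnorm H g)\<^sup>2"
  by (simp add: hnorm_add_sq)

text \<open>Serves twice: nonnegativity of the left side is the Cauchy-Schwarz inequality, and
  minimality of a distance forces the subtracted term to vanish in the projection theorem.\<close>

lemma best_coefficient:
  assumes "f \<in> car H" "g \<in> car H" "g \<noteq> 0"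
  shows "(hnorm H (f - (\<lambda>x. ip H f g / of_real ((hnorm H g)\<^sup>2) * g x)))\<^sup>2
    = (hnorm H f)\<^sup>2 - (cmod (ip H f g))\<^sup>2 / (hnorm H g)\<^sup>2"
proof -
  have g: "hnorm H g \<noteq> 0"
    using assms by (simp add: hnorm_eq_0)
  define c where "c = ip H f g / of_real ((hnorm H g)\<^sup>2)"
  have "Re (ip H f (\<lambda>x. c * g x)) = Re (of_real ((cmod (ip H f g))\<^sup>2 / (hnorm H g)\<^sup>2))"
    using assms by (subst ip_scale_right) (simp_all add: c_def complex_norm_square mult.commute del: of_real_power)
  moreover have "(hnorm H (\<lambda>x. c * g x))\<^sup>2 = (cmod (ip H f g))\<^sup>2 / (hnorm H g)\<^sup>2"
    using assms g by (subst hnorm_scale) (simp_all add: c_def norm_divide norm_power field_simps power2_eq_square norm_mult)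
  ultimately have "(hnorm H (f - (\<lambda>x. c * g x)))\<^sup>2 = (hnorm H f)\<^sup>2 - (cmod (ip H f g))\<^sup>2 / (hnorm H g)\<^sup>2"
    by (subst hnorm_diff_sq) (use assms in \<open>simp_all del: ip_scale_right hnorm_scale\<close>)
  then show ?thesis
    by (simp only: c_def)
qed

lemma Cauchy_Schwarz:
  assumes "f \<in> car H" "g \<in> car H"
  shows "cmod (ip H f g) \<le> hnorm H f * hnorm H g"
proof (cases "g = 0")
  case False
  then have g: "hnorm H g > 0"
    using assms hnorm_eq_0 hnorm_nonneg by (metis less_eq_real_def)
  have "(cmod (ip H f g))\<^sup>2 / (hnorm H g)\<^sup>2 \<le> (hnorm H f)\<^sup>2"
    using best_coefficient[OF assms False] by (metis diff_ge_0_iff_ge zero_le_power2)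
  then have "(cmod (ip H f g))\<^sup>2 \<le> (hnorm H f * hnorm H g)\<^sup>2"
    using g by (simp add: pos_divide_le_eq power_mult_distrib)
  then show ?thesis
    by (rule power2_le_imp_le) (use assms in simp)
qed (use assms in simp)

lemma hnorm_triangle:
  assumes "f \<in> car H" "g \<in> car H"
  shows "hnorm H (f + g) \<le> hnorm H f + hnorm H g"
proof (rule power2_le_imp_le)
  show "(hnorm H (f + g))\<^sup>2 \<le> (hnorm H f + hnorm H g)\<^sup>2"
    using assms Cauchy_Schwarz[OF assms] complex_Re_le_cmod[of "ip H f g"]
    by (simp add: hnorm_add_sq power2_sum)
qed (use assms in simp)

lemma hnorm_triangle_diff:
  assumes "f \<in> car H" "g \<in> car H" "h \<in> car H"
  shows "hnorm H (f - h) \<le> hnorm H (f - g) + hnorm H (g - h)"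
  using hnorm_triangle[of "f - g" "g - h"] assms by simp

lemma parallelogram:
  "\<lbrakk>f \<in> car H; g \<in> car H\<rbrakk>
    \<Longrightarrow> (hnorm H (f + g))\<^sup>2 + (hnorm H (f - g))\<^sup>2 = 2 * (hnorm H f)\<^sup>2 + 2 * (hnorm H g)\<^sup>2"
  by (simp add: hnorm_add_sq hnorm_diff_sq)

lemma eq_by_ip:
  assumes "f \<in> car H" "g \<in> car H" "\<And>h. h \<in> car H \<Longrightarrow> ip H h f = ip H h g"
  shows "f = g"
proof -
  have "ip H (f - g) (f - g) = 0"
    using assms by (subst ip_diff_right) auto
  then have "f - g = 0"
    by (intro ip_definite car_diff assms)
  then show ?thesis by simp
qed

section \<open>Closures, closed subspaces and orthogonal complements\<close>

lemma hclosure_subset: "hclosure H X \<subseteq> car H"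
  by (auto simp: hclosure_def)

lemma subset_hclosure: "X \<subseteq> car H \<Longrightarrow> X \<subseteq> hclosure H X"
  unfolding hclosure_def by (auto intro!: bexI[where x = f for f])

lemma hclosureE:
  assumes "f \<in> hclosure H X" "e > 0"
  obtains g where "g \<in> X" "hnorm H (f - g) < e"
  using assms by (auto simp: hclosure_def)

lemma closed_subspace_hclosure:
  assumes X: "X \<subseteq> car H" "fvs.subspace X"
  shows "closed_subspace H (hclosure H X)"
  unfolding closed_subspace_def
proof (intro conjI)
  show "fvs.subspace (hclosure H X)"
    unfolding fvs.subspace_def
  proof (intro conjI ballI allI)
    show "0 \<in> hclosure H X"
      using subset_hclosure X fvs.subspace_0 by blast
  next
    fix f g assume fg: "f \<in> hclosure H X" "g \<in> hclosure H X"
    have "\<exists>u\<in>X. hnorm H (f + g - u) < e" if "e > 0" for e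
    proof -
      obtain u where u: "u \<in> X" "hnorm H (f - u) < e / 2"
        using fg(1) \<open>e > 0\<close> by (auto elim: hclosureE[of _ _ "e / 2"])
      obtain v where v: "v \<in> X" "hnorm H (g - v) < e / 2"
        using fg(2) \<open>e > 0\<close> by (auto elim: hclosureE[of _ _ "e / 2"])
      note uv = u v
      have "hnorm H (f + g - (u + v)) = hnorm H ((f - u) + (g - v))"
        by (simp add: add_diff_add)
      also have "\<dots> \<le> hnorm H (f - u) + hnorm H (g - v)"
        using hnorm_triangle[of "f - u" "g - v"] uv fg X hclosure_subset[of X] by (auto simp: subset_iff)
      finally show ?thesis
        using uv fvs.subspace_add[OF X(2)] by (intro bexI[of _ "u + v"]) auto
    qed
    then show "f + g \<in> hclosure H X"
      using fg by (auto simp: hclosure_def)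
  next
    fix c and f assume f: "f \<in> hclosure H X"
    have "\<exists>u\<in>X. hnorm H ((\<lambda>x. c * f x) - u) < e" if "e > 0" for e
    proof -
      have "e / (cmod c + 1) > 0"
        using \<open>e > 0\<close> by (smt (verit) divide_pos_pos norm_ge_zero)
      then obtain u where u: "u \<in> X" "hnorm H (f - u) < e / (cmod c + 1)"
        using f unfolding hclosure_def by blast
      have *: "f \<in> car H" "u \<in> car H"
        using f u X hclosure_subset by auto
      have "(\<lambda>x. c * f x) - (\<lambda>x. c * u x) = (\<lambda>x. c * (f - u) x)"
        by (simp add: fun_eq_iff algebra_simps)
      then have "hnorm H ((\<lambda>x. c * f x) - (\<lambda>x. c * u x)) = cmod c * hnorm H (f - u)"
        using * by (metis car_diff hnorm_scale)
      also have "\<dots> \<le> (cmod c + 1) * hnorm H (f - u)"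
        using * by (intro mult_right_mono) auto
      also have "\<dots> < e"
        using u(2) by (simp add: pos_less_divide_eq mult.commute add_nonneg_pos)
      finally show ?thesis
        using u fvs.subspace_scale[OF X(2)] by (intro bexI[of _ "\<lambda>x. c * u x"]) auto
    qed
    then show "(\<lambda>x. c * f x) \<in> hclosure H X"
      using f by (auto simp: hclosure_def)
  qed
  have "hclosure H (hclosure H X) \<subseteq> hclosure H X"
  proof
    fix f assume f: "f \<in> hclosure H (hclosure H X)"
    have "\<exists>u\<in>X. hnorm H (f - u) < e" if "e > 0" for e
    proof -
      obtain g where g: "g \<in> hclosure H X" "hnorm H (f - g) < e / 2"
        using f \<open>e > 0\<close> by (auto elim: hclosureE[of _ _ "e / 2"])
      then obtain u where u: "u \<in> X" "hnorm H (g - u) < e / 2"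
        using \<open>e > 0\<close> by (auto elim: hclosureE[of _ _ "e / 2"])
      have "hnorm H (f - u) \<le> hnorm H (f - g) + hnorm H (g - u)"
        using f g u X hclosure_subset by (intro hnorm_triangle_diff) auto
      then show ?thesis
        using u g by (intro bexI[of _ u]) auto
    qed
    then show "f \<in> hclosure H X"
      using f by (simp add: hclosure_def)
  qed
  then show "hclosure H (hclosure H X) = hclosure H X"
    using subset_hclosure[OF hclosure_subset] by blast
qed (rule hclosure_subset)

lemma closed_subspaceD:
  assumes "closed_subspace H M"
  shows "M \<subseteq> car H" "fvs.subspace M" "hclosure H M = M"
  using assms by (auto simp: closed_subspace_def)

text \<open>Stated for an abstract bounded functional rather than an inner product: it yields
  closedness of kernels before Riesz representation is available, and later applies to an inner
  product with an elementary tensor of which one slot varies.\<close>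

lemma functional_zero_on_hclosure:
  assumes X: "X \<subseteq> car H"
    and add: "\<And>f g. \<lbrakk>f \<in> car H; g \<in> car H\<rbrakk> \<Longrightarrow> \<phi> (f + g) = \<phi> f + \<phi> g"
    and scale: "\<And>c f. f \<in> car H \<Longrightarrow> \<phi> (\<lambda>x. c * f x) = (c::complex) * \<phi> f"
    and bdd: "\<And>f. f \<in> car H \<Longrightarrow> cmod (\<phi> f) \<le> C * hnorm H f"
    and zero: "\<And>x. x \<in> X \<Longrightarrow> \<phi> x = 0"
    and f: "f \<in> hclosure H (fvs.span X)"
  shows "\<phi> f = 0"
proof -
  have fc: "f \<in> car H"
    using f hclosure_subset by auto
  have span0: "\<phi> g = 0" if "g \<in> fvs.span X" for g
  proof -
    have "fvs.span X \<subseteq> {g \<in> car H. \<phi> g = 0}"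
    proof (rule fvs.span_minimal)
      show "fvs.subspace {g \<in> car H. \<phi> g = 0}"
        unfolding fvs.subspace_def using add scale scale[of 0 0] by (auto simp: zero_fun_def)
    qed (use X zero in auto)
    then show ?thesis
      using that by auto
  qed
  have "cmod (\<phi> f) \<le> 0 + e" if "e > 0" for e
  proof -
    \<comment> \<open>The bound \<open>C\<close> may be 0, or negative if all norms vanish; its
      absolute value plus 1 is a safe divisor.\<close>
    have "e / (\<bar>C\<bar> + 1) > 0"
      using \<open>e > 0\<close> by (smt (verit) divide_pos_pos)
    then obtain g where g: "g \<in> fvs.span X" "hnorm H (f - g) < e / (\<bar>C\<bar> + 1)"
      using f unfolding hclosure_def by blast
    have gc: "g \<in> car H"
      using g span_car[OF X] by auto
    have "\<phi> f = \<phi> ((f - g) + g)"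
      by simp
    also have "\<dots> = \<phi> (f - g)"
      using span0[OF g(1)] fc gc by (subst add) auto
    finally have "cmod (\<phi> f) \<le> C * hnorm H (f - g)"
      using bdd fc gc by simp
    also have "\<dots> \<le> (\<bar>C\<bar> + 1) * hnorm H (f - g)"
      using fc gc by (intro mult_right_mono) auto
    also have "\<dots> \<le> e"
      using g(2) by (simp add: pos_less_divide_eq mult.commute add_nonneg_pos)
    finally show ?thesis by simp
  qed
  then have "cmod (\<phi> f) \<le> 0"
    by (rule field_le_epsilon)
  then show ?thesis by simp
qed

lemma orthogonal_hclosure:
  assumes "X \<subseteq> car H" "h \<in> car H" "\<And>x. x \<in> X \<Longrightarrow> ip H x h = 0" "f \<in> hclosure H (fvs.span X)"
  shows "ip H f h = 0"
  by (rule functional_zero_on_hclosure[of X "\<lambda>f. ip H f h" "hnorm H h"])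
     (use assms Cauchy_Schwarz in \<open>auto simp: mult.commute\<close>)

lemma orth_hclosure_span:
  assumes "X \<subseteq> car H"
  shows "orth H (hclosure H (fvs.span X)) = orth H X"
proof
  show "orth H X \<subseteq> orth H (hclosure H (fvs.span X))"
  proof
    fix f assume f: "f \<in> orth H X"
    then show "f \<in> orth H (hclosure H (fvs.span X))"
      using orthogonal_hclosure[OF assms, of f] assms by (simp add: orth_iff hclosure_subset)
  qed
  have "X \<subseteq> hclosure H (fvs.span X)"
    using fvs.span_superset span_car[OF assms] subset_hclosure by blast
  then show "orth H (hclosure H (fvs.span X)) \<subseteq> orth H X"
    by (auto simp: orth_def)
qed

lemma closed_subspace_orth:
  assumes "X \<subseteq> car H"
  shows "closed_subspace H (orth H X)"
proof -
  have sub: "orth H X \<subseteq> car H" "fvs.subspace (orth H X)"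
    using assms unfolding fvs.subspace_def by (auto simp: orth_def subset_iff)
  have "hclosure H (orth H X) \<subseteq> orth H X"
  proof
    fix f assume f: "f \<in> hclosure H (orth H X)"
    have "ip H f x = 0" if "x \<in> X" for x
      by (rule orthogonal_hclosure[of "orth H X"])
         (use assms that f sub in \<open>auto simp: orth_def fvs.span_eq_iff[THEN iffD2]\<close>)
    then show "f \<in> orth H X"
      using f by (auto simp: orth_def hclosure_def)
  qed
  then show ?thesis
    using sub subset_hclosure[OF sub(1)] by (auto simp: closed_subspace_def)
qed

section \<open>The projection theorem and its consequences\<close>

theorem orthogonal_projection:
  assumes M: "closed_subspace H M" and f: "f \<in> car H"
  obtains g where "g \<in> M" "f - g \<in> orth H M"
proof -
  note M' = closed_subspaceD[OF M]
  define d where "d = (INF m\<in>M. (hnorm H (f - m))\<^sup>2)"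
  have bb: "bdd_below ((\<lambda>m. (hnorm H (f - m))\<^sup>2) ` M)"
    by (rule bdd_belowI2[of _ 0]) simp
  have ne: "M \<noteq> {}"
    using fvs.subspace_0[OF M'(2)] by auto
  have d_le: "d \<le> (hnorm H (f - m))\<^sup>2" if "m \<in> M" for m
    unfolding d_def using bb that by (rule cINF_lower)
  have "\<exists>m\<in>M. (hnorm H (f - m))\<^sup>2 < d + inverse (real (Suc n))" for n
    using cINF_less_iff[OF ne bb, of "d + inverse (real (Suc n))"] by (simp add: d_def)
  then obtain X where X: "\<And>n. X n \<in> M" "\<And>n. (hnorm H (f - X n))\<^sup>2 < d + inverse (real (Suc n))"
    by metis
  have Xc: "X n \<in> car H" for n
    using X M' by auto
  \<comment> \<open>Parallelogram law for \<open>f - X m\<close> and \<open>f - X n\<close>: their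
    squared norms barely exceed \<open>d\<close>, while the midpoint \<open>a\<close> stays in
    \<open>M\<close> and so has squared distance at least \<open>d\<close>.\<close>
  have est: "(hnorm H (X m - X n))\<^sup>2 \<le> 2 * inverse (real (Suc m)) + 2 * inverse (real (Suc n))" for m n
  proof -
    define a where "a = (\<lambda>x. (1/2) * (X m + X n) x)"
    have a: "a \<in> M"
      unfolding a_def using X(1) fvs.subspace_add[OF M'(2)] fvs.subspace_scale[OF M'(2)] by blast
    have "(f - X m) + (f - X n) = (\<lambda>x. 2 * (f - a) x)" "(f - X m) - (f - X n) = X n - X m"
      by (auto simp: a_def fun_eq_iff algebra_simps)
    then have "(hnorm H (\<lambda>x. 2 * (f - a) x))\<^sup>2 + (hnorm H (X n - X m))\<^sup>2
        = 2 * (hnorm H (f - X m))\<^sup>2 + 2 * (hnorm H (f - X n))\<^sup>2"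
      using parallelogram[of "f - X m" "f - X n"] f Xc by simp
    moreover have "(hnorm H (\<lambda>x. 2 * (f - a) x))\<^sup>2 = 4 * (hnorm H (f - a))\<^sup>2"
      using a M' f by (subst hnorm_scale) (auto simp: power_mult_distrib)
    ultimately show ?thesis
      using X(2)[of m] X(2)[of n] d_le[OF a] hnorm_minus[OF Xc Xc, of m n] by simp
  qed
  have "\<exists>l\<in>car H. (\<lambda>n. hnorm H (X n - l)) \<longlonglongrightarrow> 0"
  proof (rule complete[OF Xc])
    fix e :: real assume "e > 0"
    then obtain N where N: "inverse (real (Suc N)) < e\<^sup>2 / 4"
      using reals_Archimedean[of "e\<^sup>2 / 4"] by auto
    have "hnorm H (X m - X n) < e" if "m \<ge> N" "n \<ge> N" for m n
    proof (rule power2_less_imp_less)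
      have "inverse (real (Suc m)) \<le> inverse (real (Suc N))" "inverse (real (Suc n)) \<le> inverse (real (Suc N))"
        using that by auto
      then show "(hnorm H (X m - X n))\<^sup>2 < e\<^sup>2"
        using est[of m n] N by linarith
    qed (use \<open>e > 0\<close> in simp)
    then show "\<exists>N. \<forall>m\<ge>N. \<forall>n\<ge>N. hnorm H (X m - X n) < e"
      by blast
  qed
  then obtain l where l: "l \<in> car H" "(\<lambda>n. hnorm H (X n - l)) \<longlonglongrightarrow> 0"
    by blast
  have "\<exists>g\<in>M. hnorm H (l - g) < e" if "e > 0" for e
  proof -
    have "\<forall>\<^sub>F n in sequentially. hnorm H (X n - l) < e"
      using l(2) that by (rule order_tendstoD)
    then obtain n where "hnorm H (X n - l) < e"
      by (meson eventually_sequentially order_refl)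
    then show ?thesis
      using X(1) hnorm_minus[OF Xc l(1)] by auto
  qed
  then have lM: "l \<in> M"
    using l(1) M'(3) by (auto simp: hclosure_def)
  have le_d: "(hnorm H (f - l))\<^sup>2 \<le> d"
  proof (rule LIMSEQ_le_const)
    have "(\<lambda>n. (sqrt (d + inverse (real (Suc n))) + hnorm H (X n - l))\<^sup>2) \<longlonglongrightarrow> (sqrt (d + 0) + 0)\<^sup>2"
      by (intro tendsto_intros l(2) LIMSEQ_inverse_real_of_nat)
    moreover have "d \<ge> 0"
      unfolding d_def using ne by (intro cINF_greatest) auto
    ultimately show "(\<lambda>n. (sqrt (d + inverse (real (Suc n))) + hnorm H (X n - l))\<^sup>2) \<longlonglongrightarrow> d"
      by simp
    have "(hnorm H (f - l))\<^sup>2 \<le> (sqrt (d + inverse (real (Suc n))) + hnorm H (X n - l))\<^sup>2" for n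
    proof (rule power_mono)
      have "hnorm H (f - X n) \<le> sqrt (d + inverse (real (Suc n)))"
        using X(2)[of n] by (intro real_le_rsqrt) simp
      then show "hnorm H (f - l) \<le> sqrt (d + inverse (real (Suc n))) + hnorm H (X n - l)"
        using hnorm_triangle_diff[OF f Xc l(1), of n] by linarith
    qed (use f l in simp)
    then show "\<exists>N. \<forall>n\<ge>N. (hnorm H (f - l))\<^sup>2 \<le> (sqrt (d + inverse (real (Suc n))) + hnorm H (X n - l))\<^sup>2"
      by blast
  qed
  have "ip H (f - l) m = 0" if "m \<in> M" for m
  proof (cases "m = 0")
    case False
    have mc: "m \<in> car H"
      using that M' by auto
    \<comment> \<open>The competitor \<open>l + ?t\<close> lowers the squared distance by
      \<open>(cmod (ip H (f - l) m))\<^sup>2 / (hnorm H m)\<^sup>2\<close>, which minimality forces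
      to be 0.\<close>
    let ?t = "\<lambda>x. ip H (f - l) m / of_real ((hnorm H m)\<^sup>2) * m x"
    have t: "?t \<in> M"
      using fvs.subspace_scale[OF M'(2) that] .
    have "d \<le> (hnorm H (f - (l + ?t)))\<^sup>2"
      using lM t fvs.subspace_add[OF M'(2)] by (intro d_le) auto
    also have "f - (l + ?t) = (f - l) - ?t"
      by simp
    also have "(hnorm H \<dots>)\<^sup>2 = (hnorm H (f - l))\<^sup>2 - (cmod (ip H (f - l) m))\<^sup>2 / (hnorm H m)\<^sup>2"
      by (rule best_coefficient) (use f l mc False in auto)
    finally have "d \<le> (hnorm H (f - l))\<^sup>2 - (cmod (ip H (f - l) m))\<^sup>2 / (hnorm H m)\<^sup>2" .
    then have "(cmod (ip H (f - l) m))\<^sup>2 / (hnorm H m)\<^sup>2 \<le> 0"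
      using le_d by linarith
    then show ?thesis
      using False mc hnorm_eq_0 by (simp add: divide_le_0_iff)
  qed (use f l in simp)
  then show thesis
    using that[OF lM] f l by (simp add: orth_def)
qed

lemma orth_orth:
  assumes M: "closed_subspace H M"
  shows "orth H (orth H M) = M"
proof
  note M' = closed_subspaceD[OF M]
  show "M \<subseteq> orth H (orth H M)"
    using M'(1) orth_iff[of "orth H M"] by (auto simp: orth_def)
  show "orth H (orth H M) \<subseteq> M"
  proof
    fix f assume f: "f \<in> orth H (orth H M)"
    then have fc: "f \<in> car H"
      by (simp add: orth_def)
    obtain g where g: "g \<in> M" "f - g \<in> orth H M"
      using orthogonal_projection[OF M fc] .
    have gc: "g \<in> car H"
      using g M' by auto
    have "ip H (f - g) f = 0" "ip H (f - g) g = 0"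
      using f g fc gc ip_eq_0_commute[of f "f - g"] unfolding orth_def by blast+
    then have "ip H (f - g) (f - g) = 0"
      using fc gc by simp
    then have "f - g = 0"
      by (intro ip_definite car_diff fc gc)
    then show "f \<in> M"
      using g by simp
  qed
qed

lemma closed_subspace_eq_car:
  assumes M: "closed_subspace H M" and "\<And>h. h \<in> orth H M \<Longrightarrow> h = 0"
  shows "M = car H"
proof -
  have "orth H M \<subseteq> {0}"
    using assms by auto
  then have "car H \<subseteq> orth H (orth H M)"
    by (auto simp: orth_def)
  then show ?thesis
    using orth_orth[OF M] closed_subspaceD[OF M] by auto
qed

lemma hclosure_span_eq_car:
  assumes X: "X \<subseteq> car H" and "\<And>h. \<lbrakk>h \<in> car H; \<And>x. x \<in> X \<Longrightarrow> ip H x h = 0\<rbrakk> \<Longrightarrow> h = 0"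
  shows "hclosure H (fvs.span X) = car H"
proof (rule closed_subspace_eq_car)
  show "closed_subspace H (hclosure H (fvs.span X))"
    using span_car[OF X] by (intro closed_subspace_hclosure) auto
  fix h assume "h \<in> orth H (hclosure H (fvs.span X))"
  then have "h \<in> orth H X"
    using orth_hclosure_span[OF X] by simp
  then show "h = 0"
    using X by (intro assms(2)) (auto simp: orth_iff)
qed

section \<open>Riesz representation\<close>

theorem Riesz_representation:
  assumes add: "\<And>f g. \<lbrakk>f \<in> car H; g \<in> car H\<rbrakk> \<Longrightarrow> \<phi> (f + g) = \<phi> f + \<phi> g"
    and scale: "\<And>c f. f \<in> car H \<Longrightarrow> \<phi> (\<lambda>x. c * f x) = (c::complex) * \<phi> f"
    and bdd: "\<And>f. f \<in> car H \<Longrightarrow> cmod (\<phi> f) \<le> C * hnorm H f"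
  obtains r where "r \<in> car H" "\<And>f. f \<in> car H \<Longrightarrow> \<phi> f = ip H f r"
proof -
  define M where "M = {f \<in> car H. \<phi> f = 0}"
  have sub: "M \<subseteq> car H" "fvs.subspace M"
    unfolding fvs.subspace_def using add scale scale[of 0 0] by (auto simp: M_def zero_fun_def)
  have "hclosure H M \<subseteq> M"
  proof
    fix f assume f: "f \<in> hclosure H M"
    have "\<phi> f = 0"
      by (rule functional_zero_on_hclosure[of M \<phi> C])
         (use add scale bdd sub f in \<open>auto simp: M_def fvs.span_eq_iff[THEN iffD2]\<close>)
    then show "f \<in> M"
      using f by (auto simp: M_def hclosure_def)
  qed
  then have M: "closed_subspace H M"
    using sub subset_hclosure[OF sub(1)] by (auto simp: closed_subspace_def)
  show thesis
  proof (cases "M = car H")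
    case True
    then show thesis
      using that[of 0] by (auto simp: M_def)
  next
    case False
    then obtain u where u: "u \<in> car H" "u \<notin> M"
      using sub by auto
    obtain g where g: "g \<in> M" "u - g \<in> orth H M"
      using orthogonal_projection[OF M u(1)] .
    define v where "v = u - g"
    have v: "v \<in> car H" "v \<in> orth H M"
      using g by (auto simp: v_def orth_def)
    have "v \<noteq> 0"
      using g u by (auto simp: v_def)
    then have nv: "hnorm H v \<noteq> 0" and "ip H v v \<noteq> 0"
      using v hnorm_eq_0 ip_definite by auto
    then have pv: "\<phi> v \<noteq> 0"
      using v by (auto simp: orth_def M_def)
    show thesis
    proof (rule that[of "\<lambda>x. (cnj (\<phi> v) / of_real ((hnorm H v)\<^sup>2)) * v x"])
      fix f assume f: "f \<in> car H"
      \<comment> \<open>Modulo the kernel, \<open>f\<close> is a multiple of \<open>v\<close>; as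
        \<open>v\<close> is orthogonal to the kernel, pairing with \<open>v\<close> reads off the
        multiple.\<close>
      define m where "m = f + (\<lambda>x. (- (\<phi> f / \<phi> v)) * v x)"
      have sc: "(\<lambda>x. (- (\<phi> f / \<phi> v)) * v x) \<in> car H"
        using car_scale[OF v(1)] .
      have "\<phi> m = 0"
        unfolding m_def by (subst add[OF f sc], subst scale[OF v(1)]) (use pv in simp)
      then have "m \<in> M"
        using f sc by (simp add: M_def m_def)
      then have "ip H m v = 0"
        using v sub by (simp add: orth_iff)
      moreover have "ip H m v = ip H f v - \<phi> f / \<phi> v * of_real ((hnorm H v)\<^sup>2)"
        unfolding m_def by (subst ip_add_left[OF f sc v(1)], subst ip_scale_left[OF v(1) v(1)]) (use v in \<open>simp add: ip_self\<close>)
      ultimately have "ip H f v = \<phi> f / \<phi> v * of_real ((hnorm H v)\<^sup>2)"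
        by simp
      then show "\<phi> f = ip H f (\<lambda>x. (cnj (\<phi> v) / of_real ((hnorm H v)\<^sup>2)) * v x)"
        by (subst ip_scale_right[OF v(1) f]) (use pv nv in simp)
    qed (rule car_scale[OF v(1)])
  qed
qed

end

lemma restr_simps [simp]:
  "car (restr H S) = S" "ip (restr H S) = ip H" "hnorm (restr H S) = hnorm H"
  by (simp_all add: restr_def hnorm_def fun_eq_iff)

lemma (in hilbert) hilbert_restr:
  assumes S: "closed_subspace H S"
  shows "hilbert (restr H S)"
proof -
  note S' = closed_subspaceD[OF S]
  show ?thesis
  proof unfold_locales
    fix X :: "nat \<Rightarrow> 'x \<Rightarrow> complex"
    assume X: "\<And>n. X n \<in> car (restr H S)"
      and Cauchy: "\<And>e. e > 0 \<Longrightarrow> \<exists>N. \<forall>m\<ge>N. \<forall>n\<ge>N. hnorm (restr H S) (X m - X n) < e"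
    have "X n \<in> car H" for n
      using X[of n] S'(1) by auto
    from complete[of X, OF this] Cauchy obtain l where l: "l \<in> car H" "(\<lambda>n. hnorm H (X n - l)) \<longlonglongrightarrow> 0"
      by auto
    have "\<exists>g\<in>S. hnorm H (l - g) < e" if "e > 0" for e
    proof -
      have "\<forall>\<^sub>F n in sequentially. hnorm H (X n - l) < e"
        using l(2) that by (rule order_tendstoD)
      then obtain n where "hnorm H (X n - l) < e"
        by (meson eventually_sequentially order_refl)
      then show ?thesis
        using X[of n] hnorm_minus[of "X n" l] l S'(1) by (auto simp: subset_iff)
    qed
    then have "l \<in> S"
      using l(1) S'(3) by (auto simp: hclosure_def)
    then show "\<exists>l\<in>car (restr H S). (\<lambda>n. hnorm (restr H S) (X n - l)) \<longlonglongrightarrow> 0"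
      using l by auto
  next
    fix f g assume "f \<in> car (restr H S)" "g \<in> car (restr H S)"
    then show "ip (restr H S) g f = cnj (ip (restr H S) f g)"
      using S' ip_commute[of f g] by auto
  qed (use S' ip_nonneg ip_definite in \<open>auto simp: subset_iff\<close>)
qed

section \<open>Multiplicity\<close>

text \<open>More unknowns than equations. The rows, cut off outside \<open>G\<close>, lie in the
  span of the delta functions at the points of \<open>G\<close>, so there are too many of them to be
  independent.\<close>

lemma homogeneous_system_nontrivial:
  fixes M :: "'a \<Rightarrow> 'b \<Rightarrow> complex"
  assumes I: "finite I" and G: "finite G" and less: "card G < card I"
  obtains c where "\<And>g. g \<in> G \<Longrightarrow> (\<Sum>a\<in>I. c a * M a g) = 0" "\<exists>a\<in>I. c a \<noteq> 0"
proof -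
  define r where "r a = (\<lambda>g. if g \<in> G then M a g else 0)" for a
  define \<delta> where "\<delta> g = (\<lambda>x. if x = g then 1 else (0::complex))" for g :: 'b
  show thesis
  proof (cases "inj_on r I")
    case False
    then obtain a b where ab: "a \<in> I" "b \<in> I" "a \<noteq> b" "r a = r b"
      by (auto simp: inj_on_def)
    have eq: "M a g = M b g" if "g \<in> G" for g
      using fun_cong[OF ab(4), of g] that by (simp add: r_def)
    define c where "c x = (if x = a then 1 else if x = b then -1 else (0::complex))" for x
    have "(\<Sum>x\<in>I. c x * M x g) = 0" if "g \<in> G" for g
    proof -
      have "(\<Sum>x\<in>I. c x * M x g) = (\<Sum>x\<in>{a, b}. c x * M x g)"
        using I ab by (intro sum.mono_neutral_right) (auto simp: c_def)
      then show ?thesis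
        using ab(3) eq[OF that] by (simp add: c_def)
    qed
    then show thesis
      using ab(1) by (intro that[of c]) (auto simp: c_def)
  next
    case True
    have "r ` I \<subseteq> fvs.span (\<delta> ` G)"
    proof (rule image_subsetI)
      fix a
      have "r a = (\<Sum>g\<in>G. (\<lambda>x. M a g * \<delta> g x))"
      proof
        fix x
        have "(\<Sum>g\<in>G. (\<lambda>x. M a g * \<delta> g x)) x = (\<Sum>g\<in>G. M a g * \<delta> g x)"
          using G by (induction G rule: finite_induct) auto
        also have "\<dots> = (\<Sum>g\<in>G. if x = g then M a g else 0)"
          by (intro sum.cong) (auto simp: \<delta>_def)
        also have "\<dots> = r a x"
          using G by (simp add: r_def)
        finally show "r a x = (\<Sum>g\<in>G. (\<lambda>x. M a g * \<delta> g x)) x" ..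
      qed
      then show "r a \<in> fvs.span (\<delta> ` G)"
        by (simp only:) (intro fvs.span_sum fvs.span_scale fvs.span_base, simp)
    qed
    moreover have "\<not> card (r ` I) \<le> card (\<delta> ` G)"
      using less card_image[OF True] card_image_le[OF G, of \<delta>] by simp
    ultimately have "fvs.dependent (r ` I)"
      using fvs.independent_span_bound[of "\<delta> ` G" "r ` I"] G by auto
    then obtain u v where u: "(\<Sum>v\<in>r ` I. (\<lambda>x. u v * v x)) = 0" and v: "v \<in> r ` I" "u v \<noteq> 0"
      using fvs.dependent_finite[of "r ` I"] I by auto
    have "(\<Sum>a\<in>I. (\<lambda>x. u (r a) * r a x)) = 0"
      using u by (simp add: sum.reindex[OF True])
    moreover have "(\<Sum>a\<in>I. (\<lambda>x. u (r a) * r a x)) g = (\<Sum>a\<in>I. u (r a) * r a g)" for g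
      using I by (induction I rule: finite_induct) auto
    ultimately have "(\<Sum>a\<in>I. u (r a) * r a g) = 0" for g
      by (metis zero_fun_apply)
    moreover have "r a g = M a g" if "g \<in> G" for a g
      using that by (simp add: r_def)
    ultimately have "(\<Sum>a\<in>I. u (r a) * M a g) = 0" if "g \<in> G" for g
      using that by (metis (mono_tags, lifting) sum.cong)
    then show thesis
      using v by (intro that[of "\<lambda>a. u (r a)"]) auto
  qed
qed

section \<open>Monomials in commuting operators\<close>

lemma funpow_commute_funpow:
  assumes "f \<circ> g = g \<circ> f"
  shows "(f ^^ m) \<circ> (g ^^ n) = (g ^^ n) \<circ> (f ^^ m)"
proof -
  have pow: "p \<circ> (q ^^ m) = (q ^^ m) \<circ> p" if "p \<circ> q = q \<circ> p" for p q :: "'a \<Rightarrow> 'a" and m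
  proof (induction m)
    case (Suc m)
    have "p \<circ> (q ^^ Suc m) = q \<circ> (p \<circ> (q ^^ m))"
      by (simp add: that flip: comp_assoc)
    then show ?case
      by (simp only: Suc funpow.simps flip: comp_assoc)
  qed simp
  show ?thesis
    by (intro pow pow[symmetric] assms)
qed

text \<open>Gives access to the fold by induction: commuting powers make it a member of its graph,
  and rule induction on the graph then builds the monomial one index at a time, in whatever
  order.\<close>

lemma op_monomial_fold_graph:
  assumes "\<And>i j. A i \<circ> A j = A j \<circ> A i"
  shows "fold_graph (\<lambda>i T. (A i ^^ k i) \<circ> T) id UNIV (op_monomial A k)"
proof -
  have *: "(A i ^^ m) ((A j ^^ n) F) = (A j ^^ n) ((A i ^^ m) F)" for i j m n F
    using fun_cong[OF funpow_commute_funpow[OF assms]] by (simp add: comp_def)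
  interpret comp_fun_commute "\<lambda>i T. (A i ^^ k i) \<circ> T"
    by unfold_locales ((rule ext)+, unfold comp_apply, rule *)
  show ?thesis
    unfolding op_monomial_def by (rule fold_graph_fold) auto
qed

lemma op_monomial_induct:
  assumes commute: "\<And>i j. A i \<circ> A j = A j \<circ> A i"
    and "P F" "\<And>i F. P F \<Longrightarrow> P (A i F)"
  shows "P (op_monomial A k F)"
proof -
  have pow: "P ((A i ^^ m) F)" if "P F" for i m F
    by (induction m) (use that assms(3) in auto)
  have "fold_graph (\<lambda>i T. (A i ^^ k i) \<circ> T) id I T \<Longrightarrow> P (T F)" for I T
    by (induction rule: fold_graph.induct) (use assms(2) pow in auto)
  then show ?thesis
    using op_monomial_fold_graph[OF commute] .
qed

lemma op_monomial_M\<^sub>z: "op_monomial (\<lambda>_::unit. M\<^sub>z) k = M\<^sub>z ^^ k ()"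
proof -
  have "fold_graph (\<lambda>i T. (M\<^sub>z ^^ k i) \<circ> T) id I T \<Longrightarrow> T = (if I = {} then id else M\<^sub>z ^^ k ())" for I :: "unit set" and T
    by (induction rule: fold_graph.induct) auto
  from this[of UNIV] show ?thesis
    using op_monomial_fold_graph[of "\<lambda>_::unit. M\<^sub>z" k] by simp
qed

lemma op_monomial_Mcoord: "op_monomial Mcoord k F = (\<lambda>z. monom_at k z * F z)"
proof -
  have pow: "(Mcoord i ^^ m) G = (\<lambda>z. (z $ i) ^ m * G z)" for i m and G :: "complex ^ 'a \<Rightarrow> complex"
    by (induction m) (auto simp: Mcoord_def fun_eq_iff)
  have "fold_graph (\<lambda>i T. (Mcoord i ^^ k i) \<circ> T) id I T \<Longrightarrow> finite I \<and> T F = (\<lambda>z. (\<Prod>i\<in>I. (z $ i) ^ k i) * F z)" for I T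
    by (induction rule: fold_graph.induct) (auto simp: pow fun_eq_iff)
  from this[of UNIV] show ?thesis
    using op_monomial_fold_graph[of Mcoord k] by (simp add: monom_at_def fun_eq_iff Mcoord_def)
qed

section \<open>Generating sets: a duality criterion and a lower bound for their size\<close>

context hilbert
begin

lemma generated_eq_carI:
  assumes mono: "\<And>k g. g \<in> G \<Longrightarrow> op_monomial A k g \<in> car H"
    and "\<And>h. \<lbrakk>h \<in> car H; \<And>k g. g \<in> G \<Longrightarrow> ip H (op_monomial A k g) h = 0\<rbrakk> \<Longrightarrow> h = 0"
  shows "generated H A G = car H"
  unfolding generated_def
proof (rule hclosure_span_eq_car)
  show "{op_monomial A k g | k g. g \<in> G} \<subseteq> car H"
    using mono by auto
  fix h assume "h \<in> car H" and *: "\<And>x. x \<in> {op_monomial A k g | k g. g \<in> G} \<Longrightarrow> ip H x h = 0"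
  then show "h = 0"
    by (intro assms(2) *) auto
qed

text \<open>Vectors \<open>v a\<close> that are joint eigenvectors of the adjoint tuple for one common eigenvalue
  \<open>\<mu>\<close> see a generating set only through its own values, since on \<open>A\<^sup>k g\<close> they differ from their
  values on \<open>g\<close> by a scalar factor independent of \<open>a\<close>.\<close>

theorem card_le_generating_set:
  assumes commute: "\<And>i j. A i \<circ> A j = A j \<circ> A i"
    and A_car: "\<And>i F. F \<in> car H \<Longrightarrow> A i F \<in> car H"
    and I: "finite I"
    and v: "\<And>a. a \<in> I \<Longrightarrow> v a \<in> car K"
    and K: "hilbert K" "closed_subspace K (car H)" "ip H = ip K"
    and eigen: "\<And>i F a. \<lbrakk>F \<in> car H; a \<in> I\<rbrakk> \<Longrightarrow> ip K (A i F) (v a) = \<mu> i * ip K F (v a)"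
    and indep: "\<And>c a. \<lbrakk>\<And>F. F \<in> car H \<Longrightarrow> (\<Sum>a\<in>I. c a * ip K F (v a)) = 0; a \<in> I\<rbrakk> \<Longrightarrow> c a = 0"
    and G: "G \<subseteq> car H" "generated H A G = car H"
  shows "enat (card I) \<le> ecard G"
proof (rule ccontr)
  assume "\<not> ?thesis"
  then have fin: "finite G" and less: "card G < card I"
    by (auto simp: ecard_def split: if_splits)
  \<comment> \<open>With fewer generators than eigenvectors, some nontrivial combination of the
    eigenvectors annihilates every generator, hence every monomial and by continuity all of
    \<open>H\<close>, against \<open>indep\<close>.\<close>
  obtain c where c: "\<And>g. g \<in> G \<Longrightarrow> (\<Sum>a\<in>I. c a * ip K g (v a)) = 0" and nz: "\<exists>a\<in>I. c a \<noteq> 0"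
    using homogeneous_system_nontrivial[OF I fin less, where M = "\<lambda>a g. ip K g (v a)"] by blast
  interpret K: hilbert K by fact
  have HK: "car H \<subseteq> car K"
    using K(2) by (simp add: closed_subspace_def)
  have nrm: "hnorm H = hnorm K"
    by (simp add: hnorm_def K(3) fun_eq_iff)
  define V where "V = (\<Sum>a\<in>I. (\<lambda>x. cnj (c a) * v a x))"
  have V: "V \<in> car K"
    unfolding V_def by (intro K.car_sum K.car_scale v)
  have ipV: "ip K F V = (\<Sum>a\<in>I. c a * ip K F (v a))" if "F \<in> car K" for F
    unfolding V_def by (subst K.ip_sum_right) (use that v in auto)
  have mono: "op_monomial A k g \<in> car H \<and> ip K (op_monomial A k g) V = 0" if "g \<in> G" for k g
  proof -
    have "op_monomial A k g \<in> car H \<and> (\<exists>s. \<forall>a\<in>I. ip K (op_monomial A k g) (v a) = s * ip K g (v a))"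
    proof (rule op_monomial_induct[OF commute])
      show "g \<in> car H \<and> (\<exists>s. \<forall>a\<in>I. ip K g (v a) = s * ip K g (v a))"
        using G that by (auto intro: exI[of _ 1])
      fix i F assume "F \<in> car H \<and> (\<exists>s. \<forall>a\<in>I. ip K F (v a) = s * ip K g (v a))"
      then obtain s where "F \<in> car H" "\<forall>a\<in>I. ip K F (v a) = s * ip K g (v a)"
        by auto
      then show "A i F \<in> car H \<and> (\<exists>s. \<forall>a\<in>I. ip K (A i F) (v a) = s * ip K g (v a))"
        using A_car[of F i] eigen[of F _ i] by (intro conjI exI[of _ "\<mu> i * s"]) auto
    qed
    then obtain s where *: "op_monomial A k g \<in> car H" "\<And>a. a \<in> I \<Longrightarrow> ip K (op_monomial A k g) (v a) = s * ip K g (v a)"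
      by auto
    have "ip K (op_monomial A k g) V = (\<Sum>a\<in>I. c a * (s * ip K g (v a)))"
      using *(1) HK *(2) by (subst ipV) auto
    also have "\<dots> = s * (\<Sum>a\<in>I. c a * ip K g (v a))"
      by (simp add: sum_distrib_left mult.left_commute)
    finally show ?thesis
      using * c[OF that] by simp
  qed
  have "(\<Sum>a\<in>I. c a * ip K F (v a)) = 0" if "F \<in> car H" for F
  proof -
    have "F \<in> hclosure K (fvs.span {op_monomial A k g | k g. g \<in> G})"
      using that G(2) HK by (auto simp: generated_def hclosure_def nrm)
    then have "ip K F V = 0"
    proof (rule K.orthogonal_hclosure[rotated -1])
      show "{op_monomial A k g | k g. g \<in> G} \<subseteq> car K"
        using mono HK by blast
      show "ip K x V = 0" if "x \<in> {op_monomial A k g | k g. g \<in> G}" for x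
        using mono that by blast
    qed (rule V)
    then show ?thesis
      using ipV that HK by auto
  qed
  then show False
    using indep nz by blast
qed

end

section \<open>The wandering subspace property\<close>

text \<open>The assumption \<open>analytic\<close> is a uniform form of the triviality of the
  intersection of the ranges of the powers of \<open>T\<close>: relative to its norm,
  \<open>(T ^^ n) g\<close> becomes orthogonal to \<open>h\<close> uniformly in \<open>g\<close>. It
  thereby controls remainders \<open>(T ^^ n) ((L ^^ n) h)\<close> that are merely bounded.\<close>

locale shift_operator = hilbert H for H :: "'x hspace" +
  fixes T :: "('x \<Rightarrow> complex) \<Rightarrow> 'x \<Rightarrow> complex" and c C :: real
  assumes T_car [simp]: "f \<in> car H \<Longrightarrow> T f \<in> car H"
    and T_add: "\<lbrakk>f \<in> car H; g \<in> car H\<rbrakk> \<Longrightarrow> T (f + g) = T f + T g"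
    and T_scale: "f \<in> car H \<Longrightarrow> T (\<lambda>x. a * f x) = (\<lambda>x. a * T f x)"
    and T_bounded: "f \<in> car H \<Longrightarrow> hnorm H (T f) \<le> C * hnorm H f"
    and c_pos: "c > 0"
    and T_below: "f \<in> car H \<Longrightarrow> c * hnorm H f \<le> hnorm H (T f)"
    and analytic: "\<lbrakk>h \<in> car H; e > 0\<rbrakk> \<Longrightarrow>
      \<exists>N. \<forall>n\<ge>N. \<forall>g\<in>car H. cmod (ip H ((T ^^ n) g) h) \<le> e * hnorm H ((T ^^ n) g)"
begin

abbreviation W :: "('x \<Rightarrow> complex) set" where
  "W \<equiv> orth H (T ` car H)"

lemma W_car: "w \<in> W \<Longrightarrow> w \<in> car H"
  by (simp add: orth_def)

lemma T_diff: "\<lbrakk>f \<in> car H; g \<in> car H\<rbrakk> \<Longrightarrow> T (f - g) = T f - T g"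
  by (metis T_add car_diff diff_add_cancel eq_diff_eq)

lemma T_0 [simp]: "T 0 = 0"
  using T_scale[of 0 0] by (simp add: zero_fun_def)

lemma funpow_T_diff: "\<lbrakk>f \<in> car H; g \<in> car H\<rbrakk> \<Longrightarrow> (T ^^ n) (f - g) = (T ^^ n) f - (T ^^ n) g"
proof (induction n)
  case (Suc n)
  have "(T ^^ n) f \<in> car H" "(T ^^ n) g \<in> car H"
    using Suc.prems by (induction n) auto
  then show ?case
    by (simp only: funpow.simps comp_apply Suc.IH[OF Suc.prems] T_diff)
qed simp

lemma funpow_T_car [simp]: "f \<in> car H \<Longrightarrow> (T ^^ n) f \<in> car H"
  by (induction n) auto

lemma inj_on_T: "inj_on T (car H)"
proof (rule inj_onI)
  fix f g assume fg: "f \<in> car H" "g \<in> car H" "T f = T g"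
  then have "hnorm H (T (f - g)) = 0"
    by (simp add: T_diff)
  then have "hnorm H (f - g) \<le> 0"
    using T_below[of "f - g"] fg c_pos by (simp add: mult_le_0_iff)
  then have "f - g = 0"
    by (intro hnorm_le_0 car_diff fg)
  then show "f = g"
    by simp
qed

lemma subspace_range: "fvs.subspace (T ` car H)"
  unfolding fvs.subspace_def
proof (intro conjI ballI allI)
  show "0 \<in> T ` car H"
    using T_scale[of 0 0] by (auto simp: zero_fun_def image_iff intro!: bexI[of _ 0])
  fix f g assume "f \<in> T ` car H" "g \<in> T ` car H"
  then show "f + g \<in> T ` car H"
    by (auto simp flip: T_add)
next
  fix a f assume "f \<in> T ` car H"
  then show "(\<lambda>x. a * f x) \<in> T ` car H"
    by (auto simp flip: T_scale)
qed

text \<open>As \<open>T\<close> is bounded below, preimages of a convergent sequence in the range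
  form a Cauchy sequence.\<close>

lemma closed_range: "closed_subspace H (T ` car H)"
proof -
  have sub: "T ` car H \<subseteq> car H"
    by auto
  have "hclosure H (T ` car H) \<subseteq> T ` car H"
  proof
    fix f assume f: "f \<in> hclosure H (T ` car H)"
    then have fc: "f \<in> car H"
      using hclosure_subset by auto
    have "\<exists>u\<in>car H. hnorm H (f - T u) < inverse (real (Suc n))" for n
      using hclosureE[OF f, of "inverse (real (Suc n))"] by auto
    then obtain u where u: "\<And>n. u n \<in> car H" "\<And>n. hnorm H (f - T (u n)) < inverse (real (Suc n))"
      by metis
    have est: "c * hnorm H (u m - u n) \<le> inverse (real (Suc m)) + inverse (real (Suc n))" for m n
    proof -
      have "c * hnorm H (u m - u n) \<le> hnorm H (T (u m) - T (u n))"
        using T_below[of "u m - u n"] u(1) by (simp add: T_diff)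
      also have "\<dots> \<le> hnorm H (T (u m) - f) + hnorm H (f - T (u n))"
        using u(1) fc by (intro hnorm_triangle_diff) auto
      also have "hnorm H (T (u m) - f) = hnorm H (f - T (u m))"
        using u(1) fc by (intro hnorm_minus) auto
      finally show ?thesis
        using u(2)[of m] u(2)[of n] by linarith
    qed
    have "\<exists>l\<in>car H. (\<lambda>n. hnorm H (u n - l)) \<longlonglongrightarrow> 0"
    proof (rule complete[OF u(1)])
      fix e :: real assume e: "e > 0"
      then obtain N where N: "inverse (real (Suc N)) < c * e / 2"
        using reals_Archimedean[of "c * e / 2"] c_pos by auto
      have "hnorm H (u m - u n) < e" if "m \<ge> N" "n \<ge> N" for m n
      proof -
        have "inverse (real (Suc m)) \<le> inverse (real (Suc N))" "inverse (real (Suc n)) \<le> inverse (real (Suc N))"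
          using that by auto
        then have "c * hnorm H (u m - u n) < c * e"
          using est[of m n] N by linarith
        then show ?thesis
          using c_pos by simp
      qed
      then show "\<exists>N. \<forall>m\<ge>N. \<forall>n\<ge>N. hnorm H (u m - u n) < e"
        by blast
    qed
    then obtain l where l: "l \<in> car H" "(\<lambda>n. hnorm H (u n - l)) \<longlonglongrightarrow> 0"
      by blast
    have "hnorm H (f - T l) \<le> 0"
    proof (rule LIMSEQ_le_const)
      have "(\<lambda>n. inverse (real (Suc n)) + C * hnorm H (u n - l)) \<longlonglongrightarrow> 0 + C * 0"
        by (intro tendsto_intros l(2) LIMSEQ_inverse_real_of_nat)
      then show "(\<lambda>n. inverse (real (Suc n)) + C * hnorm H (u n - l)) \<longlonglongrightarrow> 0"
        by simp
      have "hnorm H (f - T l) \<le> inverse (real (Suc n)) + C * hnorm H (u n - l)" for n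
        using hnorm_triangle_diff[of f "T (u n)" "T l"] T_bounded[of "u n - l"] u(1)[of n] u(2)[of n] fc l(1)
        by (simp add: T_diff)
      then show "\<exists>N. \<forall>n\<ge>N. hnorm H (f - T l) \<le> inverse (real (Suc n)) + C * hnorm H (u n - l)"
        by blast
    qed
    then have "f - T l = 0"
      by (intro hnorm_le_0 car_diff T_car fc l(1))
    then have "f = T l"
      by simp
    then show "f \<in> T ` car H"
      using l(1) by simp
  qed
  then show ?thesis
    using subset_hclosure[OF sub] subspace_range sub by (auto simp: closed_subspace_def)
qed

text \<open>The left inverse of \<open>T\<close> that vanishes on \<open>W\<close>, that is, the
  inverse of T^*T followed after T^*. It is read off from the projection onto the closed range,
  which avoids inverting an operator.\<close>

definition L :: "('x \<Rightarrow> complex) \<Rightarrow> 'x \<Rightarrow> complex" where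
  "L f = (SOME u. u \<in> car H \<and> f - T u \<in> W)"

lemma L_props:
  assumes "f \<in> car H"
  shows L_car [simp]: "L f \<in> car H" and L_W: "f - T (L f) \<in> W"
proof -
  obtain g where "g \<in> T ` car H" "f - g \<in> W"
    using orthogonal_projection[OF closed_range assms] .
  then have "\<exists>u. u \<in> car H \<and> f - T u \<in> W"
    by auto
  then have "L f \<in> car H \<and> f - T (L f) \<in> W"
    unfolding L_def by (rule someI_ex)
  then show "L f \<in> car H" "f - T (L f) \<in> W"
    by auto
qed

lemma L_unique:
  assumes f: "f \<in> car H" and u: "u \<in> car H" "f - T u \<in> W"
  shows "L f = u"
proof -
  have sub: "fvs.subspace W"
    by (rule closed_subspaceD, rule closed_subspace_orth) auto
  have "(f - T u) - (f - T (L f)) \<in> W"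
    using fvs.subspace_diff[OF sub] u L_W[OF f] by blast
  moreover have "(f - T u) - (f - T (L f)) = T (L f - u)"
    using f u by (simp add: T_diff)
  ultimately have "T (L f - u) \<in> W"
    by simp
  then have "ip H (T (L f - u)) (T (L f - u)) = 0"
    using f u by (auto simp: orth_def simp del: ip_diff_left ip_diff_right)
  then have "T (L f - u) = 0"
    by (intro ip_definite T_car car_diff L_car f u)
  then have "T (L f) = T u"
    using f u by (simp add: T_diff)
  then show ?thesis
    using inj_onD[OF inj_on_T] f u by auto
qed

lemma L_T [simp]: "f \<in> car H \<Longrightarrow> L (T f) = f"
  by (rule L_unique) (auto simp: orth_def)

lemma L_W_0: "w \<in> W \<Longrightarrow> L w = 0"
  by (rule L_unique) (auto simp: W_car)

lemma L_add:
  assumes "f \<in> car H" "g \<in> car H"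
  shows "L (f + g) = L f + L g"
proof (rule L_unique)
  have sub: "fvs.subspace W"
    by (rule closed_subspaceD, rule closed_subspace_orth) auto
  have "(f - T (L f)) + (g - T (L g)) \<in> W"
    using fvs.subspace_add[OF sub] L_W assms by blast
  then show "f + g - T (L f + L g) \<in> W"
    using assms by (simp add: T_add algebra_simps)
qed (use assms in auto)

lemma L_scale:
  assumes "f \<in> car H"
  shows "L (\<lambda>x. a * f x) = (\<lambda>x. a * L f x)"
proof (rule L_unique)
  have sub: "fvs.subspace W"
    by (rule closed_subspaceD, rule closed_subspace_orth) auto
  have "(\<lambda>x. a * (f - T (L f)) x) \<in> W"
    using fvs.subspace_scale[OF sub] L_W assms by blast
  then show "(\<lambda>x. a * f x) - T (\<lambda>x. a * L f x) \<in> W"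
    using assms by (simp add: T_scale fun_diff_def algebra_simps)
qed (use assms in auto)

lemma ip_W_T: "\<lbrakk>w \<in> W; f \<in> car H\<rbrakk> \<Longrightarrow> ip H w (T f) = 0"
  by (simp add: orth_def)

lemma ip_T_W: "\<lbrakk>w \<in> W; f \<in> car H\<rbrakk> \<Longrightarrow> ip H (T f) w = 0"
  by (metis T_car W_car ip_W_T ip_eq_0_commute)

lemma hnorm_decomp:
  assumes "f \<in> car H"
  shows "(hnorm H f)\<^sup>2 = (hnorm H (f - T (L f)))\<^sup>2 + (hnorm H (T (L f)))\<^sup>2"
proof -
  have "(hnorm H ((f - T (L f)) + T (L f)))\<^sup>2 = (hnorm H (f - T (L f)))\<^sup>2 + (hnorm H (T (L f)))\<^sup>2"
    using assms L_W[OF assms] ip_W_T by (intro pythagoras) auto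
  then show ?thesis by simp
qed

lemma hnorm_T_L: "f \<in> car H \<Longrightarrow> hnorm H (T (L f)) \<le> hnorm H f"
  using hnorm_decomp[of f] by (intro power2_le_imp_le[of "hnorm H (T (L f))"]) auto

lemma hnorm_L: "f \<in> car H \<Longrightarrow> c * hnorm H (L f) \<le> hnorm H f"
  using hnorm_T_L[of f] T_below[of "L f"] by simp

section \<open>The adjoints of \<open>T\<close> and of its left inverse\<close>

definition A :: "('x \<Rightarrow> complex) \<Rightarrow> 'x \<Rightarrow> complex" where
  "A g = (SOME r. r \<in> car H \<and> (\<forall>f\<in>car H. ip H (T f) g = ip H f r))"

text \<open>The Cauchy dual of \<open>T\<close>. Taking adjoints in \<open>L (T f) = f\<close> gives
  \<open>A (B g) = g\<close>, so that orbits of \<open>B\<close> are backward orbits of the adjoint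
  of \<open>T\<close>.\<close>

definition B :: "('x \<Rightarrow> complex) \<Rightarrow> 'x \<Rightarrow> complex" where
  "B g = (SOME r. r \<in> car H \<and> (\<forall>f\<in>car H. ip H (L f) g = ip H f r))"

lemma A_props:
  assumes g: "g \<in> car H"
  shows A_car [simp]: "A g \<in> car H" and ip_A: "\<And>f. f \<in> car H \<Longrightarrow> ip H (T f) g = ip H f (A g)"
proof -
  obtain r where "r \<in> car H" "\<And>f. f \<in> car H \<Longrightarrow> ip H (T f) g = ip H f r"
  proof (rule Riesz_representation)
    fix f assume f: "f \<in> car H"
    have "cmod (ip H (T f) g) \<le> hnorm H (T f) * hnorm H g"
      using f g by (intro Cauchy_Schwarz) auto
    also have "\<dots> \<le> (C * hnorm H f) * hnorm H g"
      using f g by (intro mult_right_mono T_bounded) auto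
    finally show "cmod (ip H (T f) g) \<le> (C * hnorm H g) * hnorm H f"
      by (simp add: mult_ac)
  qed (use g in \<open>auto simp: T_add T_scale\<close>)
  then have "\<exists>r. r \<in> car H \<and> (\<forall>f\<in>car H. ip H (T f) g = ip H f r)"
    by auto
  then have "A g \<in> car H \<and> (\<forall>f\<in>car H. ip H (T f) g = ip H f (A g))"
    unfolding A_def by (rule someI_ex)
  then show "A g \<in> car H" "\<And>f. f \<in> car H \<Longrightarrow> ip H (T f) g = ip H f (A g)"
    by auto
qed

lemma B_props:
  assumes g: "g \<in> car H"
  shows B_car [simp]: "B g \<in> car H" and ip_B: "\<And>f. f \<in> car H \<Longrightarrow> ip H (L f) g = ip H f (B g)"
proof -
  obtain r where "r \<in> car H" "\<And>f. f \<in> car H \<Longrightarrow> ip H (L f) g = ip H f r"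
  proof (rule Riesz_representation)
    fix f assume f: "f \<in> car H"
    have "cmod (ip H (L f) g) \<le> hnorm H (L f) * hnorm H g"
      using f g by (intro Cauchy_Schwarz) auto
    also have "\<dots> \<le> (1 / c * hnorm H f) * hnorm H g"
      using f g hnorm_L[OF f] c_pos by (intro mult_right_mono) (auto simp: field_simps)
    finally show "cmod (ip H (L f) g) \<le> (1 / c * hnorm H g) * hnorm H f"
      by (simp add: mult_ac)
  qed (use g in \<open>auto simp: L_add L_scale\<close>)
  then have "\<exists>r. r \<in> car H \<and> (\<forall>f\<in>car H. ip H (L f) g = ip H f r)"
    by auto
  then have "B g \<in> car H \<and> (\<forall>f\<in>car H. ip H (L f) g = ip H f (B g))"
    unfolding B_def by (rule someI_ex)
  then show "B g \<in> car H" "\<And>f. f \<in> car H \<Longrightarrow> ip H (L f) g = ip H f (B g)"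
    by auto
qed

lemma funpow_B_car [simp]: "g \<in> car H \<Longrightarrow> (B ^^ n) g \<in> car H"
  by (induction n) auto

lemma A_B [simp]: "g \<in> car H \<Longrightarrow> A (B g) = g"
  by (rule eq_by_ip) (simp_all add: ip_A[symmetric] ip_B[symmetric])

lemma orth_W_in_range:
  assumes "h \<in> car H" "\<And>w. w \<in> W \<Longrightarrow> ip H w h = 0"
  shows "h \<in> T ` car H"
proof -
  have "h \<in> orth H W"
    using assms W_car by (subst orth_iff) auto
  then show ?thesis
    using orth_orth[OF closed_range] by simp
qed

text \<open>\<open>L\<close> annihilates \<open>W\<close>, so its adjoint maps into the complement
  of \<open>W\<close>, which is the closed range of \<open>T\<close>.\<close>

lemma B_in_range: "g \<in> car H \<Longrightarrow> B g \<in> T ` car H"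
  by (rule orth_W_in_range) (auto simp: ip_B[symmetric] W_car L_W_0)

text \<open>Such an \<open>h\<close> may be paired with itself in \<open>analytic\<close>; half its
  norm as tolerance makes its squared norm at most half of itself.\<close>

lemma funpow_T_0: "(\<And>n. \<exists>g\<in>car H. h = (T ^^ n) g) \<Longrightarrow> h = 0"
proof (rule ccontr)
  assume h: "\<And>n. \<exists>g\<in>car H. h = (T ^^ n) g" and "h \<noteq> 0"
  from h[of 0] have hc: "h \<in> car H"
    by auto
  then have pos: "hnorm H h > 0"
    using \<open>h \<noteq> 0\<close> hnorm_eq_0 hnorm_nonneg less_eq_real_def by metis
  obtain N where N: "\<forall>n\<ge>N. \<forall>g\<in>car H. cmod (ip H ((T ^^ n) g) h) \<le> hnorm H h / 2 * hnorm H ((T ^^ n) g)"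
    using analytic[OF hc, of "hnorm H h / 2"] pos by auto
  obtain g where "g \<in> car H" "h = (T ^^ N) g"
    using h[of N] by auto
  then have "cmod (ip H h h) \<le> hnorm H h / 2 * hnorm H h"
    using N by auto
  then have "(hnorm H h)\<^sup>2 \<le> (hnorm H h)\<^sup>2 / 2"
    using hc by (simp add: ip_self norm_power power2_eq_square norm_mult)
  then show False
    using pos by simp
qed

text \<open>Each step peels off \<open>(T ^^ n) (g - T (L g))\<close> with
  \<open>g = (L ^^ n) f\<close>; the bracket lies in \<open>W\<close>, so \<open>h\<close> does not
  see it.\<close>

lemma wandering_sum:
  assumes h: "h \<in> car H" and orth: "\<And>k w. w \<in> W \<Longrightarrow> ip H ((T ^^ k) w) h = 0" and f: "f \<in> car H"
  shows "ip H f h = ip H ((T ^^ n) ((L ^^ n) f)) h"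
proof (induction n)
  case (Suc n)
  have Ln: "(L ^^ n) f \<in> car H" for n
    using f by (induction n) auto
  define g where "g = (L ^^ n) f"
  have g: "g \<in> car H"
    using Ln by (simp add: g_def)
  have "ip H ((T ^^ n) (g - T (L g))) h = 0"
    by (rule orth[OF L_W[OF g]])
  then have "ip H ((T ^^ n) g) h = ip H ((T ^^ n) (T (L g))) h"
    using g h by (simp add: funpow_T_diff)
  then show ?case
    using Suc by (simp add: g_def funpow_swap1)
qed simp

end

text \<open>Richter's argument for concave operators: in \<open>h = \<Sum>\<^bsub>k<n\<^esub> T\<^sup>k P L\<^sup>k h + T\<^sup>n L\<^sup>n h\<close> the
  remainders stay bounded along a subsequence, because the defects
  \<open>\<parallel>T L\<^sup>k h\<parallel>\<^sup>2 - \<parallel>L\<^sup>k h\<parallel>\<^sup>2\<close> are summable.\<close>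

locale concave_operator = shift_operator +
  assumes expansive: "f \<in> car H \<Longrightarrow> hnorm H f \<le> hnorm H (T f)"
    and concave: "f \<in> car H \<Longrightarrow> (hnorm H (T (T f)))\<^sup>2 + (hnorm H f)\<^sup>2 \<le> 2 * (hnorm H (T f))\<^sup>2"
begin

definition defect :: "('a \<Rightarrow> complex) \<Rightarrow> real" where
  "defect f = (hnorm H (T f))\<^sup>2 - (hnorm H f)\<^sup>2"

lemma defect_nonneg: "f \<in> car H \<Longrightarrow> 0 \<le> defect f"
  unfolding defect_def using expansive[of f] by (simp add: power_mono)

lemma defect_T: "f \<in> car H \<Longrightarrow> defect (T f) \<le> defect f"
  unfolding defect_def using concave[of f] by simp

text \<open>Each application of \<open>T\<close> adds the current defect to the squared norm, and by
  concavity the defects do not increase along the orbit.\<close>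

lemma hnorm_funpow_T: "f \<in> car H \<Longrightarrow> (hnorm H ((T ^^ n) f))\<^sup>2 \<le> (hnorm H f)\<^sup>2 + n * defect f"
proof -
  assume f: "f \<in> car H"
  have d: "defect ((T ^^ n) f) \<le> defect f" for n
    by (induction n) (use f defect_T order_trans in \<open>auto intro: order_trans[OF defect_T]\<close>)
  show ?thesis
  proof (induction n)
    case (Suc n)
    then show ?case
      using d[of n] by (simp add: defect_def algebra_simps)
  qed simp
qed

lemma wandering_orth_0:
  assumes h: "h \<in> car H" and orth: "\<And>k w. w \<in> W \<Longrightarrow> ip H ((T ^^ k) w) h = 0"
  shows "h = 0"
proof (rule ccontr)
  assume "h \<noteq> 0"
  then have pos: "hnorm H h > 0"
    using h hnorm_eq_0 hnorm_nonneg less_eq_real_def by metis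
  have Lh [simp]: "(L ^^ n) h \<in> car H" for n
    using h by (induction n) auto
  \<comment> \<open>Telescoped from \<open>hnorm H (T (L g)) \<le> hnorm H g\<close>; it bounds both
    the sum of the defects and the norm of \<open>(L ^^ n) h\<close>.\<close>
  have sum: "(\<Sum>k<n. defect ((L ^^ Suc k) h)) + (hnorm H ((L ^^ n) h))\<^sup>2 \<le> (hnorm H h)\<^sup>2" for n
  proof (induction n)
    case (Suc n)
    have "(hnorm H (T ((L ^^ Suc n) h)))\<^sup>2 \<le> (hnorm H ((L ^^ n) h))\<^sup>2"
      using hnorm_T_L[OF Lh, of n] by (intro power_mono) auto
    with Suc show ?case
      unfolding sum.lessThan_Suc defect_def[of "(L ^^ Suc n) h"] by linarith
  qed simp
  have d0: "0 \<le> defect ((L ^^ k) h)" for k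
    by (rule defect_nonneg) simp
  \<comment> \<open>Otherwise the summable defects would eventually dominate the harmonic
    series.\<close>
  have "\<exists>n\<ge>N. n * defect ((L ^^ n) h) \<le> 1" for N
  proof (rule ccontr)
    assume no: "\<not> (\<exists>n\<ge>N. n * defect ((L ^^ n) h) \<le> 1)"
    have less: "1 / real n \<le> defect ((L ^^ n) h)" if "n \<ge> Suc N" for n
    proof -
      have "1 < real n * defect ((L ^^ n) h)"
        using no that by (metis Suc_leD not_le)
      then show ?thesis
        using that by (simp add: field_simps)
    qed
    have "summable (\<lambda>k. defect ((L ^^ Suc k) h))"
    proof (rule bounded_imp_summable)
      fix n
      show "(\<Sum>k\<le>n. defect ((L ^^ Suc k) h)) \<le> (hnorm H h)\<^sup>2"
        using sum[of "Suc n"] by (simp only: lessThan_Suc_atMost) (smt (verit) zero_le_power2)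
    qed (rule d0)
    then have "summable (\<lambda>k. defect ((L ^^ k) h))"
      by (rule summable_Suc_iff[THEN iffD1])
    then have "summable (\<lambda>k. 1 / real k)"
      by (rule summable_comparison_test'[where N = "Suc N"]) (use less in auto)
    then show False
      using not_summable_harmonic[where ?'a = real] by (simp add: inverse_eq_divide)
  qed
  then have freq: "\<exists>n\<ge>N. (hnorm H ((T ^^ n) ((L ^^ n) h)))\<^sup>2 \<le> (hnorm H h)\<^sup>2 + 1" for N
  proof -
    obtain n where n: "n \<ge> N" "n * defect ((L ^^ n) h) \<le> 1"
      using \<open>\<And>N. \<exists>n\<ge>N. n * defect ((L ^^ n) h) \<le> 1\<close> by blast
    have "(hnorm H ((L ^^ n) h))\<^sup>2 \<le> (hnorm H h)\<^sup>2"
    proof -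
      have "0 \<le> (\<Sum>k<n. defect ((L ^^ Suc k) h))"
        by (intro sum_nonneg d0)
      then show ?thesis
        using sum[of n] by linarith
    qed
    then show ?thesis
      using n hnorm_funpow_T[of "(L ^^ n) h" n] by (intro exI[of _ n]) auto
  qed
  \<comment> \<open>Chosen so that \<open>e\<close> times the bound on the remainders is half the
    squared norm of \<open>h\<close>.\<close>
  define e where "e = (hnorm H h)\<^sup>2 / (2 * sqrt ((hnorm H h)\<^sup>2 + 1))"
  have sq: "sqrt ((hnorm H h)\<^sup>2 + 1) > 0"
    by (smt (verit) real_sqrt_gt_zero zero_le_power2)
  then have e: "e > 0"
    using pos by (simp add: e_def)
  obtain N where N: "\<forall>n\<ge>N. \<forall>g\<in>car H. cmod (ip H ((T ^^ n) g) h) \<le> e * hnorm H ((T ^^ n) g)"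
    using analytic[OF h e] by auto
  obtain n where n: "n \<ge> N" "(hnorm H ((T ^^ n) ((L ^^ n) h)))\<^sup>2 \<le> (hnorm H h)\<^sup>2 + 1"
    using freq by auto
  have "(hnorm H h)\<^sup>2 = cmod (ip H h h)"
    using h by (simp add: ip_self norm_power norm_mult power2_eq_square)
  also have "\<dots> = cmod (ip H ((T ^^ n) ((L ^^ n) h)) h)"
    using wandering_sum[OF h orth h, of n] by simp
  also have "\<dots> \<le> e * hnorm H ((T ^^ n) ((L ^^ n) h))"
    using N n by auto
  also have "\<dots> \<le> e * sqrt ((hnorm H h)\<^sup>2 + 1)"
    using n e by (intro mult_left_mono real_le_rsqrt) auto
  also have "\<dots> = (hnorm H h)\<^sup>2 / 2"
    using sq by (simp add: e_def)
  finally show False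
    using pos by simp
qed

text \<open>Here \<open>B\<close> is even a contraction, because \<open>L\<close> is one:
  \<open>T\<close> is expansive and \<open>T (L f)\<close> is a projection of \<open>f\<close>. The
  linear factor only brings the bound into the form shared with the Bergman case.\<close>

lemma hnorm_funpow_B: "w \<in> car H \<Longrightarrow> hnorm H ((B ^^ n) w) \<le> (real n + 1) * hnorm H w"
proof -
  assume w: "w \<in> car H"
  have B: "hnorm H (B g) \<le> hnorm H g" if g: "g \<in> car H" for g
  proof (cases "hnorm H (B g) = 0")
    case False
    have "(hnorm H (B g))\<^sup>2 = Re (ip H (L (B g)) g)"
      using g by (simp add: ip_B hnorm_sq)
    also have "\<dots> \<le> hnorm H (L (B g)) * hnorm H g"
      using g by (intro order_trans[OF complex_Re_le_cmod] Cauchy_Schwarz) auto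
    also have "\<dots> \<le> hnorm H (B g) * hnorm H g"
      using g expansive[of "L (B g)"] hnorm_T_L[of "B g"] by (intro mult_right_mono) auto
    finally show ?thesis
      using False hnorm_nonneg[OF B_car[OF g]] by (simp add: power2_eq_square less_le)
  qed (use g in simp)
  have "hnorm H ((B ^^ n) w) \<le> hnorm H w"
  proof (induction n)
    case (Suc n)
    then show ?case
      using B[of "(B ^^ n) w"] w by simp
  qed simp
  also have "\<dots> \<le> (real n + 1) * hnorm H w"
    using w by (simp add: algebra_simps)
  finally show ?thesis .
qed

end

text \<open>Shimorin's argument: the inequality says \<open>T T\<^sup>* + (T\<^sup>* T)\<^sup>-\<^sup>1 \<le> 2\<close>, which makes the Cauchy
  dual \<open>B = T (T\<^sup>* T)\<^sup>-\<^sup>1\<close> concave.\<close>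

locale Shimorin_operator = shift_operator +
  assumes contractive: "f \<in> car H \<Longrightarrow> hnorm H (T f) \<le> hnorm H f"
    and Shimorin: "\<lbrakk>f \<in> car H; g \<in> car H\<rbrakk>
      \<Longrightarrow> (hnorm H (T f + g))\<^sup>2 \<le> 2 * ((hnorm H f)\<^sup>2 + (hnorm H (T g))\<^sup>2)"
begin

text \<open>Concavity of the Cauchy dual in a form without inverses. Put \<open>y = A (T u)\<close>:
  pairing \<open>T (A y) + u\<close> with \<open>y\<close> produces exactly the left side
  \<open>S\<close>, while Cauchy-Schwarz and the inequality \<open>Shimorin\<close> for
  \<open>A y\<close> and \<open>u\<close> bound \<open>S\<^sup>2\<close> by
  \<open>2 * S * (hnorm H y)\<^sup>2\<close>.\<close>

lemma dual_concave:
  assumes u: "u \<in> car H"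
  shows "(hnorm H (T u))\<^sup>2 + (hnorm H (A (A (T u))))\<^sup>2 \<le> 2 * (hnorm H (A (T u)))\<^sup>2"
proof -
  define y where "y = A (T u)"
  define S where "S = (hnorm H (T u))\<^sup>2 + (hnorm H (A y))\<^sup>2"
  have y [simp]: "y \<in> car H"
    using u by (simp add: y_def)
  have "ip H (T (A y) + u) y = of_real S"
    using u by (simp add: ip_A S_def ip_self) (simp add: y_def ip_A[symmetric] ip_self)
  moreover have S0: "S \<ge> 0"
    by (simp add: S_def)
  ultimately have "S = cmod (ip H (T (A y) + u) y)"
    by simp
  also have "\<dots> \<le> hnorm H (T (A y) + u) * hnorm H y"
    using u by (intro Cauchy_Schwarz) auto
  finally have "S\<^sup>2 \<le> (hnorm H (T (A y) + u) * hnorm H y)\<^sup>2"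
    by (intro power_mono) (auto simp: S_def)
  also have "\<dots> = (hnorm H (T (A y) + u))\<^sup>2 * (hnorm H y)\<^sup>2"
    by (simp add: power_mult_distrib)
  also have "\<dots> \<le> (2 * S) * (hnorm H y)\<^sup>2"
    using Shimorin[of "A y" u] u by (intro mult_right_mono) (auto simp: S_def)
  finally have "S * S \<le> S * (2 * (hnorm H y)\<^sup>2)"
    by (simp add: power2_eq_square mult_ac)
  with S0 have "S \<le> 2 * (hnorm H y)\<^sup>2"
    by (cases "S = 0") auto
  then show ?thesis
    by (simp add: S_def y_def)
qed

lemma hnorm_A_sq_le: "h \<in> car H \<Longrightarrow> hnorm H (A h) \<le> hnorm H h"
proof (cases "hnorm H (A h) = 0")
  case False
  assume h: "h \<in> car H"
  have "(hnorm H (A h))\<^sup>2 = Re (ip H (T (A h)) h)"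
    using h by (simp add: ip_A hnorm_sq)
  also have "\<dots> \<le> hnorm H (T (A h)) * hnorm H h"
    using h by (intro order_trans[OF complex_Re_le_cmod] Cauchy_Schwarz) auto
  also have "\<dots> \<le> hnorm H (A h) * hnorm H h"
    using h contractive[of "A h"] by (intro mult_right_mono) auto
  finally show ?thesis
    using False hnorm_nonneg[OF A_car[OF h]] by (simp add: power2_eq_square less_le)
qed simp

text \<open>The orthogonality puts every \<open>a n = (A ^^ n) h\<close> into the range of
  \<open>T\<close>, where \<open>dual_concave\<close> makes the squared norms a concave sequence. A
  nonnegative concave sequence cannot decrease, since a first drop would repeat forever; but
  \<open>A\<close> is a contraction. Hence the norms are constant, equality in the contraction gives
  \<open>T (A (a n)) = a n\<close>, and \<open>h\<close> lies in the range of every power of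
  \<open>T\<close>.\<close>

lemma wandering_orth_0:
  assumes h: "h \<in> car H" and orth: "\<And>k w. w \<in> W \<Longrightarrow> ip H ((T ^^ k) w) h = 0"
  shows "h = 0"
proof -
  define a where "a n = (A ^^ n) h" for n
  have a [simp]: "a n \<in> car H" for n
    using h by (induction n) (auto simp: a_def)
  have a_Suc: "a (Suc n) = A (a n)" for n
    by (simp add: a_def)
  have shift: "ip H f (a n) = ip H ((T ^^ n) f) h" if "f \<in> car H" for f n
    using that
  proof (induction n arbitrary: f)
    case (Suc n)
    then show ?case
      using Suc.IH[of "T f"] by (simp add: a_Suc ip_A[symmetric] funpow_swap1)
  qed (simp add: a_def)
  have range: "a n \<in> T ` car H" for n
    by (rule orth_W_in_range) (auto simp: shift W_car orth)
  define s where "s n = (hnorm H (a n))\<^sup>2" for n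
  have conc: "s n + s (Suc (Suc n)) \<le> 2 * s (Suc n)" for n
    using range[of n] dual_concave by (auto simp: s_def a_Suc)
  have mono: "s n \<le> s (Suc n)" for n
  proof (rule ccontr)
    assume "\<not> ?thesis"
    define d where "d = s n - s (Suc n)"
    have "d > 0"
      using \<open>\<not> s n \<le> s (Suc n)\<close> by (simp add: d_def)
    have step: "s (n + k) - s (Suc (n + k)) \<ge> d" for k
    proof (induction k)
      case (Suc k)
      then show ?case
        using conc[of "n + k"] by simp
    qed (simp add: d_def)
    have "s (n + k) \<le> s n - k * d" for k
    proof (induction k)
      case (Suc k)
      then show ?case
        using step[of k] by (simp add: algebra_simps)
    qed simp
    moreover obtain k :: nat where "real k * d > s n"
      using reals_Archimedean3[OF \<open>d > 0\<close>] by blast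
    ultimately have "s (n + k) < 0"
      by (smt (verit))
    then show False
      by (simp add: s_def)
  qed
  have T_a: "a n = T (a (Suc n))" for n
  proof -
    have eq: "hnorm H (A (a n)) = hnorm H (a n)"
    proof (rule antisym)
      show "hnorm H (a n) \<le> hnorm H (A (a n))"
        by (rule power2_le_imp_le) (use mono[of n] in \<open>simp_all add: s_def a_Suc\<close>)
    qed (simp add: hnorm_A_sq_le)
    have "Re (ip H (T (A (a n))) (a n)) = (hnorm H (A (a n)))\<^sup>2"
      by (simp add: ip_A hnorm_sq)
    then have "(hnorm H (T (A (a n)) - a n))\<^sup>2 \<le> 0"
      using contractive[of "A (a n)"] eq by (subst hnorm_diff_sq) (auto intro: power_mono)
    then have "T (A (a n)) - a n = 0"
      using hnorm_eq_0[of "T (A (a n)) - a n"] by simp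
    then show ?thesis
      by (simp add: a_Suc)
  qed
  have "h = (T ^^ n) (a n)" for n
  proof (induction n)
    case (Suc n)
    then show ?case
      using T_a[of n] by (simp add: funpow_swap1)
  qed (simp add: a_def)
  then show ?thesis
    using a by (intro funpow_T_0) blast
qed

text \<open>The squared norms along the orbit are concave, so their increments are at most the first
  one, and that is at most \<open>s 0\<close>. Thus \<open>s n\<close> grows at most linearly, and
  the bound stated for the norm itself is generous.\<close>

lemma hnorm_funpow_B: "w \<in> car H \<Longrightarrow> hnorm H ((B ^^ n) w) \<le> (real n + 1) * hnorm H w"
proof -
  assume w: "w \<in> car H"
  define s where "s n = (hnorm H ((B ^^ n) w))\<^sup>2" for n
  have conc: "s (Suc (Suc n)) + s n \<le> 2 * s (Suc n)" for n
  proof -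
    define g where "g = (B ^^ n) w"
    have g: "g \<in> car H"
      using w by (simp add: g_def)
    \<comment> \<open>Since \<open>A\<close> undoes \<open>B\<close>, \<open>dual_concave\<close> at
      this \<open>u\<close> is the concavity inequality of \<open>B\<close> at
      \<open>g\<close>.\<close>
    obtain u where u: "u \<in> car H" "B (B g) = T u"
      using B_in_range[of "B g"] g by auto
    have "A (T u) = B g" "A (A (T u)) = g"
      using g by (simp_all flip: u(2))
    then show ?thesis
      using dual_concave[OF u(1)] u(2) by (simp add: s_def g_def)
  qed
  have B1: "s (Suc 0) \<le> 2 * s 0"
  proof -
    obtain u where u: "u \<in> car H" "B w = T u"
      using B_in_range[OF w] by auto
    have wu: "A (T u) = w"
      using w by (simp flip: u(2))
    have "(hnorm H (T u))\<^sup>2 \<le> 2 * (hnorm H (A (T u)))\<^sup>2"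
      using dual_concave[OF u(1)] by (smt (verit) zero_le_power2)
    then show ?thesis
      using u wu by (simp add: s_def)
  qed
  have d: "s (Suc n) - s n \<le> s 0" for n
  proof (induction n)
    case (Suc n)
    then show ?case
      using conc[of n] by simp
  qed (use B1 in simp)
  have "s n \<le> (n + 1) * s 0" for n
  proof (induction n)
    case (Suc n)
    then show ?case
      using d[of n] by (simp add: algebra_simps)
  qed simp
  also have "(real n + 1) * s 0 \<le> (real n + 1)\<^sup>2 * s 0"
    by (intro mult_right_mono) (auto simp: s_def power2_eq_square)
  finally have "(hnorm H ((B ^^ n) w))\<^sup>2 \<le> ((real n + 1) * hnorm H w)\<^sup>2"
    by (simp add: s_def power_mult_distrib)
  then show ?thesis
    by (rule power2_le_imp_le) (use w in auto)
qed

end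

text \<open>The vector series is never formed: its pairings with \<open>f\<close> converge
  absolutely by the growth bound, against the derivative of the geometric series, and Riesz
  representation recovers \<open>h\<close> from them.\<close>

lemma (in shift_operator) adjoint_eigenvector:
  assumes bound: "\<And>n w. w \<in> car H \<Longrightarrow> hnorm H ((B ^^ n) w) \<le> (real n + 1) * hnorm H w"
    and w: "w \<in> W" and l: "cmod l < 1"
  obtains h where "h \<in> car H" "\<And>f. f \<in> car H \<Longrightarrow> ip H (T f) h = l * ip H f h"
    "\<And>v. v \<in> W \<Longrightarrow> ip H v h = ip H v w"
proof -
  note wc = W_car[OF w]
  define \<phi> where "\<phi> f = (\<Sum>n. l ^ n * ip H f ((B ^^ n) w))" for f
  have geo: "summable (\<lambda>n. (real n + 1) * cmod l ^ n)"
    using summable_norm_cancel geometric_deriv_sums[of "cmod l"] l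
    by (auto simp: sums_iff add_ac dest!: summable_ignore_initial_segment[where k = 0])
  have term_le: "cmod (l ^ n * ip H f ((B ^^ n) w)) \<le> ((real n + 1) * cmod l ^ n) * (hnorm H w * hnorm H f)"
    if "f \<in> car H" for f n
  proof -
    have "cmod (ip H f ((B ^^ n) w)) \<le> hnorm H f * ((real n + 1) * hnorm H w)"
      using that wc bound[OF wc, of n]
      by (intro order_trans[OF Cauchy_Schwarz] mult_left_mono) auto
    then have "cmod (ip H f ((B ^^ n) w)) * cmod l ^ n \<le> (hnorm H f * ((real n + 1) * hnorm H w)) * cmod l ^ n"
      by (intro mult_right_mono) auto
    then show ?thesis
      by (simp add: norm_mult norm_power mult_ac)
  qed
  have geo2: "summable (\<lambda>n. ((real n + 1) * cmod l ^ n) * (hnorm H w * hnorm H f))" for f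
    by (rule summable_mult2[OF geo])
  have sm: "summable (\<lambda>n. l ^ n * ip H f ((B ^^ n) w))" if "f \<in> car H" for f
    by (rule summable_comparison_test'[OF geo2]) (rule term_le[OF that])
  obtain h where h: "h \<in> car H" "\<And>f. f \<in> car H \<Longrightarrow> \<phi> f = ip H f h"
  proof (rule Riesz_representation[of \<phi> "(\<Sum>n. (real n + 1) * cmod l ^ n) * hnorm H w"])
    fix f g assume fg: "f \<in> car H" "g \<in> car H"
    show "\<phi> (f + g) = \<phi> f + \<phi> g"
      unfolding \<phi>_def using fg wc by (subst suminf_add[OF sm sm]) (auto simp: algebra_simps)
  next
    fix a f assume f: "f \<in> car H"
    show "\<phi> (\<lambda>x. a * f x) = a * \<phi> f"
      unfolding \<phi>_def using f wc by (subst suminf_mult[OF sm, symmetric]) (auto simp: mult_ac)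
    have "cmod (\<phi> f) \<le> (\<Sum>n. ((real n + 1) * cmod l ^ n) * (hnorm H w * hnorm H f))"
      unfolding \<phi>_def
    proof (rule order_trans[OF summable_norm])
      show nsm: "summable (\<lambda>n. norm (l ^ n * ip H f ((B ^^ n) w)))"
        by (rule summable_comparison_test'[OF geo2[of f], of 0]) (use term_le[OF f] in simp)
      show "(\<Sum>n. norm (l ^ n * ip H f ((B ^^ n) w))) \<le> (\<Sum>n. ((real n + 1) * cmod l ^ n) * (hnorm H w * hnorm H f))"
        by (rule suminf_le[OF term_le[OF f] nsm geo2])
    qed
    then show "cmod (\<phi> f) \<le> (\<Sum>n. (real n + 1) * cmod l ^ n) * hnorm H w * hnorm H f"
      unfolding suminf_mult2[OF geo, symmetric] by (simp only: mult.assoc)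
  qed auto
  \<comment> \<open>One \<open>B\<close> is moved across as \<open>L\<close>. For \<open>T f\<close>
    the first term vanishes and \<open>L (T f) = f\<close> reproduces the series with a factor
    \<open>l\<close>; on \<open>W\<close> the whole tail vanishes.\<close>
  have split: "\<phi> f = ip H f w + (\<Sum>n. l ^ Suc n * ip H (L f) ((B ^^ n) w))" if f: "f \<in> car H" for f
    unfolding \<phi>_def using suminf_split_head[OF sm[OF f]] f wc by (simp add: ip_B)
  show thesis
  proof (rule that[OF h(1)])
    fix f assume f: "f \<in> car H"
    have "\<phi> (T f) = (\<Sum>n. l * (l ^ n * ip H f ((B ^^ n) w)))"
      using f ip_T_W[OF w f] by (subst split) (simp_all add: mult.assoc)
    also have "\<dots> = l * \<phi> f"
      unfolding \<phi>_def by (rule suminf_mult[OF sm[OF f]])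
    finally show "ip H (T f) h = l * ip H f h"
      using f by (simp add: h(2))
  next
    fix v assume v: "v \<in> W"
    then show "ip H v h = ip H v w"
      using W_car[OF v] wc L_W_0[OF v] by (simp add: h(2)[symmetric] split)
  qed
qed

section \<open>Weighted square-summable coefficient spaces\<close>

text \<open>The index is a natural number on the disc and a multi-index on the polydisc. Together,
  \<open>cf_inj\<close> and \<open>cf_surj\<close> identify the space with a full weighted l2 space,
  which gives completeness and lets vectors be prescribed by coefficients.\<close>

locale weighted_l2 =
  fixes H :: "'x hspace" and wt :: "'i \<Rightarrow> real" and cf :: "('x \<Rightarrow> complex) \<Rightarrow> 'i \<Rightarrow> complex"
  assumes wt_pos: "wt i > 0"
    and subspace_coeff: "fvs.subspace (car H)"
    and cf_add [simp]: "\<lbrakk>f \<in> car H; g \<in> car H\<rbrakk> \<Longrightarrow> cf (f + g) i = cf f i + cf g i"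
    and cf_scale [simp]: "f \<in> car H \<Longrightarrow> cf (\<lambda>x. c * f x) i = c * cf f i"
    and cf_inj: "\<lbrakk>f \<in> car H; \<And>i. cf f i = 0\<rbrakk> \<Longrightarrow> f = 0"
    and cf_surj: "(\<lambda>i. wt i * (cmod (a i))\<^sup>2) summable_on UNIV \<Longrightarrow> \<exists>f\<in>car H. cf f = a"
    and cf_summable: "f \<in> car H \<Longrightarrow> (\<lambda>i. wt i * (cmod (cf f i))\<^sup>2) summable_on UNIV"
    and ip_eq: "\<lbrakk>f \<in> car H; g \<in> car H\<rbrakk>
      \<Longrightarrow> ip H f g = (\<Sum>\<^sub>\<infinity>i. of_real (wt i) * cf f i * cnj (cf g i))"
begin

lemma wt_sq_nonneg [simp]: "0 \<le> wt i * (cmod z)\<^sup>2"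
  using wt_pos[of i] by simp

lemma has_sum_ip:
  assumes "f \<in> car H" "g \<in> car H"
  shows "((\<lambda>i. of_real (wt i) * cf f i * cnj (cf g i)) has_sum ip H f g) UNIV"
proof -
  have "(\<lambda>i. norm (of_real (wt i) * cf f i * cnj (cf g i))) summable_on UNIV"
  proof (rule summable_on_comparison_test)
    show "(\<lambda>i. wt i * (cmod (cf f i))\<^sup>2 + wt i * (cmod (cf g i))\<^sup>2) summable_on UNIV"
      using assms by (intro summable_on_add cf_summable)
    fix i
    define a b where "a = cmod (cf f i)" and "b = cmod (cf g i)"
    have "0 \<le> (a - b)\<^sup>2" "a \<ge> 0" "b \<ge> 0"
      by (auto simp: a_def b_def)
    then have "a * b \<le> a\<^sup>2 + b\<^sup>2"
      using mult_nonneg_nonneg[of a b] unfolding power2_diff by linarith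
    then have "wt i * (a * b) \<le> wt i * (a\<^sup>2 + b\<^sup>2)"
      using wt_pos[of i] by (intro mult_left_mono) auto
    then show "norm (of_real (wt i) * cf f i * cnj (cf g i)) \<le> wt i * (cmod (cf f i))\<^sup>2 + wt i * (cmod (cf g i))\<^sup>2"
      using wt_pos[of i] by (simp add: norm_mult a_def b_def algebra_simps)
  qed auto
  then show ?thesis
    using abs_summable_summable[of "\<lambda>i. of_real (wt i) * cf f i * cnj (cf g i)" UNIV] assms
    by (simp add: ip_eq)
qed

lemma ip_self_real: "f \<in> car H \<Longrightarrow> ip H f f = of_real (\<Sum>\<^sub>\<infinity>i. wt i * (cmod (cf f i))\<^sup>2)"
proof -
  assume f: "f \<in> car H"
  have "((\<lambda>i. complex_of_real (wt i * (cmod (cf f i))\<^sup>2)) has_sum of_real (\<Sum>\<^sub>\<infinity>i. wt i * (cmod (cf f i))\<^sup>2)) UNIV"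
    by (intro has_sum_of_real has_sum_infsum cf_summable f)
  moreover have "complex_of_real (wt i * (cmod (cf f i))\<^sup>2) = of_real (wt i) * cf f i * cnj (cf f i)" for i
    by (simp add: mult.assoc flip: complex_norm_square)
  ultimately show ?thesis
    by (intro has_sum_unique[OF has_sum_ip[OF f f]]) (simp only:)
qed

lemma has_sum_hnorm:
  assumes f: "f \<in> car H"
  shows "((\<lambda>i. wt i * (cmod (cf f i))\<^sup>2) has_sum (hnorm H f)\<^sup>2) UNIV"
proof -
  have "0 \<le> (\<Sum>\<^sub>\<infinity>i. wt i * (cmod (cf f i))\<^sup>2)"
    by (rule infsum_nonneg) simp
  then have "(hnorm H f)\<^sup>2 = (\<Sum>\<^sub>\<infinity>i. wt i * (cmod (cf f i))\<^sup>2)"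
    by (simp add: hnorm_def ip_self_real[OF f])
  then show ?thesis
    using cf_summable[OF f] by simp
qed

lemma sum_le_hnorm: "\<lbrakk>f \<in> car H; finite I\<rbrakk> \<Longrightarrow> (\<Sum>i\<in>I. wt i * (cmod (cf f i))\<^sup>2) \<le> (hnorm H f)\<^sup>2"
  by (rule finite_sum_le_has_sum[OF has_sum_hnorm]) auto

lemma cf_le_hnorm: "f \<in> car H \<Longrightarrow> wt i * (cmod (cf f i))\<^sup>2 \<le> (hnorm H f)\<^sup>2"
  using sum_le_hnorm[of f "{i}"] by simp

lemma cf_diff [simp]: "\<lbrakk>f \<in> car H; g \<in> car H\<rbrakk> \<Longrightarrow> cf (f - g) i = cf f i - cf g i"
  by (metis cf_add diff_add_cancel eq_diff_eq fvs.subspace_diff subspace_coeff)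

sublocale hilbert H
proof
  show "fvs.subspace (car H)"
    by (rule subspace_coeff)
next
  fix f g h assume *: "f \<in> car H" "g \<in> car H" "h \<in> car H"
  have "((\<lambda>i. of_real (wt i) * cf f i * cnj (cf h i) + of_real (wt i) * cf g i * cnj (cf h i)) has_sum
      (ip H f h + ip H g h)) UNIV"
    by (intro has_sum_add has_sum_ip *)
  moreover have "f + g \<in> car H"
    using fvs.subspace_add[OF subspace_coeff] * by blast
  ultimately show "ip H (f + g) h = ip H f h + ip H g h"
    using * by (subst ip_eq) (auto intro!: infsumI simp: algebra_simps)
next
  fix f h c assume *: "f \<in> car H" "h \<in> car H"
  have "((\<lambda>i. c * (of_real (wt i) * cf f i * cnj (cf h i))) has_sum (c * ip H f h)) UNIV"
    by (intro has_sum_cmult_right has_sum_ip *)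
  moreover have "(\<lambda>x. c * f x) \<in> car H"
    using fvs.subspace_scale[OF subspace_coeff] * by blast
  ultimately show "ip H (\<lambda>x. c * f x) h = c * ip H f h"
    using * by (subst ip_eq) (auto intro!: infsumI simp: mult_ac)
next
  fix f g assume *: "f \<in> car H" "g \<in> car H"
  show "ip H g f = cnj (ip H f g)"
    using * by (simp add: ip_eq mult_ac flip: infsum_cnj)
next
  fix f assume *: "f \<in> car H"
  show "0 \<le> Re (ip H f f)"
    using * by (simp add: ip_self_real infsum_nonneg)
next
  fix f assume *: "f \<in> car H" "ip H f f = 0"
  have "cf f i = 0" for i
    using cf_le_hnorm[OF *(1), of i] wt_pos[of i] *(2) by (simp add: hnorm_def mult_le_0_iff)
  then show "f = 0"
    using cf_inj * by blast
next
  fix X :: "nat \<Rightarrow> 'x \<Rightarrow> complex"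
  assume X: "\<And>n. X n \<in> car H"
    and Cauchy: "\<And>e. e > 0 \<Longrightarrow> \<exists>N. \<forall>m\<ge>N. \<forall>n\<ge>N. hnorm H (X m - X n) < e"
  have Xd: "X m - X n \<in> car H" for m n
    using fvs.subspace_diff[OF subspace_coeff] X by blast
  have "Cauchy (\<lambda>n. cf (X n) i)" for i
  proof (rule CauchyI)
    fix e :: real assume e: "e > 0"
    have "sqrt (wt i) * e > 0"
      using e wt_pos[of i] by simp
    from Cauchy[OF this] obtain N where N: "\<forall>m\<ge>N. \<forall>n\<ge>N. hnorm H (X m - X n) < sqrt (wt i) * e"
      by blast
    have "cmod (cf (X m) i - cf (X n) i) < e" if "m \<ge> N" "n \<ge> N" for m n
    proof -
      have "0 \<le> hnorm H (X m - X n)"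
        by (simp add: hnorm_def ip_self_real[OF Xd] infsum_nonneg)
      then have "(hnorm H (X m - X n))\<^sup>2 < (sqrt (wt i) * e)\<^sup>2"
        using N that by (intro power_strict_mono) auto
      then have "(hnorm H (X m - X n))\<^sup>2 < wt i * e\<^sup>2"
        using wt_pos[of i] by (simp add: power_mult_distrib)
      with cf_le_hnorm[OF Xd[of m n], of i] have "wt i * (cmod (cf (X m - X n) i))\<^sup>2 < wt i * e\<^sup>2"
        by linarith
      then have "(cmod (cf (X m - X n) i))\<^sup>2 < e\<^sup>2"
        using wt_pos[of i] by simp
      then show ?thesis
        using e X by (simp add: power2_less_imp_less)
    qed
    then show "\<exists>N. \<forall>m\<ge>N. \<forall>n\<ge>N. cmod (cf (X m) i - cf (X n) i) < e"
      by blast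
  qed
  then obtain a where a: "\<And>i. (\<lambda>n. cf (X n) i) \<longlonglongrightarrow> a i"
    unfolding Cauchy_convergent_iff convergent_def by metis
  \<comment> \<open>The coefficientwise limit is compared with \<open>X m\<close> on finite index
    sets, where passing to the limit in \<open>n\<close> is harmless; bounds uniform in the set give
    summability and the estimate together.\<close>
  have lim: "(\<lambda>i. wt i * (cmod (cf (X m) i - a i))\<^sup>2) summable_on UNIV \<and>
      (\<Sum>\<^sub>\<infinity>i. wt i * (cmod (cf (X m) i - a i))\<^sup>2) \<le> e\<^sup>2"
    if N: "\<And>n. n \<ge> N \<Longrightarrow> hnorm H (X m - X n) < e" for m N e
  proof -
    have fin: "(\<Sum>i\<in>I. wt i * (cmod (cf (X m) i - a i))\<^sup>2) \<le> e\<^sup>2" if I: "finite I" for I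
    proof (rule LIMSEQ_le_const2)
      show "(\<lambda>n. \<Sum>i\<in>I. wt i * (cmod (cf (X m) i - cf (X n) i))\<^sup>2) \<longlonglongrightarrow> (\<Sum>i\<in>I. wt i * (cmod (cf (X m) i - a i))\<^sup>2)"
        by (intro tendsto_intros a)
      have "(\<Sum>i\<in>I. wt i * (cmod (cf (X m) i - cf (X n) i))\<^sup>2) \<le> e\<^sup>2" if "n \<ge> N" for n
      proof -
        have "(\<Sum>i\<in>I. wt i * (cmod (cf (X m - X n) i))\<^sup>2) \<le> (hnorm H (X m - X n))\<^sup>2"
          by (rule sum_le_hnorm[OF Xd I])
        also have "\<dots> \<le> e\<^sup>2"
          using N[OF that] by (intro power_mono) (auto simp: hnorm_def ip_self_real[OF Xd] infsum_nonneg)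
        finally show ?thesis
          using X by simp
      qed
      then show "\<exists>N. \<forall>n\<ge>N. (\<Sum>i\<in>I. wt i * (cmod (cf (X m) i - cf (X n) i))\<^sup>2) \<le> e\<^sup>2"
        by blast
    qed
    have sm: "(\<lambda>i. wt i * (cmod (cf (X m) i - a i))\<^sup>2) summable_on UNIV"
      by (rule nonneg_bdd_above_summable_on) (auto intro!: bdd_aboveI2[where M = "e\<^sup>2"] fin)
    moreover have "(\<Sum>\<^sub>\<infinity>i. wt i * (cmod (cf (X m) i - a i))\<^sup>2) \<le> e\<^sup>2"
      by (rule infsum_le_finite_sums[OF sm]) (use fin in auto)
    ultimately show ?thesis by blast
  qed
  obtain N0 where "\<forall>m\<ge>N0. \<forall>n\<ge>N0. hnorm H (X m - X n) < 1"
    using Cauchy[of 1] by auto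
  then have "(\<lambda>i. wt i * (cmod (cf (X N0) i - a i))\<^sup>2) summable_on UNIV"
    using lim[of N0 N0 1] by blast
  \<comment> \<open>Square-summability is known for the difference between \<open>X N0\<close> and
    the limit, not yet for the limit itself, so the difference is realized as a vector
    first.\<close>
  from cf_surj[OF this] obtain d where d: "d \<in> car H" "cf d = (\<lambda>i. cf (X N0) i - a i)"
    by blast
  define l where "l = X N0 - d"
  have l: "l \<in> car H"
    using fvs.subspace_diff[OF subspace_coeff] X d by (simp add: l_def)
  have cfl: "cf l i = a i" for i
    using X d by (simp add: l_def)
  have Xl: "X m - l \<in> car H" for m
    using fvs.subspace_diff[OF subspace_coeff] X l by blast
  have "(\<lambda>n. hnorm H (X n - l)) \<longlonglongrightarrow> 0"
  proof (rule LIMSEQ_I)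
    fix r :: real assume r: "r > 0"
    then obtain N where N: "\<forall>m\<ge>N. \<forall>n\<ge>N. hnorm H (X m - X n) < r / 2"
      using Cauchy[of "r / 2"] by auto
    have "norm (hnorm H (X m - l) - 0) < r" if "m \<ge> N" for m
    proof -
      have "(hnorm H (X m - l))\<^sup>2 = (\<Sum>\<^sub>\<infinity>i. wt i * (cmod (cf (X m) i - a i))\<^sup>2)"
        using infsumI[OF has_sum_hnorm[OF Xl]] X l cfl by simp
      also have "\<dots> \<le> (r / 2)\<^sup>2"
        using lim[of N m "r / 2"] N that by blast
      finally have "hnorm H (X m - l) \<le> r / 2"
        by (rule power2_le_imp_le) (use r in simp)
      moreover have "0 \<le> hnorm H (X m - l)"
        by (simp add: hnorm_def ip_self_real[OF Xl] infsum_nonneg)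
      ultimately show ?thesis
        using r by simp
    qed
    then show "\<exists>N. \<forall>n\<ge>N. norm (hnorm H (X n - l) - 0) < r"
      by blast
  qed
  then show "\<exists>l\<in>car H. (\<lambda>n. hnorm H (X n - l)) \<longlonglongrightarrow> 0"
    using l by blast
qed

text \<open>A vector whose coefficients vanish on \<open>I\<close> pairs with \<open>h\<close> as it
  does with the tail of \<open>h\<close> outside \<open>I\<close>, and that tail has small
  norm.\<close>

lemma tail_estimate:
  assumes h: "h \<in> car H" and e: "e > 0"
  obtains I where "finite I"
    "\<And>g. \<lbrakk>g \<in> car H; \<And>i. i \<in> I \<Longrightarrow> cf g i = 0\<rbrakk> \<Longrightarrow> cmod (ip H g h) \<le> e * hnorm H g"
proof -
  note hs = has_sum_hnorm[OF h]
  obtain I where I: "finite I" "dist (\<Sum>i\<in>I. wt i * (cmod (cf h i))\<^sup>2) ((hnorm H h)\<^sup>2) \<le> e\<^sup>2"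
    using has_sum_finite_approximation[OF hs, of "e\<^sup>2"] e by auto
  have tail: "((\<lambda>i. wt i * (cmod (cf h i))\<^sup>2) has_sum ((hnorm H h)\<^sup>2 - (\<Sum>i\<in>I. wt i * (cmod (cf h i))\<^sup>2))) (UNIV - I)"
    using I(1) by (intro has_sum_Diff[OF hs] has_sum_finite) auto
  have tail': "((\<lambda>i. wt i * (cmod (if i \<in> I then 0 else cf h i))\<^sup>2) has_sum
      ((hnorm H h)\<^sup>2 - (\<Sum>i\<in>I. wt i * (cmod (cf h i))\<^sup>2))) UNIV"
    by (rule has_sum_cong_neutral[THEN iffD1, OF _ _ _ tail]) auto
  from cf_surj[OF has_sum_imp_summable[OF this]]
  obtain h' where h': "h' \<in> car H" "cf h' = (\<lambda>i. if i \<in> I then 0 else cf h i)"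
    by blast
  have "(hnorm H h')\<^sup>2 = (hnorm H h)\<^sup>2 - (\<Sum>i\<in>I. wt i * (cmod (cf h i))\<^sup>2)"
    using has_sum_hnorm[OF h'(1)] tail' has_sum_unique unfolding h'(2) by blast
  also have "\<dots> \<le> e\<^sup>2"
    using I(2) by (simp add: dist_real_def)
  finally have h'e: "hnorm H h' \<le> e"
    by (rule power2_le_imp_le) (use e in simp)
  show thesis
  proof (rule that[OF I(1)])
    fix g assume g: "g \<in> car H" "\<And>i. i \<in> I \<Longrightarrow> cf g i = 0"
    have "ip H g h = ip H g h'"
      unfolding ip_eq[OF g(1) h] ip_eq[OF g(1) h'(1)] using g(2) by (intro infsum_cong) (auto simp: h'(2))
    then have "cmod (ip H g h) \<le> hnorm H g * hnorm H h'"
      using Cauchy_Schwarz g(1) h'(1) by simp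
    also have "\<dots> \<le> hnorm H g * e"
      using h'e g(1) by (intro mult_left_mono) auto
    finally show "cmod (ip H g h) \<le> e * hnorm H g"
      by (simp add: mult.commute)
  qed
qed

end

section \<open>Weighted shifts\<close>

lemma has_sum_reindex_range:
  assumes "inj s" "\<And>j. j \<notin> range s \<Longrightarrow> \<phi> j = 0"
  shows "(\<phi> has_sum x) UNIV \<longleftrightarrow> ((\<lambda>i. \<phi> (s i)) has_sum x) UNIV"
proof -
  have "(\<phi> has_sum x) UNIV \<longleftrightarrow> (\<phi> has_sum x) (range s)"
    by (rule has_sum_cong_neutral) (use assms(2) in auto)
  also have "\<dots> \<longleftrightarrow> ((\<lambda>i. \<phi> (s i)) has_sum x) UNIV"
    using has_sum_reindex[OF assms(1), of \<phi> x] by (simp add: o_def)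
  finally show ?thesis .
qed

text \<open>Covers \<open>M\<^sub>z\<close>, with \<open>s = Suc\<close>, and multiplication by a
  coordinate, with \<open>s\<close> raising one exponent. The factor 2 is the ratio of the first two
  Dirichlet weights, the largest that occurs; the Bergman weights give the opposite extreme
  1/2.\<close>

locale weighted_shift = weighted_l2 H wt cf
  for H :: "'x hspace" and wt :: "'i \<Rightarrow> real" and cf +
  fixes s :: "'i \<Rightarrow> 'i" and T :: "('x \<Rightarrow> complex) \<Rightarrow> 'x \<Rightarrow> complex"
  assumes inj_s: "inj s"
    and wt_upper: "wt (s i) \<le> 2 * wt i"
    and T_car [simp]: "f \<in> car H \<Longrightarrow> T f \<in> car H"
    and cf_T [simp]: "f \<in> car H \<Longrightarrow> cf (T f) (s i) = cf f i"
    and cf_T_0: "\<lbrakk>f \<in> car H; j \<notin> range s\<rbrakk> \<Longrightarrow> cf (T f) j = 0"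
begin

lemma has_sum_ip_T:
  assumes "f \<in> car H" "g \<in> car H"
  shows "((\<lambda>i. of_real (wt (s i)) * cf f i * cnj (cf g (s i))) has_sum ip H (T f) g) UNIV"
  using has_sum_reindex_range[OF inj_s, of "\<lambda>i. of_real (wt i) * cf (T f) i * cnj (cf g i)"]
    has_sum_ip[of "T f" g] assms by (simp add: cf_T_0)

lemma has_sum_hnorm_T:
  assumes "f \<in> car H"
  shows "((\<lambda>i. wt (s i) * (cmod (cf f i))\<^sup>2) has_sum (hnorm H (T f))\<^sup>2) UNIV"
  using has_sum_reindex_range[OF inj_s, of "\<lambda>i. wt i * (cmod (cf (T f) i))\<^sup>2"]
    has_sum_hnorm[of "T f"] assms by (simp add: cf_T_0)

lemma has_sum_hnorm_TT:
  assumes "f \<in> car H"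
  shows "((\<lambda>i. wt (s (s i)) * (cmod (cf f i))\<^sup>2) has_sum (hnorm H (T (T f)))\<^sup>2) UNIV"
  using has_sum_reindex_range[OF inj_s, of "\<lambda>i. wt (s i) * (cmod (cf (T f) i))\<^sup>2"]
    has_sum_hnorm_T[of "T f"] assms by (simp add: cf_T_0)

lemma hnorm_T_le: "f \<in> car H \<Longrightarrow> hnorm H (T f) \<le> sqrt 2 * hnorm H f"
proof -
  assume f: "f \<in> car H"
  have "(hnorm H (T f))\<^sup>2 \<le> 2 * (hnorm H f)\<^sup>2"
    by (rule has_sum_mono[OF has_sum_hnorm_T[OF f] has_sum_cmult_right[OF has_sum_hnorm[OF f]]])
       (simp add: wt_upper mult_right_mono flip: mult.assoc)
  also have "\<dots> = (sqrt 2 * hnorm H f)\<^sup>2"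
    by (simp add: power_mult_distrib)
  finally show ?thesis
    by (rule power2_le_imp_le) (use f in simp)
qed

text \<open>The adjoint as an explicit weighted backward shift. The coefficient formula is what
  later shows that on an elementary tensor the adjoint of \<open>Mcoord k\<close> changes only slot
  \<open>k\<close>.\<close>

lemma adjoint_exists:
  assumes g: "g \<in> car H"
  obtains g' where "g' \<in> car H" "\<And>i. cf g' i = of_real (wt (s i) / wt i) * cf g (s i)"
proof -
  have "(\<lambda>i. wt i * (cmod (of_real (wt (s i) / wt i) * cf g (s i)))\<^sup>2) summable_on UNIV"
  proof (rule summable_on_comparison_test)
    have "(\<lambda>j. wt j * (cmod (cf g j))\<^sup>2) summable_on (range s)"
      by (rule summable_on_subset_banach[OF cf_summable[OF g]]) auto
    then have "(\<lambda>i. wt (s i) * (cmod (cf g (s i)))\<^sup>2) summable_on UNIV"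
      using summable_on_reindex[OF inj_s, of "\<lambda>j. wt j * (cmod (cf g j))\<^sup>2"] by (simp add: o_def)
    then show "(\<lambda>i. 2 * (wt (s i) * (cmod (cf g (s i)))\<^sup>2)) summable_on UNIV"
      by (rule summable_on_cmult_right)
    fix i
    have "wt i * (cmod (of_real (wt (s i) / wt i) * cf g (s i)))\<^sup>2
        = wt (s i) / wt i * (wt (s i) * (cmod (cf g (s i)))\<^sup>2)"
      using wt_pos[of i] wt_pos[of "s i"]
      by (simp add: norm_mult norm_divide power_mult_distrib power_divide power2_eq_square)
    also have "\<dots> \<le> 2 * (wt (s i) * (cmod (cf g (s i)))\<^sup>2)"
      using wt_upper[of i] wt_pos[of i] by (intro mult_right_mono) (auto simp: divide_le_eq)
    finally show "wt i * (cmod (of_real (wt (s i) / wt i) * cf g (s i)))\<^sup>2 \<le> 2 * (wt (s i) * (cmod (cf g (s i)))\<^sup>2)" .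
  qed simp
  from cf_surj[OF this] obtain g' where "g' \<in> car H" "cf g' = (\<lambda>i. of_real (wt (s i) / wt i) * cf g (s i))"
    by blast
  then show thesis
    using that by simp
qed

lemma ip_adjoint:
  assumes "f \<in> car H" "g \<in> car H" "g' \<in> car H"
    and g': "\<And>i. cf g' i = of_real (wt (s i) / wt i) * cf g (s i)"
  shows "ip H (T f) g = ip H f g'"
proof (rule has_sum_unique[OF has_sum_ip_T[OF assms(1,2)]])
  have "of_real (wt i) * cf f i * cnj (cf g' i) = of_real (wt (s i)) * cf f i * cnj (cf g (s i))" for i
    using wt_pos[of i] by (simp add: g')
  then show "((\<lambda>i. of_real (wt (s i)) * cf f i * cnj (cf g (s i))) has_sum ip H f g') UNIV"
    using has_sum_ip[OF assms(1,3)] by (simp only:)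
qed

end

section \<open>The spaces on the disc\<close>

lemma taylor_coeff_unique:
  assumes f: "f holomorphic_on ball 0 1" and a: "\<And>z. z \<in> ball 0 1 \<Longrightarrow> (\<lambda>m. a m * z ^ m) sums f z"
  shows "taylor_coeff f = a"
proof
  fix m
  have "(\<lambda>m. (taylor_coeff f m - a m) * z ^ m) sums 0" if "norm z < 1" for z
  proof -
    have z: "z \<in> ball 0 1"
      using that by simp
    show ?thesis
      using sums_diff[OF has_sum_imp_sums[OF taylor_abs_summable(2)[OF f z]] a[OF z]]
      by (simp add: left_diff_distrib)
  qed
  then show "taylor_coeff f m = a m"
    using powser_zero_imp_coeff_zero[of "\<lambda>m. taylor_coeff f m - a m" m] by simp
qed

lemma taylor_sums: "\<lbrakk>f holomorphic_on ball 0 1; z \<in> ball 0 1\<rbrakk> \<Longrightarrow> (\<lambda>m. taylor_coeff f m * z ^ m) sums f z"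
  by (intro has_sum_imp_sums taylor_abs_summable)

lemma disc_spaceD:
  assumes "f \<in> car (disc_space \<kappa>)"
  shows "f holomorphic_on ball 0 1" "z \<notin> ball 0 1 \<Longrightarrow> f z = 0"
    "(\<lambda>m. weight \<kappa> m * (cmod (taylor_coeff f m))\<^sup>2) summable_on UNIV"
  using assms by (auto simp: disc_space_def)

lemma weight_ge: "1 / (real m + 1) \<le> weight \<kappa> m"
  by (cases \<kappa>) (auto simp: field_simps)

lemma weight_Suc_le: "weight \<kappa> (Suc m) \<le> 2 * weight \<kappa> m"
  by (cases \<kappa>) (auto simp: field_simps)

lemma weight_Suc_ge: "weight \<kappa> m \<le> 2 * weight \<kappa> (Suc m)"
  by (cases \<kappa>) (auto simp: field_simps)

lemma taylor_coeff_add: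
  assumes "f holomorphic_on ball 0 1" "g holomorphic_on ball 0 1"
  shows "taylor_coeff (f + g) = (\<lambda>m. taylor_coeff f m + taylor_coeff g m)"
proof (rule taylor_coeff_unique)
  show "f + g holomorphic_on ball 0 1"
    using assms by (simp add: plus_fun_def holomorphic_on_add)
  show "(\<lambda>m. (taylor_coeff f m + taylor_coeff g m) * z ^ m) sums (f + g) z" if "z \<in> ball 0 1" for z
    using sums_add[OF taylor_sums[OF assms(1) that] taylor_sums[OF assms(2) that]] by (simp add: distrib_right)
qed

lemma taylor_coeff_scale:
  assumes "f holomorphic_on ball 0 1"
  shows "taylor_coeff (\<lambda>z. c * f z) = (\<lambda>m. c * taylor_coeff f m)"
proof (rule taylor_coeff_unique)
  show "(\<lambda>z. c * f z) holomorphic_on ball 0 1"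
    using assms by (intro holomorphic_intros)
  show "(\<lambda>m. c * taylor_coeff f m * z ^ m) sums (c * f z)" if "z \<in> ball 0 1" for z
    using sums_mult[OF taylor_sums[OF assms that], of c] by (simp add: mult.assoc)
qed

lemma taylor_coeff_M\<^sub>z:
  assumes "f holomorphic_on ball 0 1"
  shows "taylor_coeff (M\<^sub>z f) = (\<lambda>m. case m of 0 \<Rightarrow> 0 | Suc k \<Rightarrow> taylor_coeff f k)"
proof (rule taylor_coeff_unique)
  show "M\<^sub>z f holomorphic_on ball 0 1"
    unfolding M\<^sub>z_def using assms by (intro holomorphic_intros)
  fix z :: complex assume "z \<in> ball 0 1"
  then have "(\<lambda>m. z * (taylor_coeff f m * z ^ m)) sums (z * f z)"
    by (intro sums_mult taylor_sums assms)
  then have "(\<lambda>m. (case Suc m of 0 \<Rightarrow> 0 | Suc k \<Rightarrow> taylor_coeff f k) * z ^ Suc m) sums (M\<^sub>z f z)"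
    by (simp add: M\<^sub>z_def mult_ac)
  then show "(\<lambda>m. (case m of 0 \<Rightarrow> 0 | Suc k \<Rightarrow> taylor_coeff f k) * z ^ m) sums M\<^sub>z f z"
    by (subst (asm) sums_Suc_iff) simp
qed

text \<open>Polynomial growth of coefficients, enough for convergence in the open disc:
  \<open>p\<close> will be \<open>m + 1\<close>, or the product of such factors in several
  variables. The bound by \<open>p\<close> instead of its square root keeps the majorant series
  elementary.\<close>

lemma sqrt_bound_of_weighted:
  fixes w p S x :: real
  assumes "w * x\<^sup>2 \<le> S" "1 / p \<le> w" "1 \<le> p" "0 \<le> x"
  shows "x \<le> sqrt S * p"
proof -
  have "x\<^sup>2 / p \<le> S"
    using mult_right_mono[OF assms(2), of "x\<^sup>2"] assms(1) by simp
  then have "x\<^sup>2 \<le> S * p"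
    using assms(3) by (simp add: field_simps)
  moreover have "S \<ge> 0"
    using \<open>x\<^sup>2 / p \<le> S\<close> assms(3) by (smt (verit) divide_nonneg_nonneg zero_le_power2)
  then have "S * p \<le> S * p\<^sup>2"
    using assms(3) by (intro mult_left_mono) (auto simp: power2_eq_square)
  ultimately have "x\<^sup>2 \<le> (sqrt S * p)\<^sup>2"
    using \<open>S \<ge> 0\<close> by (simp add: power_mult_distrib)
  then show ?thesis
    by (rule power2_le_imp_le) (use \<open>S \<ge> 0\<close> assms(3) in simp)
qed

lemma summable_Suc_power: "0 \<le> r \<Longrightarrow> r < 1 \<Longrightarrow> summable (\<lambda>m. (real m + 1) * r ^ m)" for r :: real
  using geometric_deriv_sums[of r] by (auto simp: sums_iff add.commute)

lemma disc_space_surj: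
  assumes a: "(\<lambda>m. weight \<kappa> m * (cmod (a m))\<^sup>2) summable_on UNIV"
  shows "\<exists>f\<in>car (disc_space \<kappa>). taylor_coeff f = a"
proof -
  define S where "S = (\<Sum>\<^sub>\<infinity>m. weight \<kappa> m * (cmod (a m))\<^sup>2)"
  have le: "weight \<kappa> m * (cmod (a m))\<^sup>2 \<le> S" for m
    using finite_sum_le_infsum[OF a, of "{m}"] weight_pos[of \<kappa>] by (simp add: S_def less_imp_le)
  have bound: "cmod (a m) \<le> sqrt S * (real m + 1)" for m
    by (rule sqrt_bound_of_weighted[OF le weight_ge]) auto
  define f where "f z = (if z \<in> ball 0 1 then \<Sum>m. a m * z ^ m else 0)" for z
  have sums: "(\<lambda>m. a m * z ^ m) sums f z" if "z \<in> ball 0 1" for z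
  proof -
    have "summable (\<lambda>m. sqrt S * ((real m + 1) * cmod z ^ m))"
      using that by (intro summable_mult summable_Suc_power) auto
    then have "summable (\<lambda>m. a m * z ^ m)"
    proof (rule summable_comparison_test')
      show "norm (a m * z ^ m) \<le> sqrt S * ((real m + 1) * cmod z ^ m)" for m
        using mult_right_mono[OF bound[of m], of "cmod z ^ m"] by (simp add: norm_mult norm_power mult.assoc)
    qed
    then show ?thesis
      using that by (simp add: f_def summable_sums)
  qed
  have hol: "f holomorphic_on ball 0 1"
    using power_series_holomorphic[of 0 1 a f] sums by simp
  have tc: "taylor_coeff f = a"
    by (rule taylor_coeff_unique[OF hol sums])
  have "f \<in> car (disc_space \<kappa>)"
    using hol a by (simp add: disc_space_def tc) (simp add: f_def)
  then show ?thesis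
    using tc by blast
qed

interpretation disc: weighted_shift "disc_space \<kappa>" "weight \<kappa>" taylor_coeff Suc M\<^sub>z for \<kappa>
proof
  show "fvs.subspace (car (disc_space \<kappa>))"
    unfolding fvs.subspace_def
  proof (intro conjI ballI allI)
    have "taylor_coeff (0 :: complex \<Rightarrow> complex) = (\<lambda>_. 0)"
      by (rule taylor_coeff_unique) (auto simp: zero_fun_def)
    then show "0 \<in> car (disc_space \<kappa>)"
      by (simp add: disc_space_def) (simp add: zero_fun_def)
  next
    fix f g assume fg: "f \<in> car (disc_space \<kappa>)" "g \<in> car (disc_space \<kappa>)"
    have "(\<lambda>m. weight \<kappa> m * (cmod (taylor_coeff f m + taylor_coeff g m))\<^sup>2) summable_on UNIV"
    proof (rule summable_on_comparison_test)
      show "(\<lambda>m. 2 * (weight \<kappa> m * (cmod (taylor_coeff f m))\<^sup>2 + weight \<kappa> m * (cmod (taylor_coeff g m))\<^sup>2)) summable_on UNIV"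
        by (intro summable_on_cmult_right summable_on_add disc_spaceD fg)
      fix m
      define x y where "x = cmod (taylor_coeff f m)" and "y = cmod (taylor_coeff g m)"
      have "(cmod (taylor_coeff f m + taylor_coeff g m))\<^sup>2 \<le> (x + y)\<^sup>2"
        unfolding x_def y_def by (intro power_mono norm_triangle_ineq) auto
      also have "\<dots> \<le> 2 * (x\<^sup>2 + y\<^sup>2)"
        using sum_squares_bound[of x y] by (simp add: power2_sum)
      finally have "weight \<kappa> m * (cmod (taylor_coeff f m + taylor_coeff g m))\<^sup>2 \<le> weight \<kappa> m * (2 * (x\<^sup>2 + y\<^sup>2))"
        using weight_pos[of \<kappa> m] by (intro mult_left_mono) auto
      then show "weight \<kappa> m * (cmod (taylor_coeff f m + taylor_coeff g m))\<^sup>2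
          \<le> 2 * (weight \<kappa> m * (cmod (taylor_coeff f m))\<^sup>2 + weight \<kappa> m * (cmod (taylor_coeff g m))\<^sup>2)"
        by (simp add: x_def y_def algebra_simps)
    qed (use weight_pos in \<open>simp add: less_imp_le\<close>)
    then show "f + g \<in> car (disc_space \<kappa>)"
      using fg disc_spaceD[OF fg(1)] disc_spaceD[OF fg(2)]
      by (simp add: disc_space_def taylor_coeff_add) (simp add: plus_fun_def holomorphic_on_add)
  next
    fix c f assume f: "f \<in> car (disc_space \<kappa>)"
    have "(\<lambda>m. (cmod c)\<^sup>2 * (weight \<kappa> m * (cmod (taylor_coeff f m))\<^sup>2)) summable_on UNIV"
      by (intro summable_on_cmult_right disc_spaceD f)
    then show "(\<lambda>z. c * f z) \<in> car (disc_space \<kappa>)"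
      using disc_spaceD[OF f]
      by (simp add: disc_space_def taylor_coeff_scale norm_mult power_mult_distrib mult_ac holomorphic_intros)
  qed
next
  fix f :: "complex \<Rightarrow> complex" assume f: "f \<in> car (disc_space \<kappa>)" "\<And>i. taylor_coeff f i = 0"
  have "f z = 0" for z
  proof (cases "z \<in> ball 0 1")
    case True
    then show ?thesis
      using taylor_sums[OF disc_spaceD(1)[OF f(1)] True] f(2) by (simp add: sums_iff)
  qed (use disc_spaceD(2)[OF f(1)] in simp)
  then show "f = 0"
    by (simp add: fun_eq_iff)
next
  fix f assume f: "f \<in> car (disc_space \<kappa>)"
  note f' = disc_spaceD[OF f]
  show "taylor_coeff (M\<^sub>z f) (Suc i) = taylor_coeff f i" for i
    by (simp add: taylor_coeff_M\<^sub>z[OF f'(1)])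
  show "taylor_coeff (M\<^sub>z f) j = 0" if "j \<notin> range Suc" for j
    using that by (cases j) (auto simp: taylor_coeff_M\<^sub>z[OF f'(1)])
  have "(\<lambda>m. weight \<kappa> (Suc m) * (cmod (taylor_coeff f m))\<^sup>2) summable_on UNIV"
  proof (rule summable_on_comparison_test)
    show "(\<lambda>m. 2 * (weight \<kappa> m * (cmod (taylor_coeff f m))\<^sup>2)) summable_on UNIV"
      by (intro summable_on_cmult_right f')
    show "weight \<kappa> (Suc m) * (cmod (taylor_coeff f m))\<^sup>2 \<le> 2 * (weight \<kappa> m * (cmod (taylor_coeff f m))\<^sup>2)" for m
      using weight_Suc_le[of \<kappa> m] by (simp add: mult_right_mono flip: mult.assoc)
  qed (use weight_pos in \<open>simp add: less_imp_le\<close>)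
  then have "(\<lambda>m. weight \<kappa> m * (cmod (taylor_coeff (M\<^sub>z f) m))\<^sup>2) summable_on UNIV"
    unfolding summable_on_def
    by (subst has_sum_reindex_range[of Suc])
       (auto simp: taylor_coeff_M\<^sub>z[OF f'(1)] split: nat.split)
  then show "M\<^sub>z f \<in> car (disc_space \<kappa>)"
    using f' by (simp add: disc_space_def) (simp add: M\<^sub>z_def holomorphic_intros)
qed (auto simp: weight_pos disc_spaceD taylor_coeff_add taylor_coeff_scale disc_space_surj weight_Suc_le
  simp del: weight.simps, simp_all add: disc_space_def)

section \<open>Monomials and kernel functions\<close>

lemma ip_disc_monom:
  assumes "h \<in> car (disc_space \<kappa>)"
  shows "ip (disc_space \<kappa>) (disc_monom m) h = of_real (weight \<kappa> m) * cnj (taylor_coeff h m)"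
proof -
  have "((\<lambda>j. of_real (weight \<kappa> j) * taylor_coeff (disc_monom m) j * cnj (taylor_coeff h j)) has_sum
      (of_real (weight \<kappa> m) * cnj (taylor_coeff h m))) UNIV"
    by (rule has_sum_finite_neutralI[of "{m}"]) (auto simp: taylor_coeff_disc_monom)
  then show ?thesis
    using disc.has_sum_ip[OF disc_monom_in_disc_space assms] has_sum_unique by blast
qed

lemma hclosure_disc_monoms:
  "hclosure (disc_space \<kappa>) (fvs.span (range disc_monom)) = car (disc_space \<kappa>)"
proof (rule disc.hclosure_span_eq_car)
  fix h assume h: "h \<in> car (disc_space \<kappa>)" and *: "\<And>x. x \<in> range disc_monom \<Longrightarrow> ip (disc_space \<kappa>) x h = 0"
  have "taylor_coeff h m = 0" for m
    using *[of "disc_monom m"] ip_disc_monom[OF h, of m] weight_pos[of \<kappa> m] by simp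
  then show "h = 0"
    using disc.cf_inj[OF h] by blast
qed (auto simp: disc_monom_in_disc_space)

text \<open>The kernel has coefficients \<open>cnj l ^ m / weight \<kappa> m\<close>; as the weights
  are at least \<open>1 / (m + 1)\<close>, the derivative of the geometric series in
  \<open>(cmod l)\<^sup>2\<close> shows that it belongs to the space.\<close>

lemma reproducing_kernel:
  assumes l: "l \<in> ball 0 1"
  obtains k where "k \<in> car (disc_space \<kappa>)" "\<And>f. f \<in> car (disc_space \<kappa>) \<Longrightarrow> ip (disc_space \<kappa>) f k = f l"
proof -
  define a where "a m = cnj l ^ m / of_real (weight \<kappa> m)" for m
  have "(\<lambda>m. weight \<kappa> m * (cmod (a m))\<^sup>2) summable_on UNIV"
  proof (rule summable_on_comparison_test)
    have "summable (\<lambda>m. (real m + 1) * ((cmod l)\<^sup>2) ^ m)"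
      using l by (intro summable_Suc_power) (auto simp: power_less_one_iff)
    then show "(\<lambda>m. (real m + 1) * ((cmod l)\<^sup>2) ^ m) summable_on UNIV"
      by (intro summable_nonneg_imp_summable_on) auto
    fix m
    have "weight \<kappa> m * (cmod (a m))\<^sup>2 = (1 / weight \<kappa> m) * ((cmod l)\<^sup>2) ^ m"
      using weight_pos[of \<kappa> m]
      by (simp add: a_def norm_divide norm_power power_divide power2_eq_square power_mult_distrib)
    also have "\<dots> \<le> (real m + 1) * ((cmod l)\<^sup>2) ^ m"
      using weight_ge[of m \<kappa>] weight_pos[of \<kappa> m] by (intro mult_right_mono) (auto simp: field_simps)
    finally show "weight \<kappa> m * (cmod (a m))\<^sup>2 \<le> (real m + 1) * ((cmod l)\<^sup>2) ^ m" .
  qed simp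
  from disc_space_surj[OF this] obtain k where k: "k \<in> car (disc_space \<kappa>)" "taylor_coeff k = a"
    by blast
  show thesis
  proof (rule that[OF k(1)])
    fix f assume f: "f \<in> car (disc_space \<kappa>)"
    have "of_real (weight \<kappa> m) * taylor_coeff f m * cnj (taylor_coeff k m) = taylor_coeff f m * l ^ m" for m
      using weight_pos[of \<kappa> m] by (simp add: k(2) a_def)
    then have "((\<lambda>m. taylor_coeff f m * l ^ m) has_sum ip (disc_space \<kappa>) f k) UNIV"
      using disc.has_sum_ip[OF f k(1)] by (simp only:)
    then show "ip (disc_space \<kappa>) f k = f l"
      using taylor_abs_summable(2)[OF disc_spaceD(1)[OF f] l] has_sum_unique by blast
  qed
qed

section \<open>Multiplication by z: bounds, concavity and the Shimorin inequality\<close>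

lemma M\<^sub>z_linear:
  "M\<^sub>z (f + g) = M\<^sub>z f + M\<^sub>z g" "M\<^sub>z (\<lambda>z. c * f z) = (\<lambda>z. c * M\<^sub>z f z)"
  by (auto simp: M\<^sub>z_def fun_eq_iff algebra_simps)

lemma M\<^sub>z_funpow: "(M\<^sub>z ^^ n) f = (\<lambda>z. z ^ n * f z)"
  by (induction n) (auto simp: M\<^sub>z_def fun_eq_iff)

lemma M\<^sub>z_funpow_car: "f \<in> car (disc_space \<kappa>) \<Longrightarrow> (M\<^sub>z ^^ n) f \<in> car (disc_space \<kappa>)"
  by (induction n) auto

lemma taylor_coeff_funpow_0: "\<lbrakk>f \<in> car (disc_space \<kappa>); i < n\<rbrakk> \<Longrightarrow> taylor_coeff ((M\<^sub>z ^^ n) f) i = 0"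
proof (induction n arbitrary: i)
  case (Suc n)
  note hol = disc_spaceD(1)[OF M\<^sub>z_funpow_car[OF Suc.prems(1)]]
  show ?case
    using Suc.IH[OF Suc.prems(1), of "i - 1"] Suc.prems(2)
    by (cases i) (simp_all add: taylor_coeff_M\<^sub>z[OF hol])
qed simp

lemma hnorm_M\<^sub>z_lower:
  assumes f: "f \<in> car (disc_space \<kappa>)"
  shows "1 / sqrt 2 * hnorm (disc_space \<kappa>) f \<le> hnorm (disc_space \<kappa>) (M\<^sub>z f)"
proof (rule power2_le_imp_le)
  have "(hnorm (disc_space \<kappa>) f)\<^sup>2 \<le> 2 * (hnorm (disc_space \<kappa>) (M\<^sub>z f))\<^sup>2"
    by (rule has_sum_mono[OF disc.has_sum_hnorm[OF f] has_sum_cmult_right[OF disc.has_sum_hnorm_T[OF f]]])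
       (use weight_Suc_ge[of \<kappa>] in \<open>simp add: mult_right_mono flip: mult.assoc\<close>)
  then show "(1 / sqrt 2 * hnorm (disc_space \<kappa>) f)\<^sup>2 \<le> (hnorm (disc_space \<kappa>) (M\<^sub>z f))\<^sup>2"
    by (simp add: power_mult_distrib power_divide)
qed (use f in simp)

lemma shift_operator_restr:
  assumes S: "closed_subspace (disc_space \<kappa>) S" and inv: "M\<^sub>z ` S \<subseteq> S"
  shows "shift_operator (restr (disc_space \<kappa>) S) M\<^sub>z (1 / sqrt 2) (sqrt 2)"
proof -
  have sub: "S \<subseteq> car (disc_space \<kappa>)"
    using S by (simp add: closed_subspace_def)
  interpret hilbert "restr (disc_space \<kappa>) S"
    by (rule disc.hilbert_restr[OF S])
  show ?thesis
  proof
    fix h and e :: real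
    assume "h \<in> car (restr (disc_space \<kappa>) S)" and e: "e > 0"
    then have h: "h \<in> car (disc_space \<kappa>)"
      using sub by auto
    obtain I where I: "finite I" "\<And>g. \<lbrakk>g \<in> car (disc_space \<kappa>); \<And>i. i \<in> I \<Longrightarrow> taylor_coeff g i = 0\<rbrakk>
        \<Longrightarrow> cmod (ip (disc_space \<kappa>) g h) \<le> e * hnorm (disc_space \<kappa>) g"
      by (rule disc.tail_estimate[OF h e]) blast
    \<comment> \<open>Multiplication by \<open>z ^ n\<close> clears all coefficients below
      \<open>n\<close>, so \<open>N\<close> only has to exceed the finite exceptional set of
      \<open>h\<close>.\<close>
    obtain N where N: "\<forall>i\<in>I. i < N"
      using I(1) finite_nat_set_iff_bounded by blast
    have "cmod (ip (disc_space \<kappa>) ((M\<^sub>z ^^ n) g) h) \<le> e * hnorm (disc_space \<kappa>) ((M\<^sub>z ^^ n) g)"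
      if "n \<ge> N" "g \<in> S" for n g
    proof (rule I(2))
      show "(M\<^sub>z ^^ n) g \<in> car (disc_space \<kappa>)"
        using that sub by (intro M\<^sub>z_funpow_car) auto
      show "taylor_coeff ((M\<^sub>z ^^ n) g) i = 0" if "i \<in> I" for i
        using that N \<open>n \<ge> N\<close> \<open>g \<in> S\<close> sub by (intro taylor_coeff_funpow_0[of _ \<kappa>]) auto
    qed
    then show "\<exists>N. \<forall>n\<ge>N. \<forall>g\<in>car (restr (disc_space \<kappa>) S).
        cmod (ip (restr (disc_space \<kappa>) S) ((M\<^sub>z ^^ n) g) h) \<le> e * hnorm (restr (disc_space \<kappa>) S) ((M\<^sub>z ^^ n) g)"
      by auto
  qed (use inv sub hnorm_M\<^sub>z_lower disc.hnorm_T_le in \<open>auto simp: M\<^sub>z_linear\<close>)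
qed

text \<open>The Shimorin inequality for one coefficient. It is Cauchy-Schwarz with weights
  \<open>p = m + 1\<close> and \<open>q = m + 3\<close>, whose mean \<open>m + 2\<close> is the
  reciprocal of the weight on the left; the deficit is the square
  \<open>(q * x - p * y)\<^sup>2 / (p * q)\<close>.\<close>

lemma Bergman_pointwise:
  fixes a b :: complex
  shows "weight Bergman (Suc m) * (cmod (a + b))\<^sup>2
    \<le> 2 * (weight Bergman m * (cmod a)\<^sup>2 + weight Bergman (Suc (Suc m)) * (cmod b)\<^sup>2)"
proof -
  define p q x y where "p = real m + 1" "q = real m + 3" "x = cmod a" "y = cmod b"
  have pq: "p > 0" "q > 0" "p + q = 2 * (real m + 2)"
    by (auto simp: p_q_x_y_def)
  define R where "R = x\<^sup>2 / p + y\<^sup>2 / q"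
  have "(cmod (a + b))\<^sup>2 \<le> (x + y)\<^sup>2"
    unfolding p_q_x_y_def by (intro power_mono norm_triangle_ineq) auto
  also have "(x + y)\<^sup>2 \<le> (p + q) * (x\<^sup>2 / p + y\<^sup>2 / q)"
  proof -
    have "(p + q) * (x\<^sup>2 / p + y\<^sup>2 / q) - (x + y)\<^sup>2 = (q * x - p * y)\<^sup>2 / (p * q)"
      using pq(1,2) by (simp add: field_simps power2_eq_square)
    moreover have "(q * x - p * y)\<^sup>2 / (p * q) \<ge> 0"
      using pq(1,2) by simp
    ultimately show ?thesis by linarith
  qed
  also have "\<dots> = 2 * (real m + 2) * R"
    by (simp only: pq(3) R_def)
  finally have "(cmod (a + b))\<^sup>2 / (real m + 2) \<le> 2 * R"
    by (simp add: divide_le_eq mult_ac)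
  then show ?thesis
    by (simp add: R_def p_q_x_y_def add_ac)
qed

lemma has_sum_split_0:
  fixes \<phi> :: "nat \<Rightarrow> real"
  assumes "(\<phi> has_sum x) UNIV"
  shows "((\<lambda>m. \<phi> (Suc m)) has_sum (x - \<phi> 0)) UNIV"
proof -
  have "(\<phi> has_sum (x - sum \<phi> {0})) (UNIV - {0})"
    by (intro has_sum_Diff assms has_sum_finite) auto
  moreover have "UNIV - {0} = range Suc"
    by (auto simp: image_iff) (metis not0_implies_Suc)
  ultimately show ?thesis
    using has_sum_reindex[of Suc UNIV \<phi> "x - \<phi> 0"] by (simp add: o_def)
qed

text \<open>Coefficient \<open>m + 1\<close> of \<open>M\<^sub>z f + g\<close> is the sum of
  coefficient \<open>m\<close> of \<open>f\<close> and \<open>m + 1\<close> of \<open>g\<close>, to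
  which \<open>Bergman_pointwise\<close> applies. The constant coefficient of \<open>g\<close> is
  split off: it contributes equally to both sides, since
  \<open>2 * weight Bergman 1 = 1\<close>.\<close>

lemma Shimorin_Bergman:
  assumes f: "f \<in> car (disc_space Bergman)" and g: "g \<in> car (disc_space Bergman)"
  shows "(hnorm (disc_space Bergman) (M\<^sub>z f + g))\<^sup>2
    \<le> 2 * ((hnorm (disc_space Bergman) f)\<^sup>2 + (hnorm (disc_space Bergman) (M\<^sub>z g))\<^sup>2)"
proof -
  let ?H = "disc_space Bergman" and ?w = "weight Bergman"
  let ?b = "(cmod (taylor_coeff g 0))\<^sup>2"
  have w0: "?w 0 = 1"
    by simp
  have "((\<lambda>m. ?w (Suc m) * (cmod (taylor_coeff (M\<^sub>z f + g) (Suc m)))\<^sup>2)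
      has_sum ((hnorm ?H (M\<^sub>z f + g))\<^sup>2 - ?w 0 * (cmod (taylor_coeff (M\<^sub>z f + g) 0))\<^sup>2)) UNIV"
    using f g by (intro has_sum_split_0[OF disc.has_sum_hnorm]) auto
  then have 1: "((\<lambda>m. ?w (Suc m) * (cmod (taylor_coeff f m + taylor_coeff g (Suc m)))\<^sup>2)
      has_sum ((hnorm ?H (M\<^sub>z f + g))\<^sup>2 - ?b)) UNIV"
    using disc.cf_add[OF disc.T_car[OF f] g] disc.cf_T[OF f] disc.cf_T_0[OF f, of 0] w0
    by (simp del: weight.simps)
  have "((\<lambda>m. ?w (Suc (Suc m)) * (cmod (taylor_coeff g (Suc m)))\<^sup>2)
      has_sum ((hnorm ?H (M\<^sub>z g))\<^sup>2 - ?w (Suc 0) * ?b)) UNIV"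
    by (rule has_sum_split_0[OF disc.has_sum_hnorm_T[OF g]])
  from has_sum_cmult_right[OF has_sum_add[OF disc.has_sum_hnorm[OF f] this], of 2]
  have "(hnorm ?H (M\<^sub>z f + g))\<^sup>2 - ?b \<le> 2 * ((hnorm ?H f)\<^sup>2 + ((hnorm ?H (M\<^sub>z g))\<^sup>2 - ?w (Suc 0) * ?b))"
    by (rule has_sum_mono[OF 1]) (rule Bergman_pointwise)
  then show ?thesis
    by simp
qed

lemma contractive_Bergman:
  assumes f: "f \<in> car (disc_space Bergman)"
  shows "hnorm (disc_space Bergman) (M\<^sub>z f) \<le> hnorm (disc_space Bergman) f"
proof (rule power2_le_imp_le)
  show "(hnorm (disc_space Bergman) (M\<^sub>z f))\<^sup>2 \<le> (hnorm (disc_space Bergman) f)\<^sup>2"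
    by (rule has_sum_mono[OF disc.has_sum_hnorm_T[OF f] disc.has_sum_hnorm[OF f]])
       (intro mult_right_mono, auto simp: field_simps)
qed (use f in simp)

text \<open>The Hardy and Dirichlet weights are nondecreasing and affine in the index. Their second
  differences vanish, so \<open>M\<^sub>z\<close> is a 2-isometry and the concavity inequality comes
  from an identity.\<close>

lemma concave_disc:
  assumes "\<kappa> \<noteq> Bergman" and f: "f \<in> car (disc_space \<kappa>)"
  shows "hnorm (disc_space \<kappa>) f \<le> hnorm (disc_space \<kappa>) (M\<^sub>z f)"
    and "(hnorm (disc_space \<kappa>) (M\<^sub>z (M\<^sub>z f)))\<^sup>2 + (hnorm (disc_space \<kappa>) f)\<^sup>2
      \<le> 2 * (hnorm (disc_space \<kappa>) (M\<^sub>z f))\<^sup>2"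
proof -
  have w: "weight \<kappa> m \<le> weight \<kappa> (Suc m)" "weight \<kappa> (Suc (Suc m)) + weight \<kappa> m = 2 * weight \<kappa> (Suc m)" for m
    using assms(1) by (cases \<kappa>; simp)+
  show "hnorm (disc_space \<kappa>) f \<le> hnorm (disc_space \<kappa>) (M\<^sub>z f)"
  proof (rule power2_le_imp_le)
    show "(hnorm (disc_space \<kappa>) f)\<^sup>2 \<le> (hnorm (disc_space \<kappa>) (M\<^sub>z f))\<^sup>2"
      by (rule has_sum_mono[OF disc.has_sum_hnorm[OF f] disc.has_sum_hnorm_T[OF f]])
         (intro mult_right_mono w, simp)
  qed (use f in simp)
  have "((\<lambda>m. weight \<kappa> (Suc (Suc m)) * (cmod (taylor_coeff f m))\<^sup>2 + weight \<kappa> m * (cmod (taylor_coeff f m))\<^sup>2)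
      has_sum ((hnorm (disc_space \<kappa>) (M\<^sub>z (M\<^sub>z f)))\<^sup>2 + (hnorm (disc_space \<kappa>) f)\<^sup>2)) UNIV"
    by (intro has_sum_add disc.has_sum_hnorm_TT disc.has_sum_hnorm f)
  then have "((\<lambda>m. 2 * (weight \<kappa> (Suc m) * (cmod (taylor_coeff f m))\<^sup>2))
      has_sum ((hnorm (disc_space \<kappa>) (M\<^sub>z (M\<^sub>z f)))\<^sup>2 + (hnorm (disc_space \<kappa>) f)\<^sup>2)) UNIV"
    by (simp only: w(2) mult.assoc flip: distrib_right)
  then show "(hnorm (disc_space \<kappa>) (M\<^sub>z (M\<^sub>z f)))\<^sup>2 + (hnorm (disc_space \<kappa>) f)\<^sup>2
      \<le> 2 * (hnorm (disc_space \<kappa>) (M\<^sub>z f))\<^sup>2"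
    using has_sum_unique[OF _ has_sum_cmult_right[OF disc.has_sum_hnorm_T[OF f], of 2]] by force
qed

section \<open>Closed invariant subspaces of a disc space\<close>

context
  fixes \<kappa> and S :: "(complex \<Rightarrow> complex) set"
  assumes S: "closed_subspace (disc_space \<kappa>) S" and inv: "M\<^sub>z ` S \<subseteq> S"
begin

lemma S_car: "f \<in> S \<Longrightarrow> f \<in> car (disc_space \<kappa>)"
  using S by (auto simp: closed_subspace_def)

lemma wandering_eq: "orth (restr (disc_space \<kappa>) S) (M\<^sub>z ` S) = ominus (disc_space \<kappa>) S (M\<^sub>z ` S)"
  using S_car by (auto simp: orth_def ominus_def)

lemma concave_restr: "\<kappa> \<noteq> Bergman \<Longrightarrow> concave_operator (restr (disc_space \<kappa>) S) M\<^sub>z (1 / sqrt 2) (sqrt 2)"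
  unfolding concave_operator_def concave_operator_axioms_def
  using shift_operator_restr[OF S inv] concave_disc S_car by auto

lemma Shimorin_restr: "\<kappa> = Bergman \<Longrightarrow> Shimorin_operator (restr (disc_space \<kappa>) S) M\<^sub>z (1 / sqrt 2) (sqrt 2)"
  unfolding Shimorin_operator_def Shimorin_operator_axioms_def
  using shift_operator_restr[OF S inv] contractive_Bergman Shimorin_Bergman S_car by auto

theorem wandering_subspace_property:
  assumes "h \<in> S" "\<And>k w. w \<in> ominus (disc_space \<kappa>) S (M\<^sub>z ` S) \<Longrightarrow> ip (disc_space \<kappa>) ((M\<^sub>z ^^ k) w) h = 0"
  shows "h = 0"
proof (cases "\<kappa> = Bergman")
  case True
  show ?thesis
    by (rule Shimorin_operator.wandering_orth_0[OF Shimorin_restr[OF True]]) (simp_all add: wandering_eq assms)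
next
  case False
  show ?thesis
    by (rule concave_operator.wandering_orth_0[OF concave_restr[OF False]]) (simp_all add: wandering_eq assms)
qed

theorem wandering_eigenvector:
  assumes w: "w \<in> ominus (disc_space \<kappa>) S (M\<^sub>z ` S)" and l: "cmod l < 1"
  obtains h where "h \<in> S" "\<And>f. f \<in> S \<Longrightarrow> ip (disc_space \<kappa>) (M\<^sub>z f) h = l * ip (disc_space \<kappa>) f h"
    "\<And>v. v \<in> ominus (disc_space \<kappa>) S (M\<^sub>z ` S) \<Longrightarrow> ip (disc_space \<kappa>) v h = ip (disc_space \<kappa>) v w"
proof -
  interpret T: shift_operator "restr (disc_space \<kappa>) S" M\<^sub>z "1 / sqrt 2" "sqrt 2"
    by (rule shift_operator_restr[OF S inv])
  have bound: "hnorm (restr (disc_space \<kappa>) S) ((T.B ^^ n) v) \<le> (real n + 1) * hnorm (restr (disc_space \<kappa>) S) v"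
    if "v \<in> car (restr (disc_space \<kappa>) S)" for n v
    using concave_operator.hnorm_funpow_B[OF concave_restr that, of n]
      Shimorin_operator.hnorm_funpow_B[OF Shimorin_restr that, of n] by (cases "\<kappa> = Bergman") auto
  show thesis
    by (rule T.adjoint_eigenvector[OF bound _ l, of w]) (use w that in \<open>auto simp: wandering_eq\<close>)
qed

lemma subspace_wandering: "fvs.subspace (ominus (disc_space \<kappa>) S (M\<^sub>z ` S))"
proof -
  interpret T: shift_operator "restr (disc_space \<kappa>) S" M\<^sub>z "1 / sqrt 2" "sqrt 2"
    by (rule shift_operator_restr[OF S inv])
  have "closed_subspace (restr (disc_space \<kappa>) S) (orth (restr (disc_space \<kappa>) S) (M\<^sub>z ` S))"
    using inv by (intro T.closed_subspace_orth) auto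
  then show ?thesis
    by (simp only: wandering_eq closed_subspace_def)
qed

end

section \<open>Bases of the wandering subspace and multiplicity in one variable\<close>

lemma hdim_basis:
  assumes "hdim V < \<infinity>"
  obtains B where "B \<subseteq> V" "finite B" "fvs.independent B" "V \<subseteq> fvs.span B" "hdim V = enat (card B)"
proof -
  obtain E where E: "finite E" "V \<subseteq> fvs.span E"
    using assms by (auto simp: hdim_def split: if_splits)
  obtain B where B: "B \<subseteq> V" "fvs.independent B" "V \<subseteq> fvs.span B" "card B = fvs.dim V"
    using fvs.basis_exists .
  moreover have "finite B"
    using fvs.independent_span_bound[OF E(1) B(2)] B(1) E(2) by blast
  ultimately show thesis
    using E by (intro that[of B]) (auto simp: hdim_def)
qed

lemma (in hilbert) orthogonal_span:
  assumes "B \<subseteq> car H" "h \<in> car H" "\<And>b. b \<in> B \<Longrightarrow> ip H b h = 0" "w \<in> fvs.span B"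
  shows "ip H w h = 0"
  using orthogonal_hclosure[OF assms(1-3)] subset_hclosure[OF span_car[OF assms(1)]] assms(4) by blast

lemma independent_coeffs_zero:
  assumes B: "finite B" "fvs.independent B" and "(\<Sum>b\<in>B. (\<lambda>x. c b * b x)) = 0" "b \<in> B"
  shows "c b = 0"
  using fvs.independentD[OF B(2,1) subset_refl, of c b] assms by simp

text \<open>Linear combinations of the functionals \<open>\<langle>\<cdot>, h b\<rangle>\<close> act on the wandering subspace as inner
  products with its own elements, whence linear independence.\<close>

lemma (in hilbert) wandering_coeffs_zero:
  assumes B: "finite B" "fvs.independent B" "B \<subseteq> V" and V: "V \<subseteq> car H" "fvs.subspace V"
    and h: "\<And>b v. \<lbrakk>b \<in> B; v \<in> V\<rbrakk> \<Longrightarrow> ip H v (h b) = ip H v b"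
    and zero: "\<And>v. v \<in> V \<Longrightarrow> (\<Sum>b\<in>B. c b * ip H v (h b)) = 0" and b: "b \<in> B"
  shows "c b = 0"
proof -
  define u where "u = (\<Sum>b\<in>B. (\<lambda>x. cnj (c b) * b x))"
  have u: "u \<in> V"
    unfolding u_def using B V by (intro fvs.subspace_sum fvs.subspace_scale) auto
  \<comment> \<open>The combination is tested against itself: on \<open>V\<close> each
    \<open>h b\<close> may be replaced by \<open>b\<close>, which turns the vanishing sum into the
    squared norm of \<open>u\<close>.\<close>
  have "ip H u u = (\<Sum>b\<in>B. c b * ip H u b)"
    by (subst (2) u_def, subst ip_sum_right) (use u B V in \<open>auto intro!: sum.cong simp: subset_iff\<close>)
  also have "\<dots> = (\<Sum>b\<in>B. c b * ip H u (h b))"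
    using h u by (intro sum.cong) auto
  also have "\<dots> = 0"
    by (rule zero[OF u])
  finally have "u = 0"
    using ip_definite u V by blast
  then have "cnj (c b) = 0"
    using independent_coeffs_zero[OF B(1,2), of "\<lambda>b. cnj (c b)"] b by (simp add: u_def)
  then show ?thesis by simp
qed

lemma generated_wandering:
  assumes S: "closed_subspace (disc_space \<kappa>) S" and inv: "M\<^sub>z ` S \<subseteq> S"
    and B: "B \<subseteq> ominus (disc_space \<kappa>) S (M\<^sub>z ` S)" "ominus (disc_space \<kappa>) S (M\<^sub>z ` S) \<subseteq> fvs.span B"
  shows "generated (restr (disc_space \<kappa>) S) (\<lambda>_::unit. M\<^sub>z) B = car (restr (disc_space \<kappa>) S)"
proof -
  have VS: "ominus (disc_space \<kappa>) S (M\<^sub>z ` S) \<subseteq> S"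
    by (auto simp: ominus_def)
  have SC: "S \<subseteq> car (disc_space \<kappa>)"
    using S_car[OF S inv] by auto
  have pow: "(M\<^sub>z ^^ n) f \<in> S" if "f \<in> S" for n f
    by (induction n) (use that inv in auto)
  interpret R: hilbert "restr (disc_space \<kappa>) S"
    by (rule disc.hilbert_restr[OF S])
  show ?thesis
  proof (rule R.generated_eq_carI)
    show "op_monomial (\<lambda>_::unit. M\<^sub>z) k g \<in> car (restr (disc_space \<kappa>) S)" if "g \<in> B" for k g
      using that B VS pow by (auto simp: op_monomial_M\<^sub>z)
    fix h assume h: "h \<in> car (restr (disc_space \<kappa>) S)"
      and 0: "\<And>(k :: unit \<Rightarrow> nat) g. g \<in> B \<Longrightarrow> ip (restr (disc_space \<kappa>) S) (op_monomial (\<lambda>_::unit. M\<^sub>z) k g) h = 0"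
    show "h = 0"
    proof (rule wandering_subspace_property[OF S inv])
      fix k w assume w: "w \<in> ominus (disc_space \<kappa>) S (M\<^sub>z ` S)"
      have "(M\<^sub>z ^^ k) w \<in> fvs.span ((M\<^sub>z ^^ k) ` B)"
      proof -
        have "module_hom (\<lambda>c (f::complex \<Rightarrow> complex) x. c * f x) (\<lambda>c f x. c * f x) (M\<^sub>z ^^ k)"
          by unfold_locales (auto simp: M\<^sub>z_funpow fun_eq_iff algebra_simps)
        from module_hom.span_image[OF this, of B] show ?thesis
          using w B(2) by auto
      qed
      then show "ip (disc_space \<kappa>) ((M\<^sub>z ^^ k) w) h = 0"
      proof (rule disc.orthogonal_span[rotated -1])
        show "(M\<^sub>z ^^ k) ` B \<subseteq> car (disc_space \<kappa>)" "h \<in> car (disc_space \<kappa>)"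
          using B(1) VS SC h by (auto intro!: M\<^sub>z_funpow_car simp: subset_iff)
        show "ip (disc_space \<kappa>) b h = 0" if "b \<in> (M\<^sub>z ^^ k) ` B" for b
          using that 0[of _ "\<lambda>_. k"] by (auto simp: op_monomial_M\<^sub>z)
      qed
    qed (use h in simp)
  qed
qed

theorem hmult_invariant_subspace:
  assumes S: "closed_subspace (disc_space \<kappa>) S" and inv: "M\<^sub>z ` S \<subseteq> S"
    and fin: "hdim (ominus (disc_space \<kappa>) S (M\<^sub>z ` S)) < \<infinity>"
  shows "hmult (restr (disc_space \<kappa>) S) (\<lambda>_::unit. M\<^sub>z) = hdim (ominus (disc_space \<kappa>) S (M\<^sub>z ` S))"
proof -
  define V where "V = ominus (disc_space \<kappa>) S (M\<^sub>z ` S)"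
  obtain B where B: "B \<subseteq> V" "finite B" "fvs.independent B" "V \<subseteq> fvs.span B" "hdim V = enat (card B)"
    using hdim_basis fin unfolding V_def by blast
  have VS: "V \<subseteq> S"
    by (auto simp: V_def ominus_def)
  have SC: "S \<subseteq> car (disc_space \<kappa>)"
    using S_car[OF S inv] by auto
  interpret R: hilbert "restr (disc_space \<kappa>) S"
    by (rule disc.hilbert_restr[OF S])
  have gen: "generated (restr (disc_space \<kappa>) S) (\<lambda>_::unit. M\<^sub>z) B = car (restr (disc_space \<kappa>) S)"
    using generated_wandering[OF S inv] B(1,4) unfolding V_def by blast
  have lower: "enat (card B) \<le> ecard G"
    if G: "G \<subseteq> car (restr (disc_space \<kappa>) S)"
      "generated (restr (disc_space \<kappa>) S) (\<lambda>_::unit. M\<^sub>z) G = car (restr (disc_space \<kappa>) S)" for G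
  proof (rule R.card_le_generating_set[where v = "\<lambda>b. b" and K = "disc_space \<kappa>" and \<mu> = "\<lambda>_. 0"])
    show "ip (disc_space \<kappa>) (M\<^sub>z F) a = 0 * ip (disc_space \<kappa>) F a" if "F \<in> car (restr (disc_space \<kappa>) S)" "a \<in> B" for F a
    proof -
      have "M\<^sub>z ` S \<subseteq> car (disc_space \<kappa>)"
        using inv SC by blast
      moreover have "a \<in> orth (disc_space \<kappa>) (M\<^sub>z ` S)"
        using that(2) B(1) unfolding V_def ominus_def by blast
      ultimately have "\<forall>x\<in>M\<^sub>z ` S. ip (disc_space \<kappa>) x a = 0"
        using disc.orth_iff by blast
      then show ?thesis
        using that(1) by simp
    qed
    show "c a = 0" if zero: "\<And>F. F \<in> car (restr (disc_space \<kappa>) S) \<Longrightarrow> (\<Sum>a\<in>B. c a * ip (disc_space \<kappa>) F a) = 0"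
      and a: "a \<in> B" for c a
    proof (rule disc.wandering_coeffs_zero[OF B(2,3,1) _ _ refl _ a])
      show "V \<subseteq> car (disc_space \<kappa>)"
        using VS SC by blast
      show "fvs.subspace V"
        unfolding V_def by (rule subspace_wandering[OF S inv])
      show "(\<Sum>a\<in>B. c a * ip (disc_space \<kappa>) v a) = 0" if "v \<in> V" for v
        using zero that VS by auto
    qed
    show "a \<in> car (disc_space \<kappa>)" if "a \<in> B" for a
      using that B(1) VS SC by blast
    show "M\<^sub>z F \<in> car (restr (disc_space \<kappa>) S)" if "F \<in> car (restr (disc_space \<kappa>) S)" for F
      using that inv by auto
  qed (fact G | simp add: B(2) S disc.hilbert_axioms)+
  have "hmult (restr (disc_space \<kappa>) S) (\<lambda>_::unit. M\<^sub>z) = enat (card B)"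
    unfolding hmult_def
  proof (rule antisym)
    show "Inf {ecard G |G. G \<subseteq> car (restr (disc_space \<kappa>) S) \<and>
        generated (restr (disc_space \<kappa>) S) (\<lambda>_::unit. M\<^sub>z) G = car (restr (disc_space \<kappa>) S)} \<le> enat (card B)"
      using gen B VS by (intro Inf_lower) (auto simp: ecard_def intro!: exI[of _ B])
  qed (auto intro!: Inf_greatest lower)
  then show ?thesis
    using B(5) by (simp add: V_def)
qed

text \<open>Generation restated with the closure in the ambient space, the form needed to
  approximate inside one slot of a tensor.\<close>

lemma invariant_subspace_subset_hclosure:
  assumes S: "closed_subspace (disc_space \<kappa>) S" and inv: "M\<^sub>z ` S \<subseteq> S"
    and B: "B \<subseteq> ominus (disc_space \<kappa>) S (M\<^sub>z ` S)" "ominus (disc_space \<kappa>) S (M\<^sub>z ` S) \<subseteq> fvs.span B"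
  shows "S \<subseteq> hclosure (disc_space \<kappa>) (fvs.span {(M\<^sub>z ^^ k) b | k b. b \<in> B})"
proof -
  have eq: "{op_monomial (\<lambda>_::unit. M\<^sub>z) k b | k b. b \<in> B} = {(M\<^sub>z ^^ k) b | k b. b \<in> B}"
    unfolding op_monomial_M\<^sub>z by (auto intro: exI[of _ "\<lambda>_. k" for k])
  have "hclosure (restr (disc_space \<kappa>) S) (fvs.span {(M\<^sub>z ^^ k) b | k b. b \<in> B}) = S"
    using generated_wandering[OF assms] unfolding generated_def eq by simp
  then show ?thesis
    using S_car[OF S inv] by (auto simp: hclosure_def)
qed

section \<open>The tensor product\<close>

text \<open>\<open>g\<close> takes the index together with the content of the slot, so that values,
  inner products, norms, weights and coefficients of an updated tensor are all instances.\<close>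

lemma prod_fun_upd:
  fixes g :: "'n::finite \<Rightarrow> 'b \<Rightarrow> 'c::comm_monoid_mult"
  shows "(\<Prod>i\<in>UNIV. g i ((f(j := x)) i)) = g j x * (\<Prod>i\<in>-{j}. g i (f i))"
proof -
  have "(\<Prod>i\<in>UNIV. g i ((f(j := x)) i)) = g j ((f(j := x)) j) * (\<Prod>i\<in>UNIV - {j}. g i ((f(j := x)) i))"
    by (rule prod.remove) auto
  also have "(\<Prod>i\<in>UNIV - {j}. g i ((f(j := x)) i)) = (\<Prod>i\<in>-{j}. g i (f i))"
    by (rule prod.cong) auto
  finally show ?thesis by simp
qed

lemma prod_split_at:
  fixes g :: "'n::finite \<Rightarrow> 'c::comm_monoid_mult"
  shows "(\<Prod>i\<in>UNIV. g i) = g j * (\<Prod>i\<in>-{j}. g i)"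
  using prod_fun_upd[of "\<lambda>i x. g i" undefined j] by simp

lemma monom_at_Suc: "monom_at (\<alpha>(k := Suc (\<alpha> k))) z = z $ k * monom_at \<alpha> z"
  unfolding monom_at_def prod_split_at[of "\<lambda>i. (z $ i) ^ \<alpha> i" k]
  by (subst prod_fun_upd[where g = "\<lambda>i a. (z $ i) ^ a"]) simp

lemma tensor_weight_ratio:
  "tensor_weight \<kappa> (\<alpha>(k := Suc (\<alpha> k))) = weight (\<kappa> k) (Suc (\<alpha> k)) / weight (\<kappa> k) (\<alpha> k) * tensor_weight \<kappa> \<alpha>"
proof -
  have "weight (\<kappa> k) (\<alpha> k) \<noteq> 0"
    using weight_pos[of "\<kappa> k" "\<alpha> k"] by simp
  then show ?thesis
    unfolding tensor_weight_def prod_split_at[of "\<lambda>i. weight (\<kappa> i) (\<alpha> i)" k]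
    by (subst prod_fun_upd[where g = "\<lambda>i a. weight (\<kappa> i) a"]) simp
qed

lemma tensor_weight_Suc_le: "tensor_weight \<kappa> (\<alpha>(k := Suc (\<alpha> k))) \<le> 2 * tensor_weight \<kappa> \<alpha>"
  unfolding tensor_weight_ratio using weight_Suc_le[of "\<kappa> k" "\<alpha> k"] weight_pos[of "\<kappa> k" "\<alpha> k"] tensor_weight_pos[of \<kappa> \<alpha>]
  by (intro mult_right_mono) (auto simp: divide_le_eq)

lemma inj_Suc_at: "inj (\<lambda>\<alpha>. \<alpha>(k := Suc (\<alpha> k)))"
proof (rule injI)
  fix \<alpha> \<beta> :: "'a \<Rightarrow> nat" assume "\<alpha>(k := Suc (\<alpha> k)) = \<beta>(k := Suc (\<beta> k))"
  then have "(\<alpha>(k := Suc (\<alpha> k))) i = (\<beta>(k := Suc (\<beta> k))) i" for i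
    by simp
  then show "\<alpha> = \<beta>"
    by (metis ext fun_upd_apply nat.inject)
qed

lemma range_Suc_at: "\<beta> \<notin> range (\<lambda>\<alpha>. \<alpha>(k := Suc (\<alpha> k))) \<Longrightarrow> \<beta> k = 0"
proof (rule ccontr)
  assume *: "\<beta> \<notin> range (\<lambda>\<alpha>. \<alpha>(k := Suc (\<alpha> k)))" and "\<beta> k \<noteq> 0"
  then have "\<beta> = (\<lambda>\<alpha>. \<alpha>(k := Suc (\<alpha> k))) (\<beta>(k := \<beta> k - 1))"
    by simp
  then show False
    using * by blast
qed

section \<open>Functions on the polydisc and their coefficients\<close>

lemma tensor_spaceI:
  assumes "has_expansion F a" "\<And>z. z \<notin> polydisc \<Longrightarrow> F z = 0"
    "(\<lambda>\<alpha>. tensor_weight \<kappa> \<alpha> * (cmod (a \<alpha>))\<^sup>2) summable_on UNIV"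
  shows "F \<in> car (tensor_space \<kappa>)" "coeff_of F = a"
  using assms coeff_of_eq by (auto simp: tensor_space_def)

lemma tensor_spaceD:
  assumes "F \<in> car (tensor_space \<kappa>)"
  shows "has_expansion F (coeff_of F)" "z \<notin> polydisc \<Longrightarrow> F z = 0"
    "(\<lambda>\<alpha>. tensor_weight \<kappa> \<alpha> * (cmod (coeff_of F \<alpha>))\<^sup>2) summable_on UNIV"
  using assms coeff_of_eq by (auto simp: tensor_space_def)

lemma has_expansion_add:
  assumes "has_expansion F a" "has_expansion G b"
  shows "has_expansion (F + G) (\<lambda>\<alpha>. a \<alpha> + b \<alpha>)"
  using assms has_sum_add unfolding has_expansion_def by (fastforce simp: distrib_right)

lemma has_expansion_scale:
  assumes "has_expansion F a"
  shows "has_expansion (\<lambda>z. c * F z) (\<lambda>\<alpha>. c * a \<alpha>)"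
  using assms has_sum_cmult_right unfolding has_expansion_def by (fastforce simp: mult.assoc)

text \<open>Multiplying the bounds on the single weights shows that the coefficients grow at most
  like the product of the \<open>\<alpha> i + 1\<close>; the expansion is then dominated by a
  product of one-variable series.\<close>

lemma tensor_space_surj:
  fixes \<kappa> :: "'n::finite \<Rightarrow> space_kind"
  assumes a: "(\<lambda>\<alpha>. tensor_weight \<kappa> \<alpha> * (cmod (a \<alpha>))\<^sup>2) summable_on UNIV"
  shows "\<exists>F\<in>car (tensor_space \<kappa>). coeff_of F = a"
proof -
  define S where "S = (\<Sum>\<^sub>\<infinity>\<alpha>. tensor_weight \<kappa> \<alpha> * (cmod (a \<alpha>))\<^sup>2)"
  have le: "tensor_weight \<kappa> \<alpha> * (cmod (a \<alpha>))\<^sup>2 \<le> S" for \<alpha>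
    using finite_sum_le_infsum[OF a, of "{\<alpha>}"] tensor_weight_pos[of \<kappa>] by (simp add: S_def less_imp_le)
  have bound: "cmod (a \<alpha>) \<le> sqrt S * (\<Prod>i\<in>UNIV. real (\<alpha> i) + 1)" for \<alpha>
  proof (rule sqrt_bound_of_weighted[OF le])
    have "1 / (\<Prod>i\<in>UNIV. real (\<alpha> i) + 1) = (\<Prod>i\<in>UNIV. 1 / (real (\<alpha> i) + 1))"
      by (simp add: prod_dividef)
    also have "\<dots> \<le> tensor_weight \<kappa> \<alpha>"
      unfolding tensor_weight_def by (intro prod_mono) (auto simp: weight_ge)
    finally show "1 / (\<Prod>i\<in>UNIV. real (\<alpha> i) + 1) \<le> tensor_weight \<kappa> \<alpha>" .
  qed (auto intro!: prod_ge_1)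
  define F where "F z = (if z \<in> polydisc then \<Sum>\<^sub>\<infinity>\<alpha>. a \<alpha> * monom_at \<alpha> z else 0)" for z :: "complex ^ 'n"
  have "has_expansion F a"
    unfolding has_expansion_def
  proof
    fix z :: "complex ^ 'n" assume z: "z \<in> polydisc"
    have s: "summable (\<lambda>m. (real m + 1) * cmod (z $ i) ^ m)" for i
      using z by (intro summable_Suc_power) (auto simp: polydisc_def)
    have s': "(\<lambda>m. (real m + 1) * cmod (z $ i) ^ m) summable_on UNIV" for i
      using s by (intro summable_nonneg_imp_summable_on) auto
    have "((\<lambda>\<alpha>. \<Prod>i\<in>UNIV. (real (\<alpha> i) + 1) * cmod (z $ i) ^ \<alpha> i) has_sum
        (\<Prod>i\<in>UNIV. \<Sum>\<^sub>\<infinity>m. (real m + 1) * cmod (z $ i) ^ m)) UNIV"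
      using s' by (intro prod_has_sum has_sum_infsum) (auto simp: abs_mult)
    then have "(\<lambda>\<alpha>. sqrt S * (\<Prod>i\<in>UNIV. (real (\<alpha> i) + 1) * cmod (z $ i) ^ \<alpha> i)) summable_on UNIV"
      by (intro summable_on_cmult_right has_sum_imp_summable)
    then have "(\<lambda>\<alpha>. norm (a \<alpha> * monom_at \<alpha> z)) summable_on UNIV"
    proof (rule summable_on_comparison_test)
      fix \<alpha>
      have "norm (a \<alpha> * monom_at \<alpha> z) = cmod (a \<alpha>) * (\<Prod>i\<in>UNIV. cmod (z $ i) ^ \<alpha> i)"
        by (simp add: monom_at_def norm_mult norm_power flip: prod_norm)
      also have "\<dots> \<le> (sqrt S * (\<Prod>i\<in>UNIV. real (\<alpha> i) + 1)) * (\<Prod>i\<in>UNIV. cmod (z $ i) ^ \<alpha> i)"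
        by (intro mult_right_mono bound prod_nonneg) auto
      finally show "norm (a \<alpha> * monom_at \<alpha> z) \<le> sqrt S * (\<Prod>i\<in>UNIV. (real (\<alpha> i) + 1) * cmod (z $ i) ^ \<alpha> i)"
        by (simp add: prod.distrib mult.assoc)
    qed simp
    then have "(\<lambda>\<alpha>. a \<alpha> * monom_at \<alpha> z) summable_on UNIV"
      by (rule abs_summable_summable)
    then show "((\<lambda>\<alpha>. a \<alpha> * monom_at \<alpha> z) has_sum F z) UNIV"
      using z by (simp add: F_def)
  qed
  from tensor_spaceI[OF this _ a] show ?thesis
    by (auto simp: F_def)
qed

lemma tensor_space_weighted_l2: "weighted_l2 (tensor_space \<kappa>) (tensor_weight \<kappa>) coeff_of"
proof
  show "fvs.subspace (car (tensor_space \<kappa>))"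
    unfolding fvs.subspace_def
  proof (intro conjI ballI allI)
    have "has_expansion (0 :: complex ^ 'a \<Rightarrow> complex) (\<lambda>_. 0)"
      by (simp add: has_expansion_def)
    then show "0 \<in> car (tensor_space \<kappa>)"
      by (rule tensor_spaceI) auto
  next
    fix F G assume FG: "F \<in> car (tensor_space \<kappa>)" "G \<in> car (tensor_space \<kappa>)"
    show "F + G \<in> car (tensor_space \<kappa>)"
    proof (rule tensor_spaceI[OF has_expansion_add[OF tensor_spaceD(1)[OF FG(1)] tensor_spaceD(1)[OF FG(2)]]])
      show "(\<lambda>\<alpha>. tensor_weight \<kappa> \<alpha> * (cmod (coeff_of F \<alpha> + coeff_of G \<alpha>))\<^sup>2) summable_on UNIV"
      proof (rule summable_on_comparison_test)
        show "(\<lambda>\<alpha>. 2 * (tensor_weight \<kappa> \<alpha> * (cmod (coeff_of F \<alpha>))\<^sup>2 + tensor_weight \<kappa> \<alpha> * (cmod (coeff_of G \<alpha>))\<^sup>2)) summable_on UNIV"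
          by (intro summable_on_cmult_right summable_on_add tensor_spaceD FG)
        fix \<alpha>
        define x y where "x = cmod (coeff_of F \<alpha>)" and "y = cmod (coeff_of G \<alpha>)"
        have "(cmod (coeff_of F \<alpha> + coeff_of G \<alpha>))\<^sup>2 \<le> (x + y)\<^sup>2"
          unfolding x_def y_def by (intro power_mono norm_triangle_ineq) auto
        also have "\<dots> \<le> 2 * (x\<^sup>2 + y\<^sup>2)"
          using sum_squares_bound[of x y] by (simp add: power2_sum)
        finally have "tensor_weight \<kappa> \<alpha> * (cmod (coeff_of F \<alpha> + coeff_of G \<alpha>))\<^sup>2 \<le> tensor_weight \<kappa> \<alpha> * (2 * (x\<^sup>2 + y\<^sup>2))"
          using tensor_weight_pos[of \<kappa> \<alpha>] by (intro mult_left_mono) auto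
        then show "tensor_weight \<kappa> \<alpha> * (cmod (coeff_of F \<alpha> + coeff_of G \<alpha>))\<^sup>2
            \<le> 2 * (tensor_weight \<kappa> \<alpha> * (cmod (coeff_of F \<alpha>))\<^sup>2 + tensor_weight \<kappa> \<alpha> * (cmod (coeff_of G \<alpha>))\<^sup>2)"
          by (simp add: x_def y_def algebra_simps)
      qed (intro mult_nonneg_nonneg less_imp_le[OF tensor_weight_pos] zero_le_power2)
    qed (simp add: tensor_spaceD(2)[OF FG(1)] tensor_spaceD(2)[OF FG(2)])
  next
    fix c F assume F: "F \<in> car (tensor_space \<kappa>)"
    have "(\<lambda>\<alpha>. (cmod c)\<^sup>2 * (tensor_weight \<kappa> \<alpha> * (cmod (coeff_of F \<alpha>))\<^sup>2)) summable_on UNIV"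
      by (intro summable_on_cmult_right tensor_spaceD F)
    then show "(\<lambda>z. c * F z) \<in> car (tensor_space \<kappa>)"
      by (intro tensor_spaceI[OF has_expansion_scale[OF tensor_spaceD(1)[OF F]]])
         (simp_all add: tensor_spaceD(2)[OF F] norm_mult power_mult_distrib mult_ac)
  qed
next
  fix F assume F: "F \<in> car (tensor_space \<kappa>)" "\<And>\<alpha>. coeff_of F \<alpha> = 0"
  have "F z = 0" for z
  proof (cases "z \<in> polydisc")
    case True
    then have "((\<lambda>\<alpha>. coeff_of F \<alpha> * monom_at \<alpha> z) has_sum F z) UNIV"
      using tensor_spaceD(1)[OF F(1)] by (simp add: has_expansion_def)
    then show ?thesis
      using F(2) has_sum_unique[OF _ has_sum_0] by force
  qed (simp add: tensor_spaceD(2)[OF F(1)])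
  then show "F = 0"
    by (simp add: fun_eq_iff)
next
  fix F G \<alpha> assume "F \<in> car (tensor_space \<kappa>)" "G \<in> car (tensor_space \<kappa>)"
  then show "coeff_of (F + G) \<alpha> = coeff_of F \<alpha> + coeff_of G \<alpha>"
    by (subst coeff_of_eq[OF has_expansion_add]) (auto intro: tensor_spaceD)
next
  fix F c \<alpha> assume "F \<in> car (tensor_space \<kappa>)"
  then show "coeff_of (\<lambda>z. c * F z) \<alpha> = c * coeff_of F \<alpha>"
    by (subst coeff_of_eq[OF has_expansion_scale]) (auto intro: tensor_spaceD)
qed (simp_all add: tensor_weight_pos tensor_space_surj tensor_spaceD(3), simp_all add: tensor_space_def)

interpretation tensor: weighted_l2 "tensor_space \<kappa>" "tensor_weight \<kappa>" coeff_of for \<kappa>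
  by (rule tensor_space_weighted_l2)

lemma Mcoord_in_tensor_space:
  fixes k :: "'n::finite" and \<kappa> :: "'n \<Rightarrow> space_kind"
  assumes F: "F \<in> car (tensor_space \<kappa>)"
  defines "b \<equiv> \<lambda>\<beta>. if \<beta> k = 0 then 0 else coeff_of F (\<beta>(k := \<beta> k - 1))"
  shows "Mcoord k F \<in> car (tensor_space \<kappa>)" "coeff_of (Mcoord k F) = b"
proof -
  define s where "s \<alpha> = \<alpha>(k := Suc (\<alpha> k))" for \<alpha> :: "'n \<Rightarrow> nat"
  have s: "inj s" "\<And>\<beta>. \<beta> \<notin> range s \<Longrightarrow> b \<beta> = 0" "\<And>\<alpha>. b (s \<alpha>) = coeff_of F \<alpha>"
    using inj_Suc_at[of k] range_Suc_at[of _ k] by (auto simp: s_def[abs_def] b_def)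
  have exp: "has_expansion (Mcoord k F) b"
    unfolding has_expansion_def
  proof
    fix z :: "complex ^ 'n" assume "z \<in> polydisc"
    then have "((\<lambda>\<alpha>. z $ k * (coeff_of F \<alpha> * monom_at \<alpha> z)) has_sum (z $ k * F z)) UNIV"
      using tensor_spaceD(1)[OF F] by (intro has_sum_cmult_right) (simp add: has_expansion_def)
    moreover have "z $ k * (coeff_of F \<alpha> * monom_at \<alpha> z) = b (s \<alpha>) * monom_at (s \<alpha>) z" for \<alpha>
      unfolding s(3) by (simp add: s_def monom_at_Suc)
    ultimately have "((\<lambda>\<alpha>. b (s \<alpha>) * monom_at (s \<alpha>) z) has_sum Mcoord k F z) UNIV"
      by (simp only: Mcoord_def)
    then show "((\<lambda>\<alpha>. b \<alpha> * monom_at \<alpha> z) has_sum Mcoord k F z) UNIV"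
      by (subst has_sum_reindex_range[OF s(1)]) (auto simp: s(2))
  qed
  have "(\<lambda>\<alpha>. tensor_weight \<kappa> (s \<alpha>) * (cmod (coeff_of F \<alpha>))\<^sup>2) summable_on UNIV"
  proof (rule summable_on_comparison_test)
    show "(\<lambda>\<alpha>. 2 * (tensor_weight \<kappa> \<alpha> * (cmod (coeff_of F \<alpha>))\<^sup>2)) summable_on UNIV"
      by (intro summable_on_cmult_right tensor_spaceD F)
    show "tensor_weight \<kappa> (s \<alpha>) * (cmod (coeff_of F \<alpha>))\<^sup>2 \<le> 2 * (tensor_weight \<kappa> \<alpha> * (cmod (coeff_of F \<alpha>))\<^sup>2)" for \<alpha>
      using tensor_weight_Suc_le[of \<kappa> \<alpha> k] by (simp add: s_def mult_right_mono flip: mult.assoc)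
  qed (intro mult_nonneg_nonneg less_imp_le[OF tensor_weight_pos] zero_le_power2)
  then have sm: "(\<lambda>\<alpha>. tensor_weight \<kappa> \<alpha> * (cmod (b \<alpha>))\<^sup>2) summable_on UNIV"
    unfolding summable_on_def by (subst has_sum_reindex_range[OF s(1)]) (auto simp: s(2,3))
  show "Mcoord k F \<in> car (tensor_space \<kappa>)" "coeff_of (Mcoord k F) = b"
    by (rule tensor_spaceI[OF exp _ sm]; simp add: Mcoord_def tensor_spaceD(2)[OF F])+
qed

interpretation tshift: weighted_shift "tensor_space \<kappa>" "tensor_weight \<kappa>" coeff_of
    "\<lambda>\<alpha>. \<alpha>(k := Suc (\<alpha> k))" "Mcoord k" for \<kappa> k
proof
  fix F assume F: "F \<in> car (tensor_space \<kappa>)"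
  show "Mcoord k F \<in> car (tensor_space \<kappa>)"
    by (rule Mcoord_in_tensor_space(1)[OF F])
  show "coeff_of (Mcoord k F) (\<alpha>(k := Suc (\<alpha> k))) = coeff_of F \<alpha>" for \<alpha>
    by (simp add: Mcoord_in_tensor_space(2)[OF F])
  show "coeff_of (Mcoord k F) \<beta> = 0" if "\<beta> \<notin> range (\<lambda>\<alpha>. \<alpha>(k := Suc (\<alpha> k)))" for \<beta>
    using range_Suc_at[OF that] by (simp add: Mcoord_in_tensor_space(2)[OF F])
qed (rule inj_Suc_at tensor_weight_Suc_le)+

section \<open>Elementary tensors\<close>

lemma elem_tensor_fun_upd: "elem_tensor (f(j := g)) z = g (z $ j) * (\<Prod>i\<in>-{j}. f i (z $ i))"
  unfolding elem_tensor_def by (rule prod_fun_upd[where g = "\<lambda>i h. h (z $ i)"])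

lemma ip_elem_tensor_fun_upd:
  assumes "\<And>i. f i \<in> car (disc_space (\<kappa> i))" "\<And>i. h i \<in> car (disc_space (\<kappa> i))" "g \<in> car (disc_space (\<kappa> j))"
  shows "ip (tensor_space \<kappa>) (elem_tensor (f(j := g))) (elem_tensor h)
    = ip (disc_space (\<kappa> j)) g (h j) * (\<Prod>i\<in>-{j}. ip (disc_space (\<kappa> i)) (f i) (h i))"
proof -
  have "(f(j := g)) i \<in> car (disc_space (\<kappa> i))" for i
    using assms by simp
  from ip_elem_tensor[of "f(j := g)" \<kappa> h, OF this assms(2)] show ?thesis
    unfolding prod_fun_upd[where g = "\<lambda>i x. ip (disc_space (\<kappa> i)) x (h i)"] .
qed

lemma hnorm_elem_tensor:
  assumes f: "\<And>i. f i \<in> car (disc_space (\<kappa> i))"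
  shows "hnorm (tensor_space \<kappa>) (elem_tensor f) = (\<Prod>i\<in>UNIV. hnorm (disc_space (\<kappa> i)) (f i))"
proof -
  define P where "P = (\<Prod>i\<in>UNIV. hnorm (disc_space (\<kappa> i)) (f i))"
  have "P \<ge> 0"
    by (simp add: P_def prod_nonneg f)
  have "ip (tensor_space \<kappa>) (elem_tensor f) (elem_tensor f) = of_real (P\<^sup>2)"
    by (simp add: ip_elem_tensor[OF f f] disc.ip_self[OF f] prod_power_distrib P_def)
  then show ?thesis
    using \<open>P \<ge> 0\<close> unfolding P_def[symmetric] by (simp add: hnorm_def)
qed

text \<open>With the other slots fixed, the inner product with \<open>h\<close> is a linear
  functional of the content of slot \<open>j\<close>, bounded because the norm of an elementary
  tensor is the product of the norms.\<close>

lemma elem_tensor_slot_closure: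
  assumes f: "\<And>i. f i \<in> car (disc_space (\<kappa> i))" and h: "h \<in> car (tensor_space \<kappa>)"
    and X: "X \<subseteq> car (disc_space (\<kappa> j))"
    and zero: "\<And>x. x \<in> X \<Longrightarrow> ip (tensor_space \<kappa>) (elem_tensor (f(j := x))) h = 0"
    and g: "g \<in> hclosure (disc_space (\<kappa> j)) (fvs.span X)"
  shows "ip (tensor_space \<kappa>) (elem_tensor (f(j := g))) h = 0"
proof (rule disc.functional_zero_on_hclosure[OF X _ _ _ zero g])
  have mem: "elem_tensor (f(j := x)) \<in> car (tensor_space \<kappa>)" if "x \<in> car (disc_space (\<kappa> j))" for x
    using that f by (intro elem_tensor_in_tensor_space) auto
  show "ip (tensor_space \<kappa>) (elem_tensor (f(j := x + y))) h =
      ip (tensor_space \<kappa>) (elem_tensor (f(j := x))) h + ip (tensor_space \<kappa>) (elem_tensor (f(j := y))) h"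
    if "x \<in> car (disc_space (\<kappa> j))" "y \<in> car (disc_space (\<kappa> j))" for x y
  proof -
    have "elem_tensor (f(j := x + y)) = elem_tensor (f(j := x)) + elem_tensor (f(j := y))"
      by (simp add: fun_eq_iff elem_tensor_fun_upd distrib_right)
    then show ?thesis
      using that mem h by simp
  qed
  show "ip (tensor_space \<kappa>) (elem_tensor (f(j := (\<lambda>z. c * x z)))) h = c * ip (tensor_space \<kappa>) (elem_tensor (f(j := x))) h"
    if "x \<in> car (disc_space (\<kappa> j))" for c x
  proof -
    have "elem_tensor (f(j := (\<lambda>z. c * x z))) = (\<lambda>z. c * elem_tensor (f(j := x)) z)"
      by (simp add: fun_eq_iff elem_tensor_fun_upd mult.assoc)
    then show ?thesis
      using that mem h by simp
  qed
  show "cmod (ip (tensor_space \<kappa>) (elem_tensor (f(j := x))) h)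
      \<le> ((\<Prod>i\<in>-{j}. hnorm (disc_space (\<kappa> i)) (f i)) * hnorm (tensor_space \<kappa>) h) * hnorm (disc_space (\<kappa> j)) x"
    if "x \<in> car (disc_space (\<kappa> j))" for x
  proof -
    have "hnorm (tensor_space \<kappa>) (elem_tensor (f(j := x))) = (\<Prod>i\<in>UNIV. hnorm (disc_space (\<kappa> i)) ((f(j := x)) i))"
      by (rule hnorm_elem_tensor) (use f that in auto)
    also have "\<dots> = hnorm (disc_space (\<kappa> j)) x * (\<Prod>i\<in>-{j}. hnorm (disc_space (\<kappa> i)) (f i))"
      by (rule prod_fun_upd[where g = "\<lambda>i. hnorm (disc_space (\<kappa> i))"])
    finally show ?thesis
      using tensor.Cauchy_Schwarz[OF mem[OF that] h] by (simp add: mult_ac)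
  qed
qed

text \<open>Induction on the set of slots already relaxed from \<open>X i\<close> to its closed
  span; one application of \<open>elem_tensor_slot_closure\<close> relaxes one more.\<close>

lemma elem_tensor_closure:
  assumes h: "h \<in> car (tensor_space \<kappa>)" and X: "\<And>i. X i \<subseteq> car (disc_space (\<kappa> i))"
    and zero: "\<And>x. (\<And>i. x i \<in> X i) \<Longrightarrow> ip (tensor_space \<kappa>) (elem_tensor x) h = 0"
    and g: "\<And>i. g i \<in> hclosure (disc_space (\<kappa> i)) (fvs.span (X i))"
  shows "ip (tensor_space \<kappa>) (elem_tensor g) h = 0"
proof -
  have cl: "hclosure (disc_space (\<kappa> i)) (fvs.span (X i)) \<subseteq> car (disc_space (\<kappa> i))" for i
    by (rule disc.hclosure_subset)
  have "ip (tensor_space \<kappa>) (elem_tensor x) h = 0"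
    if "finite J" "\<And>i. i \<in> J \<Longrightarrow> x i \<in> hclosure (disc_space (\<kappa> i)) (fvs.span (X i))" "\<And>i. i \<notin> J \<Longrightarrow> x i \<in> X i" for J x
    using that
  proof (induction J arbitrary: x rule: finite_induct)
    case empty
    then show ?case
      by (intro zero) auto
  next
    case (insert j J)
    have "ip (tensor_space \<kappa>) (elem_tensor (x(j := x j))) h = 0"
    proof (rule elem_tensor_slot_closure[OF _ h X])
      show "x i \<in> car (disc_space (\<kappa> i))" for i
        using insert.prems[of i] cl[of i] X[of i] by (cases "i \<in> insert j J") blast+
      show "ip (tensor_space \<kappa>) (elem_tensor (x(j := y))) h = 0" if "y \<in> X j" for y
        using insert.hyps insert.prems that by (intro insert.IH) auto
    qed (use insert.prems in auto)
    then show ?case by simp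
  qed
  from this[of UNIV g] show ?thesis
    using g by simp
qed

lemma elem_tensors_total:
  assumes h: "h \<in> car (tensor_space \<kappa>)"
    and zero: "\<And>f. (\<And>i. f i \<in> car (disc_space (\<kappa> i))) \<Longrightarrow> ip (tensor_space \<kappa>) (elem_tensor f) h = 0"
  shows "h = 0"
proof -
  have "ip (tensor_space \<kappa>) h h = 0"
  proof (rule tensor.orthogonal_hclosure)
    show "h \<in> hclosure (tensor_space \<kappa>) (fvs.span {elem_tensor f | f. \<forall>i. f i \<in> car (disc_space (\<kappa> i))})"
      using h hclosure_elem_tensors by blast
  qed (use h zero elem_tensor_in_tensor_space in auto)
  then show ?thesis
    using tensor.ip_definite h by blast
qed

text \<open>Raising exponent \<open>k\<close> changes the tensor weight by a ratio that depends on
  that exponent alone, so the backward shift on multi-indices is the one-variable backward shift in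
  slot \<open>k\<close>.\<close>

lemma Mcoord_adjoint_elem_tensor:
  assumes F: "F \<in> car (tensor_space \<kappa>)" and g: "\<And>i. g i \<in> car (disc_space (\<kappa> i))"
    and g': "g' \<in> car (disc_space (\<kappa> k))"
      "\<And>m. taylor_coeff g' m = of_real (weight (\<kappa> k) (Suc m) / weight (\<kappa> k) m) * taylor_coeff (g k) (Suc m)"
  shows "ip (tensor_space \<kappa>) (Mcoord k F) (elem_tensor g) = ip (tensor_space \<kappa>) F (elem_tensor (g(k := g')))"
proof (rule tshift.ip_adjoint[OF F])
  have upd: "(g(k := g')) i \<in> car (disc_space (\<kappa> i))" for i
    using g g' by simp
  show "elem_tensor g \<in> car (tensor_space \<kappa>)" "elem_tensor (g(k := g')) \<in> car (tensor_space \<kappa>)"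
    by (intro elem_tensor_in_tensor_space g upd)+
  fix \<alpha>
  let ?\<beta> = "\<alpha>(k := Suc (\<alpha> k))"
  have "coeff_of (elem_tensor (g(k := g'))) \<alpha> = (\<Prod>i\<in>UNIV. taylor_coeff ((g(k := g')) i) (\<alpha> i))"
    using coeff_of_eq[OF elem_tensor_expansion[of "g(k := g')" \<kappa>]] upd by simp
  also have "\<dots> = taylor_coeff g' (\<alpha> k) * (\<Prod>i\<in>-{k}. taylor_coeff (g i) (\<alpha> i))"
    by (rule prod_fun_upd[where g = "\<lambda>i x. taylor_coeff x (\<alpha> i)"])
  also have "\<dots> = of_real (weight (\<kappa> k) (Suc (\<alpha> k)) / weight (\<kappa> k) (\<alpha> k)) *
      (taylor_coeff (g k) (Suc (\<alpha> k)) * (\<Prod>i\<in>-{k}. taylor_coeff (g i) (\<alpha> i)))"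
    by (simp only: g'(2) mult.assoc)
  also have "taylor_coeff (g k) (Suc (\<alpha> k)) * (\<Prod>i\<in>-{k}. taylor_coeff (g i) (\<alpha> i)) = (\<Prod>i\<in>UNIV. taylor_coeff (g i) (?\<beta> i))"
    by (rule prod_fun_upd[symmetric])
  also have "\<dots> = coeff_of (elem_tensor g) ?\<beta>"
    using coeff_of_eq[OF elem_tensor_expansion[of g \<kappa>]] g by simp
  also have "weight (\<kappa> k) (Suc (\<alpha> k)) / weight (\<kappa> k) (\<alpha> k) = tensor_weight \<kappa> ?\<beta> / tensor_weight \<kappa> \<alpha>"
    using tensor_weight_pos[of \<kappa> \<alpha>] unfolding tensor_weight_ratio by simp
  finally show "coeff_of (elem_tensor (g(k := g'))) \<alpha>
      = of_real (tensor_weight \<kappa> ?\<beta> / tensor_weight \<kappa> \<alpha>) * coeff_of (elem_tensor g) ?\<beta>" .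
qed

lemma sum_enat: "(\<Sum>i\<in>I. enat (f i)) = enat (sum f I)"
  by (induction I rule: infinite_finite_induct) (auto simp: zero_enat_def)

lemma disc_monom_funpow: "disc_monom m = (M\<^sub>z ^^ m) (disc_monom 0)"
  by (auto simp: M\<^sub>z_funpow disc_monom_def)

lemma op_monomial_elem_tensor: "op_monomial Mcoord m (elem_tensor f) = elem_tensor (\<lambda>i. (M\<^sub>z ^^ m i) (f i))"
  by (simp add: op_monomial_Mcoord M\<^sub>z_funpow elem_tensor_def monom_at_def prod.distrib)

section \<open>The orthogonal complement of the tensor product of the co-invariant subspaces\<close>

context
  fixes \<kappa> :: "'n::finite \<Rightarrow> space_kind" and Q :: "'n \<Rightarrow> (complex \<Rightarrow> complex) set"
  assumes Q: "\<And>i. closed_subspace (disc_space (\<kappa> i)) (Q i)"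
    and zb: "\<And>i. zero_based (disc_space (\<kappa> i)) (orth (disc_space (\<kappa> i)) (Q i))"
    and fin: "\<And>i. hdim (ominus (disc_space (\<kappa> i)) (orth (disc_space (\<kappa> i)) (Q i))
                     (M\<^sub>z ` orth (disc_space (\<kappa> i)) (Q i))) < \<infinity>"
begin

abbreviation (input) "perp i \<equiv> orth (disc_space (\<kappa> i)) (Q i)"
abbreviation (input) "wander i \<equiv> ominus (disc_space (\<kappa> i)) (perp i) (M\<^sub>z ` perp i)"
abbreviation (input) "tensor_perp \<equiv> orth (tensor_space \<kappa>) (tensor_subspace \<kappa> Q)"

lemma Q_car: "q \<in> Q i \<Longrightarrow> q \<in> car (disc_space (\<kappa> i))"
  using disc.closed_subspaceD(1)[OF Q] by blast

lemma perp_closed: "closed_subspace (disc_space (\<kappa> i)) (perp i)" and perp_invariant: "M\<^sub>z ` perp i \<subseteq> perp i"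
  using zb[of i] by (auto simp: zero_based_def)

lemma perp_car: "f \<in> perp i \<Longrightarrow> f \<in> car (disc_space (\<kappa> i))"
  by (simp add: orth_def)

lemma wander_perp: "v \<in> wander i \<Longrightarrow> v \<in> perp i"
  by (simp add: ominus_def)

lemma ip_perp_Q: "\<lbrakk>f \<in> perp i; q \<in> Q i\<rbrakk> \<Longrightarrow> ip (disc_space (\<kappa> i)) f q = 0"
  by (simp add: orth_def)

lemma Q_I:
  assumes "q \<in> car (disc_space (\<kappa> i))" "\<And>f. f \<in> perp i \<Longrightarrow> ip (disc_space (\<kappa> i)) f q = 0"
  shows "q \<in> Q i"
proof -
  have "q \<in> orth (disc_space (\<kappa> i)) (perp i)"
    using assms perp_car by (subst disc.orth_iff) auto
  then show ?thesis
    using disc.orth_orth[OF Q] by simp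
qed

lemma elem_tensors_Q: "{elem_tensor f | f. \<forall>i. f i \<in> Q i} \<subseteq> car (tensor_space \<kappa>)"
  using elem_tensor_in_tensor_space Q_car by blast

lemma tensor_perp_iff: "F \<in> tensor_perp \<longleftrightarrow> F \<in> car (tensor_space \<kappa>) \<and> (\<forall>q. (\<forall>i. q i \<in> Q i) \<longrightarrow> ip (tensor_space \<kappa>) F (elem_tensor q) = 0)"
  unfolding tensor_subspace_def tensor.orth_hclosure_span[OF elem_tensors_Q] by (auto simp: orth_def)

lemma tensor_perp_closed: "closed_subspace (tensor_space \<kappa>) tensor_perp"
  unfolding tensor_subspace_def by (intro tensor.closed_subspace_orth tensor.hclosure_subset)

lemma elem_tensor_in_tensor_perp:
  assumes f: "\<And>i. f i \<in> car (disc_space (\<kappa> i))" and j: "f j \<in> perp j"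
  shows "elem_tensor f \<in> tensor_perp"
  unfolding tensor_perp_iff
proof (intro conjI allI impI elem_tensor_in_tensor_space f)
  fix q assume q: "\<forall>i. q i \<in> Q i"
  have "(\<Prod>i\<in>UNIV. ip (disc_space (\<kappa> i)) (f i) (q i)) = 0"
    using ip_perp_Q[OF j] q by (intro prod_zero) auto
  then show "ip (tensor_space \<kappa>) (elem_tensor f) (elem_tensor q) = 0"
    using q Q_car by (subst ip_elem_tensor[OF f]) auto
qed

text \<open>Dually, the adjoint of \<open>Mcoord k\<close> replaces \<open>q k\<close> by its
  backward shift \<open>q'\<close>. This stays in \<open>Q k\<close>, the complement of
  \<open>perp k\<close>, because \<open>perp k\<close> is invariant under
  \<open>M\<^sub>z\<close>.\<close>

lemma tensor_perp_invariant:
  assumes F: "F \<in> tensor_perp"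
  shows "Mcoord k F \<in> tensor_perp"
  unfolding tensor_perp_iff
proof (intro conjI allI impI)
  have Fc: "F \<in> car (tensor_space \<kappa>)"
    using F by (simp add: tensor_perp_iff)
  then show "Mcoord k F \<in> car (tensor_space \<kappa>)"
    by (rule Mcoord_in_tensor_space)
  fix q assume q: "\<forall>i. q i \<in> Q i"
  have qc: "q i \<in> car (disc_space (\<kappa> i))" for i
    using q Q_car by blast
  obtain q' where q': "q' \<in> car (disc_space (\<kappa> k))"
    "\<And>m. taylor_coeff q' m = of_real (weight (\<kappa> k) (Suc m) / weight (\<kappa> k) m) * taylor_coeff (q k) (Suc m)"
    using disc.adjoint_exists[OF qc] by blast
  have "q' \<in> Q k"
  proof (rule Q_I[OF q'(1)])
    fix f assume f: "f \<in> perp k"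
    then have "ip (disc_space (\<kappa> k)) f q' = ip (disc_space (\<kappa> k)) (M\<^sub>z f) (q k)"
      using disc.ip_adjoint[OF perp_car qc q'] by simp
    also have "\<dots> = 0"
      using f perp_invariant q by (intro ip_perp_Q) auto
    finally show "ip (disc_space (\<kappa> k)) f q' = 0" .
  qed
  then have "\<forall>i. (q(k := q')) i \<in> Q i"
    using q by simp
  then have "ip (tensor_space \<kappa>) F (elem_tensor (q(k := q'))) = 0"
    using F unfolding tensor_perp_iff by blast
  then show "ip (tensor_space \<kappa>) (Mcoord k F) (elem_tensor q) = 0"
    using Mcoord_adjoint_elem_tensor[where g = q, OF Fc qc q'] by simp
qed

lemma hclosure_Q_perp: "hclosure (disc_space (\<kappa> i)) (fvs.span (Q i \<union> perp i)) = car (disc_space (\<kappa> i))"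
proof (rule disc.hclosure_span_eq_car)
  show "Q i \<union> perp i \<subseteq> car (disc_space (\<kappa> i))"
    using Q_car perp_car by blast
  fix h assume h: "h \<in> car (disc_space (\<kappa> i))" and 0: "\<And>x. x \<in> Q i \<union> perp i \<Longrightarrow> ip (disc_space (\<kappa> i)) x h = 0"
  have "h \<in> Q i"
    using h 0 by (intro Q_I) auto
  then have "ip (disc_space (\<kappa> i)) h h = 0"
    using 0 by blast
  then show "h = 0"
    by (rule disc.ip_definite[OF h])
qed

abbreviation (input) "slot i b \<equiv> elem_tensor ((\<lambda>_. disc_monom 0)(i := b))"

lemma slot_in_tensor_perp:
  assumes "b \<in> perp i"
  shows "slot i b \<in> tensor_perp"
  by (rule elem_tensor_in_tensor_perp[of _ i]) (use assms perp_car disc_monom_in_disc_space in auto)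

text \<open>By duality, let \<open>h\<close> in \<open>tensor_perp\<close> be orthogonal to all
  monomials applied to slot functions. Those are the tensors with \<open>(M\<^sub>z ^^ k) b\<close>
  in slot \<open>j\<close> and powers of z elsewhere, so passing to closed spans slot by slot makes
  \<open>h\<close> orthogonal to every elementary tensor with an entry from some
  \<open>perp j\<close>. If all entries are split along \<open>Q i\<close> and
  \<open>perp i\<close>, only tensors with every entry in \<open>Q i\<close> remain, and to these
  \<open>h\<close> is orthogonal by membership in \<open>tensor_perp\<close>.\<close>

lemma generated_slots:
  assumes B: "\<And>i. B i \<subseteq> wander i" "\<And>i. wander i \<subseteq> fvs.span (B i)"
  shows "generated (restr (tensor_space \<kappa>) tensor_perp) Mcoord (\<Union>i. slot i ` B i) = car (restr (tensor_space \<kappa>) tensor_perp)"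
proof -
  interpret R: hilbert "restr (tensor_space \<kappa>) tensor_perp"
    by (rule tensor.hilbert_restr[OF tensor_perp_closed])
  have BS: "b \<in> perp i" if "b \<in> B i" for b i
    using B(1) wander_perp that by blast
  have pow: "op_monomial Mcoord m g \<in> tensor_perp" if "g \<in> (\<Union>i. slot i ` B i)" for m g
  proof -
    have gR: "g \<in> tensor_perp"
      using that slot_in_tensor_perp BS by blast
    show ?thesis
    proof (rule op_monomial_induct[where P = "\<lambda>F. F \<in> tensor_perp"])
      show "Mcoord i \<circ> Mcoord j = Mcoord j \<circ> Mcoord i" for i j :: 'n
        by (simp add: fun_eq_iff Mcoord_def)
    qed (rule gR, erule tensor_perp_invariant)
  qed
  show ?thesis
  proof (rule R.generated_eq_carI)
    show "op_monomial Mcoord m g \<in> car (restr (tensor_space \<kappa>) tensor_perp)" if "g \<in> (\<Union>i. slot i ` B i)" for m g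
      using pow[OF that] by simp
    fix h assume "h \<in> car (restr (tensor_space \<kappa>) tensor_perp)"
      and "\<And>m g. g \<in> (\<Union>i. slot i ` B i) \<Longrightarrow> ip (restr (tensor_space \<kappa>) tensor_perp) (op_monomial Mcoord m g) h = 0"
    then have h: "h \<in> tensor_perp" and 0: "\<And>m i b. b \<in> B i \<Longrightarrow> ip (tensor_space \<kappa>) (op_monomial Mcoord m (slot i b)) h = 0"
      by auto
    have hc: "h \<in> car (tensor_space \<kappa>)"
      using h by (simp add: tensor_perp_iff)
    have zero_perp: "ip (tensor_space \<kappa>) (elem_tensor f) h = 0"
      if f: "\<And>i. f i \<in> car (disc_space (\<kappa> i))" and j: "f j \<in> perp j" for f j
    proof (rule elem_tensor_closure[OF hc])
      let ?X = "\<lambda>i. if i = j then {(M\<^sub>z ^^ k) b | k b. b \<in> B j} else range disc_monom"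
      show "?X i \<subseteq> car (disc_space (\<kappa> i))" for i
        using BS perp_car by (auto simp: disc_monom_in_disc_space intro!: M\<^sub>z_funpow_car)
      show "f i \<in> hclosure (disc_space (\<kappa> i)) (fvs.span (?X i))" for i
        using f[of i] j invariant_subspace_subset_hclosure[OF perp_closed perp_invariant B]
        by (auto simp: hclosure_disc_monoms)
      fix x assume x: "\<And>i. x i \<in> ?X i"
      obtain k b where kb: "b \<in> B j" "x j = (M\<^sub>z ^^ k) b"
        using x[of j] by auto
      have "\<exists>m. x i = disc_monom m" if "i \<noteq> j" for i
        using x[of i] that by auto
      then obtain m where m: "\<And>i. i \<noteq> j \<Longrightarrow> x i = disc_monom (m i)"
        by metis
      have "x i = (M\<^sub>z ^^ ((m(j := k)) i)) (((\<lambda>_. disc_monom 0)(j := b)) i)" for i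
        using kb m[of i] by (cases "i = j") (simp_all flip: disc_monom_funpow)
      then have "elem_tensor x = op_monomial Mcoord (m(j := k)) (slot j b)"
        unfolding op_monomial_elem_tensor by (metis (no_types, lifting) ext)
      then show "ip (tensor_space \<kappa>) (elem_tensor x) h = 0"
        using 0[OF kb(1)] by simp
    qed
    show "h = 0"
    proof (rule elem_tensors_total[OF hc])
      fix f assume f: "\<And>i. f i \<in> car (disc_space (\<kappa> i))"
      show "ip (tensor_space \<kappa>) (elem_tensor f) h = 0"
      proof (rule elem_tensor_closure[OF hc])
        show "Q i \<union> perp i \<subseteq> car (disc_space (\<kappa> i))" for i
          using Q_car perp_car by blast
        show "f i \<in> hclosure (disc_space (\<kappa> i)) (fvs.span (Q i \<union> perp i))" for i
          unfolding hclosure_Q_perp by (rule f)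
        fix x assume x: "\<And>i. x i \<in> Q i \<union> perp i"
        then have xc: "x i \<in> car (disc_space (\<kappa> i))" for i
          using Q_car perp_car by blast
        show "ip (tensor_space \<kappa>) (elem_tensor x) h = 0"
        proof (cases "\<exists>j. x j \<in> perp j")
          case True
          then show ?thesis
            using zero_perp[OF xc] by blast
        next
          case False
          then have "\<forall>i. x i \<in> Q i"
            using x by blast
          then have "ip (tensor_space \<kappa>) h (elem_tensor x) = 0"
            using h unfolding tensor_perp_iff by blast
          then show ?thesis
            using tensor.ip_eq_0_commute[OF hc elem_tensor_in_tensor_space[of x \<kappa>, OF xc]] by blast
        qed
      qed
    qed
  qed
qed

text \<open>The common zeros \<open>w i\<close> of \<open>perp i\<close> enter here: the kernel functions at \<open>w j\<close> belong to \<open>Q j\<close>, so the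
  vectors with an eigenvector of the compressed adjoint in slot \<open>i\<close> and kernel functions in the other
  slots are joint eigenvectors of the compressed adjoint tuple, all for the same eigenvalue.\<close>

lemma card_le_generating_slots:
  assumes B: "\<And>i. B i \<subseteq> wander i" "\<And>i. finite (B i)" "\<And>i. fvs.independent (B i)"
    and G: "G \<subseteq> car (restr (tensor_space \<kappa>) tensor_perp)"
      "generated (restr (tensor_space \<kappa>) tensor_perp) Mcoord G = car (restr (tensor_space \<kappa>) tensor_perp)"
  shows "enat (\<Sum>i\<in>UNIV. card (B i)) \<le> ecard G"
proof -
  interpret R: hilbert "restr (tensor_space \<kappa>) tensor_perp"
    by (rule tensor.hilbert_restr[OF tensor_perp_closed])
  have "\<exists>w\<in>ball 0 1. \<forall>f\<in>perp i. f w = 0" for i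
    using zb[of i] by (simp add: zero_based_def)
  then obtain w where w: "\<And>i. w i \<in> ball 0 1" and w0: "\<And>i f. f \<in> perp i \<Longrightarrow> f (w i) = 0"
    by metis
  have "\<exists>k\<in>car (disc_space (\<kappa> i)). \<forall>f\<in>car (disc_space (\<kappa> i)). ip (disc_space (\<kappa> i)) f k = f (w i)" for i
    using reproducing_kernel[OF w] by metis
  then obtain K where K: "\<And>i. K i \<in> car (disc_space (\<kappa> i))"
      "\<And>i f. f \<in> car (disc_space (\<kappa> i)) \<Longrightarrow> ip (disc_space (\<kappa> i)) f (K i) = f (w i)"
    by metis
  have KQ: "K i \<in> Q i" for i
    by (rule Q_I[OF K(1)]) (simp add: K(2) perp_car w0)
  define P where "P i b u \<longleftrightarrow> u \<in> perp i \<and>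
      (\<forall>f\<in>perp i. ip (disc_space (\<kappa> i)) (M\<^sub>z f) u = w i * ip (disc_space (\<kappa> i)) f u) \<and>
      (\<forall>v\<in>wander i. ip (disc_space (\<kappa> i)) v u = ip (disc_space (\<kappa> i)) v b)" for i b u
  define e where "e i b = (SOME u. P i b u)" for i b
  have "P i b (e i b)" if "b \<in> B i" for i b
  proof -
    have b: "b \<in> wander i" "cmod (w i) < 1"
      using that B(1) w[of i] by auto
    have "\<exists>u. P i b u"
      by (rule wandering_eigenvector[OF perp_closed perp_invariant b]) (auto simp: P_def)
    then show ?thesis
      unfolding e_def by (rule someI_ex)
  qed
  then have e: "\<And>i b. b \<in> B i \<Longrightarrow> e i b \<in> perp i"
      "\<And>i b f. \<lbrakk>b \<in> B i; f \<in> perp i\<rbrakk> \<Longrightarrow> ip (disc_space (\<kappa> i)) (M\<^sub>z f) (e i b) = w i * ip (disc_space (\<kappa> i)) f (e i b)"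
      "\<And>i b v. \<lbrakk>b \<in> B i; v \<in> wander i\<rbrakk> \<Longrightarrow> ip (disc_space (\<kappa> i)) v (e i b) = ip (disc_space (\<kappa> i)) v b"
    unfolding P_def by blast+
  define x where "x i b = K(i := e i b)" for i b
  have xc: "x i b j \<in> car (disc_space (\<kappa> j))" if "b \<in> B i" for i b j
    using K(1) e(1)[OF that] perp_car by (simp add: x_def)
  define I where "I = Sigma UNIV B"
  have I: "finite I" "card I = (\<Sum>i\<in>UNIV. card (B i))"
    using B(2) by (auto simp: I_def)
  let ?v = "\<lambda>(i, b). elem_tensor (x i b)"
  have "enat (card I) \<le> ecard G"
  proof (rule R.card_le_generating_set[where v = ?v and K = "tensor_space \<kappa>" and \<mu> = w])
    show "Mcoord i \<circ> Mcoord j = Mcoord j \<circ> Mcoord i" for i j :: 'n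
      by (simp add: fun_eq_iff Mcoord_def)
    show "Mcoord i F \<in> car (restr (tensor_space \<kappa>) tensor_perp)" if "F \<in> car (restr (tensor_space \<kappa>) tensor_perp)" for i F
      using tensor_perp_invariant that by simp
    show "?v a \<in> car (tensor_space \<kappa>)" if "a \<in> I" for a
      using that xc by (auto simp: I_def intro!: elem_tensor_in_tensor_space)
  next
    fix k F a assume "F \<in> car (restr (tensor_space \<kappa>) tensor_perp)" and a: "a \<in> I"
    then have F_perp: "F \<in> tensor_perp"
      by simp
    then have Fc: "F \<in> car (tensor_space \<kappa>)"
      by (simp add: tensor_perp_iff)
    obtain i b where ib: "a = (i, b)" "b \<in> B i"
      using a by (auto simp: I_def)
    obtain y where y: "y \<in> car (disc_space (\<kappa> k))"
        "\<And>m. taylor_coeff y m = of_real (weight (\<kappa> k) (Suc m) / weight (\<kappa> k) m) * taylor_coeff (x i b k) (Suc m)"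
      using disc.adjoint_exists[OF xc[OF ib(2)]] by blast
    have ip_y: "ip (disc_space (\<kappa> k)) f y = ip (disc_space (\<kappa> k)) (M\<^sub>z f) (x i b k)" if "f \<in> car (disc_space (\<kappa> k))" for f
      using disc.ip_adjoint[OF that xc[OF ib(2)] y] by simp
    \<comment> \<open>\<open>q\<close> measures how far \<open>x i b k\<close> is from an
      eigenvector of the adjoint of \<open>M\<^sub>z\<close>. For \<open>k = i\<close> it lies in
      \<open>Q k\<close>, and as all other slots hold kernel functions, the whole tensor is
      orthogonal to \<open>F\<close>; for other \<open>k\<close> the slot holds a kernel function, a
      true eigenvector, and \<open>q = 0\<close>.\<close>
    define q where "q = y - (\<lambda>z. cnj (w k) * x i b k z)"
    have qc: "q \<in> car (disc_space (\<kappa> k))"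
      using y(1) xc[OF ib(2)] by (simp add: q_def)
    have ip_q: "ip (disc_space (\<kappa> k)) f q = ip (disc_space (\<kappa> k)) (M\<^sub>z f) (x i b k) - w k * ip (disc_space (\<kappa> k)) f (x i b k)"
      if "f \<in> car (disc_space (\<kappa> k))" for f
      using that y(1) xc[OF ib(2)] by (simp add: q_def ip_y)
    have upd_c: "((x i b)(k := u)) j \<in> car (disc_space (\<kappa> j))" if "u \<in> car (disc_space (\<kappa> k))" for u j
      using xc[OF ib(2)] that by simp
    have zero: "ip (tensor_space \<kappa>) F (elem_tensor ((x i b)(k := q))) = 0"
    proof (cases "k = i")
      case True
      have "q \<in> Q k"
      proof (rule Q_I[OF qc])
        fix f assume f: "f \<in> perp k"
        have "x i b k = e k b" "b \<in> B k"
          using True ib(2) by (simp_all add: x_def)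
        then show "ip (disc_space (\<kappa> k)) f q = 0"
          using ip_q[OF perp_car[OF f]] e(2)[OF _ f, of b] by simp
      qed
      then have "\<forall>j. ((x i b)(k := q)) j \<in> Q j"
        using True KQ by (simp add: x_def)
      then show ?thesis
        using F_perp unfolding tensor_perp_iff by blast
    next
      case False
      have "ip (disc_space (\<kappa> k)) q q = 0"
        using ip_q[OF qc] False K(2)[OF qc] K(2)[OF disc.T_car[OF qc]] by (simp add: x_def M\<^sub>z_def)
      then have "q = 0"
        by (rule disc.ip_definite[OF qc])
      then have "elem_tensor ((x i b)(k := q)) = 0"
        by (simp add: fun_eq_iff elem_tensor_fun_upd)
      then show ?thesis
        using Fc by simp
    qed
    have "ip (tensor_space \<kappa>) (Mcoord k F) (elem_tensor (x i b)) = ip (tensor_space \<kappa>) F (elem_tensor ((x i b)(k := y)))"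
      by (rule Mcoord_adjoint_elem_tensor[OF Fc xc[OF ib(2)] y])
    also have "elem_tensor ((x i b)(k := y)) = elem_tensor ((x i b)(k := q)) + (\<lambda>z. cnj (w k) * elem_tensor (x i b) z)"
    proof
      fix z
      have "elem_tensor (x i b) z = x i b k (z $ k) * (\<Prod>j\<in>-{k}. x i b j (z $ j))"
        using elem_tensor_fun_upd[of "x i b" k "x i b k" z] by simp
      then show "elem_tensor ((x i b)(k := y)) z = (elem_tensor ((x i b)(k := q)) + (\<lambda>z. cnj (w k) * elem_tensor (x i b) z)) z"
        by (simp add: elem_tensor_fun_upd q_def algebra_simps)
    qed
    also have "ip (tensor_space \<kappa>) F \<dots> = w k * ip (tensor_space \<kappa>) F (elem_tensor (x i b))"
      using zero Fc elem_tensor_in_tensor_space[of "x i b" \<kappa>, OF xc[OF ib(2)]]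
        elem_tensor_in_tensor_space[of "(x i b)(k := q)" \<kappa>, OF upd_c[OF qc]] by simp
    finally show "ip (tensor_space \<kappa>) (Mcoord k F) (?v a) = w k * ip (tensor_space \<kappa>) F (?v a)"
      by (simp add: ib)
  next
    fix c a assume zero: "\<And>F. F \<in> car (restr (tensor_space \<kappa>) tensor_perp) \<Longrightarrow> (\<Sum>a\<in>I. c a * ip (tensor_space \<kappa>) F (?v a)) = 0"
      and a: "a \<in> I"
    obtain i0 b0 where a_eq: "a = (i0, b0)" "b0 \<in> B i0"
      using a by (auto simp: I_def)
    have "c (i0, b0) = 0"
    proof (rule disc.wandering_coeffs_zero[OF B(2,3,1) _ _ e(3) _ a_eq(2), where c = "\<lambda>b. c (i0, b)"])
      show "wander i0 \<subseteq> car (disc_space (\<kappa> i0))"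
        using wander_perp perp_car by blast
      show "fvs.subspace (wander i0)"
        by (rule subspace_wandering[OF perp_closed perp_invariant])
      fix u assume u: "u \<in> wander i0"
      note uc = perp_car[OF wander_perp[OF u]]
      \<comment> \<open>The tests \<open>slot i0 u\<close> separate the blocks: a vector from
        another block has the kernel function in slot \<open>i0\<close>, which evaluates
        \<open>u\<close> at its zero \<open>w i0\<close>. Within the block, the kernel functions
        evaluate the constant 1.\<close>
      have ip_slot: "ip (tensor_space \<kappa>) (slot i0 u) (elem_tensor (x i b)) =
          (if i = i0 then ip (disc_space (\<kappa> i0)) u (e i0 b) else 0)" if b: "b \<in> B i" for i b
      proof -
        have "ip (tensor_space \<kappa>) (slot i0 u) (elem_tensor (x i b)) = ip (disc_space (\<kappa> i0)) u (x i b i0) *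
            (\<Prod>j\<in>-{i0}. ip (disc_space (\<kappa> j)) (disc_monom 0) (x i b j))"
          by (rule ip_elem_tensor_fun_upd) (use disc_monom_in_disc_space xc[OF b] uc in auto)
        also have "\<dots> = (if i = i0 then ip (disc_space (\<kappa> i0)) u (e i0 b) else 0)"
        proof (cases "i = i0")
          case True
          have "(\<Prod>j\<in>-{i0}. ip (disc_space (\<kappa> j)) (disc_monom 0) (x i b j)) = (\<Prod>j\<in>-{i0}. 1)"
            using True w by (intro prod.cong) (auto simp: x_def K(2) disc_monom_in_disc_space disc_monom_def)
          then show ?thesis
            using True by (simp add: x_def)
        next
          case False
          then show ?thesis
            using w0[OF wander_perp[OF u]] by (simp add: x_def K(2)[OF uc])
        qed
        finally show ?thesis .
      qed
      have "0 = (\<Sum>a\<in>I. c a * ip (tensor_space \<kappa>) (slot i0 u) (?v a))"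
        using zero slot_in_tensor_perp[OF wander_perp[OF u]] by simp
      also have "\<dots> = (\<Sum>(i, b)\<in>I. c (i, b) * ip (tensor_space \<kappa>) (slot i0 u) (elem_tensor (x i b)))"
        by (intro sum.cong) auto
      also have "\<dots> = (\<Sum>i\<in>UNIV. \<Sum>b\<in>B i. c (i, b) * ip (tensor_space \<kappa>) (slot i0 u) (elem_tensor (x i b)))"
        unfolding I_def by (rule sum.Sigma[symmetric]) (use B(2) in auto)
      also have "\<dots> = (\<Sum>i\<in>UNIV. if i = i0 then \<Sum>b\<in>B i0. c (i0, b) * ip (disc_space (\<kappa> i0)) u (e i0 b) else 0)"
        by (intro sum.cong) (auto simp: ip_slot)
      finally show "(\<Sum>b\<in>B i0. c (i0, b) * ip (disc_space (\<kappa> i0)) u (e i0 b)) = 0"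
        by simp
    qed
    then show "c a = 0"
      by (simp add: a_eq)
  qed (fact G | simp add: I tensor_perp_closed tensor.hilbert_axioms)+
  then show ?thesis
    by (simp add: I)
qed

lemma hmult_tensor:
  "hmult (restr (tensor_space \<kappa>) tensor_perp) Mcoord = (\<Sum>i\<in>UNIV. hdim (wander i))"
proof -
  have "\<exists>B. B \<subseteq> wander i \<and> finite B \<and> fvs.independent B \<and> wander i \<subseteq> fvs.span B \<and> hdim (wander i) = enat (card B)" for i
    using hdim_basis[OF fin] by metis
  then obtain B where B: "\<And>i. B i \<subseteq> wander i" "\<And>i. finite (B i)" "\<And>i. fvs.independent (B i)"
      "\<And>i. wander i \<subseteq> fvs.span (B i)" "\<And>i. hdim (wander i) = enat (card (B i))"
    by metis
  let ?G = "\<Union>i. slot i ` B i"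
  have G: "?G \<subseteq> tensor_perp"
    using slot_in_tensor_perp wander_perp B(1) by blast
  \<comment> \<open>An upper bound is enough here: coincidences among slot functions could only
    shrink the set, and the lower bound excludes that.\<close>
  have "card ?G \<le> (\<Sum>i\<in>UNIV. card (slot i ` B i))"
    by (rule card_UN_le) simp
  also have "\<dots> \<le> (\<Sum>i\<in>UNIV. card (B i))"
    by (intro sum_mono card_image_le B)
  finally have card: "ecard ?G \<le> enat (\<Sum>i\<in>UNIV. card (B i))"
    using B(2) by (simp add: ecard_def)
  have "hmult (restr (tensor_space \<kappa>) tensor_perp) Mcoord = enat (\<Sum>i\<in>UNIV. card (B i))"
    unfolding hmult_def
  proof (rule antisym)
    show "Inf {ecard G |G. G \<subseteq> car (restr (tensor_space \<kappa>) tensor_perp) \<and>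
        generated (restr (tensor_space \<kappa>) tensor_perp) Mcoord G = car (restr (tensor_space \<kappa>) tensor_perp)}
        \<le> enat (\<Sum>i\<in>UNIV. card (B i))"
      using G generated_slots[OF B(1,4)] by (intro order_trans[OF Inf_lower card]) auto
  qed (auto intro!: Inf_greatest card_le_generating_slots[OF B(1-3)])
  then show ?thesis
    by (simp add: B(5) sum_enat)
qed

end

theorem corollary5p4:
  fixes \<kappa> :: "'n::finite \<Rightarrow> space_kind"
    and Q :: "'n \<Rightarrow> (complex \<Rightarrow> complex) set"
  assumes "CARD('n) \<ge> 2"
    and "\<And>i. closed_subspace (disc_space (\<kappa> i)) (Q i)"
    and "\<And>i. Q i \<noteq> car (disc_space (\<kappa> i))"
    and "\<And>i. hadjoint (disc_space (\<kappa> i)) M\<^sub>z ` Q i \<subseteq> Q i"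
    and "\<And>i. zero_based (disc_space (\<kappa> i)) (orth (disc_space (\<kappa> i)) (Q i))"
    and "\<And>i. hdim (ominus (disc_space (\<kappa> i)) (orth (disc_space (\<kappa> i)) (Q i))
                     (M\<^sub>z ` orth (disc_space (\<kappa> i)) (Q i))) < \<infinity>"
  shows "hmult (restr (tensor_space \<kappa>) (orth (tensor_space \<kappa>) (tensor_subspace \<kappa> Q))) Mcoord
           = (\<Sum>i\<in>UNIV. hmult (restr (disc_space (\<kappa> i)) (orth (disc_space (\<kappa> i)) (Q i))) (\<lambda>_::unit. M\<^sub>z))
       \<and> (\<Sum>i\<in>UNIV. hmult (restr (disc_space (\<kappa> i)) (orth (disc_space (\<kappa> i)) (Q i))) (\<lambda>_::unit. M\<^sub>z))
           = (\<Sum>i\<in>UNIV. hdim (ominus (disc_space (\<kappa> i)) (orth (disc_space (\<kappa> i)) (Q i))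
                     (M\<^sub>z ` orth (disc_space (\<kappa> i)) (Q i))))"
proof -
  have "hmult (restr (disc_space (\<kappa> i)) (orth (disc_space (\<kappa> i)) (Q i))) (\<lambda>_::unit. M\<^sub>z)
      = hdim (ominus (disc_space (\<kappa> i)) (orth (disc_space (\<kappa> i)) (Q i)) (M\<^sub>z ` orth (disc_space (\<kappa> i)) (Q i)))" for i
    using assms(5)[of i] by (intro hmult_invariant_subspace assms(6)) (auto simp: zero_based_def)
  then show ?thesis
    using hmult_tensor[OF assms(2,5,6)] by simp
qed

end
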